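(* Let $(E_6)^{\lambda\gamma}=\{\alpha\in E_6\mid \lambda(\gamma\alpha\gamma)=\alpha\}$ and $(E_6)^{\lambda\gamma\gamma_C}=\{\alpha\in E_6\mid \lambda(\gamma\gamma_C\,\alpha\,\gamma_C\gamma)=\alpha\}$. Then $$(E_6)^{\lambda\gamma}\cap (E_6)^{\lambda\gamma\gamma_C}\;\cong\;\big((U(1)\times SO(6))/\mathbf{Z}_2\big)\rtimes\mathcal{Z}_2,$$ where $\mathbf{Z}_2=\{(1,E),(-1,-E)\}$ and $\mathcal{Z}_2=\{1,\gamma_H\}$ is the group of order $2$ generated by $\gamma_H$, acting through $\gamma_H(a,A)=(\overline{a},(iI)A(iI)^{-1})$ with $I=\mathrm{diag}(1,-1,1,-1,1,-1)$.
   Context: Let $\mathbf{H}$ be the quaternions with basis $1,e_1,e_2,e_3=e_1e_2$, $\mathbf{C}=\mathbf{R}\oplus\mathbf{R}e_1$, $\mathbf{H}=\mathbf{C}\oplus\mathbf{C}e_2$, and $\mathfrak{C}=\mathbf{H}\oplus\mathbf{H}e_4$ the division Cayley algebra with product $(m+ae_4)(n+be_4)=(mn-\overline{b}a)+(a\overline{n}+bm)e_4$. Let $\mathfrak{J}=\{X\in M(3,\mathfrak{C})\mid X^*=X\}$ and let $\mathfrak{J}^C=\mathfrak{J}\oplus i\mathfrak{J}$ be its complexification ($C=\mathbf{R}\oplus\mathbf{R}i$), with $X\circ Y=\frac12(XY+YX)$, $(X,Y)=\mathrm{tr}(X\circ Y)$, $X\times Y=\frac12\big(2X\circ Y-\mathrm{tr}(X)Y-\mathrm{tr}(Y)X+(\mathrm{tr}(X)\mathrm{tr}(Y)-(X,Y))E\big)$,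 $\det X=\frac13(X,X\times X)$, complex conjugation $\tau(X+iY)=X-iY$ ($X,Y\in\mathfrak{J}$), and $\langle X,Y\rangle=(\tau X,Y)$. Then $E_6=\{\alpha\in\mathrm{Iso}_C(\mathfrak{J}^C)\mid \det\alpha X=\det X,\ \langle\alpha X,\alpha Y\rangle=\langle X,Y\rangle\}$. $\lambda$ is the involutive automorphism of $E_6$ given by $\lambda(\alpha)={}^t\alpha^{-1}=\tau\alpha\tau$ (transpose with respect to $(X,Y)$). On $\mathfrak{C}$ define $\gamma(x+ye_4)=x-ye_4$ ($x,y\in\mathbf{H}$); on $\mathbf{H}$ put $\gamma_H(a+be_2)=a-be_2$, $\gamma_C(a+be_2)=\overline a+\overline be_2$ ($a,b\in\mathbf{C}$), extended by $\gamma_H(x+ye_4)=\gamma_Hx+(\gamma_Hy)e_4$, $\gamma_C(x+ye_4)=\gamma_Cx+(\gamma_Cy)e_4$. Acting entrywise and $C$-linearly on $\mathfrak{J}^C$ these give involutive elements $\gamma,\gamma_H,\gamma_C\in E_6$. Here $U(1)=\{a=x+ye_2\mid x,y\in\mathbf{R},\ \overline aa=1\}$, isomorphic to the usual $U(1)$. The action of $\mathcal{Z}_2$ on $U(1)\times SO(6)$ induces the action on the quotient. *)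

theory Defs
  imports "HOL-Analysis.Analysis" "HOL-Algebra.Coset" "HOL-Algebra.Bij"
begin

section \<open>Quaternions and the division Cayley algebra\<close>

text \<open>
  The pair \<open>(a, b)\<close> of complex numbers is \<open>a + b e2\<close>, with the imaginary unit of \<^typ>\<open>complex\<close> in
  the role of \<open>e1\<close>; the pair \<open>(m, a)\<close> of quaternions is \<open>m + a e4\<close>. Addition, real scalar
  multiplication and topology are those of the product types.
\<close>

type_synonym quat = "complex \<times> complex"
type_synonym cayley = "quat \<times> quat"

text \<open>The product follows from \<open>e2 c = cnj c e2\<close> for complex \<open>c\<close>, and \<open>e2 e2 = -1\<close>.\<close>

definition hmult :: "quat \<Rightarrow> quat \<Rightarrow> quat" where
  "hmult = (\<lambda>(a, b) (c, d). (a * c - b * cnj d, a * d + b * cnj c))"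

definition hcnj :: "quat \<Rightarrow> quat" where
  "hcnj = (\<lambda>(a, b). (cnj a, - b))"

definition cay_mult :: "cayley \<Rightarrow> cayley \<Rightarrow> cayley" where
  "cay_mult = (\<lambda>(m, a) (n, b). (hmult m n - hmult (hcnj b) a, hmult a (hcnj n) + hmult b m))"

definition cay_cnj :: "cayley \<Rightarrow> cayley" where
  "cay_cnj = (\<lambda>(m, a). (hcnj m, - a))"

definition cay_one :: cayley where
  "cay_one = ((1, 0), (0, 0))"

definition cay_Re :: "cayley \<Rightarrow> real" where
  "cay_Re x = Re (fst (fst x))"

definition cay_gamma :: "cayley \<Rightarrow> cayley" where
  "cay_gamma = (\<lambda>(x, y). (x, - y))"

definition quat_gammaH :: "quat \<Rightarrow> quat" where
  "quat_gammaH = (\<lambda>(a, b). (a, - b))"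

definition quat_gammaC :: "quat \<Rightarrow> quat" where
  "quat_gammaC = (\<lambda>(a, b). (cnj a, cnj b))"

definition cay_gammaH :: "cayley \<Rightarrow> cayley" where
  "cay_gammaH = (\<lambda>(x, y). (quat_gammaH x, quat_gammaH y))"

definition cay_gammaC :: "cayley \<Rightarrow> cayley" where
  "cay_gammaC = (\<lambda>(x, y). (quat_gammaC x, quat_gammaC y))"


section \<open>The exceptional Jordan algebra and its complexification\<close>

type_synonym cmat3 = "cayley ^ 3 ^ 3"

definition cmat_mult :: "cmat3 \<Rightarrow> cmat3 \<Rightarrow> cmat3" where
  "cmat_mult X Y = (\<chi> i j. \<Sum>k\<in>UNIV. cay_mult (X $ i $ k) (Y $ k $ j))"

definition cmat_adj :: "cmat3 \<Rightarrow> cmat3" where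
  "cmat_adj X = (\<chi> i j. cay_cnj (X $ j $ i))"

definition cmat_one :: cmat3 where
  "cmat_one = (\<chi> i j. if i = j then cay_one else 0)"

definition J :: "cmat3 set" where
  "J = {X. cmat_adj X = X}"

definition jordan :: "cmat3 \<Rightarrow> cmat3 \<Rightarrow> cmat3" where
  "jordan X Y = (1 / 2) *\<^sub>R (cmat_mult X Y + cmat_mult Y X)"

text \<open>On \<^const>\<open>J\<close> the diagonal entries are real, so that taking real parts loses nothing.\<close>

definition trJ :: "cmat3 \<Rightarrow> real" where
  "trJ X = (\<Sum>i\<in>UNIV. cay_Re (X $ i $ i))"

text \<open>
  The pair \<open>(X, Y)\<close> is \<open>X + iY\<close>. The scalars \<open>C = R + Ri\<close> are again modelled by \<^typ>\<open>complex\<close>, but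
  this \<open>i\<close> is unrelated to the Cayley unit \<open>e1\<close>. Jordan product and trace are the \<open>C\<close>-bilinear,
  respectively \<open>C\<close>-linear, extensions of those on \<^const>\<open>J\<close>.
\<close>

type_synonym jc = "cmat3 \<times> cmat3"

definition JC :: "jc set" where
  "JC = J \<times> J"

definition cscale :: "complex \<Rightarrow> jc \<Rightarrow> jc" (infixr "*\<^sub>c" 75) where
  "c *\<^sub>c X = (Re c *\<^sub>R fst X - Im c *\<^sub>R snd X, Re c *\<^sub>R snd X + Im c *\<^sub>R fst X)"

definition jordanC :: "jc \<Rightarrow> jc \<Rightarrow> jc" where
  "jordanC = (\<lambda>(X, X') (Y, Y'). (jordan X Y - jordan X' Y', jordan X Y' + jordan X' Y))"

definition trC :: "jc \<Rightarrow> complex" where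
  "trC = (\<lambda>(X, X'). Complex (trJ X) (trJ X'))"

definition oneC :: jc where
  "oneC = (cmat_one, 0)"

definition formC :: "jc \<Rightarrow> jc \<Rightarrow> complex" where
  "formC X Y = trC (jordanC X Y)"

definition crossC :: "jc \<Rightarrow> jc \<Rightarrow> jc" where
  "crossC X Y = (1 / 2) *\<^sub>c (2 *\<^sub>c jordanC X Y - trC X *\<^sub>c Y - trC Y *\<^sub>c X
     + (trC X * trC Y - formC X Y) *\<^sub>c oneC)"

definition detC :: "jc \<Rightarrow> complex" where
  "detC X = (1 / 3) * formC X (crossC X X)"

definition tau :: "jc \<Rightarrow> jc" where
  "tau = (\<lambda>X\<in>JC. (fst X, - snd X))"

definition hermC :: "jc \<Rightarrow> jc \<Rightarrow> complex" where
  "hermC X Y = formC (tau X) Y"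


section \<open>The group E6\<close>

text \<open>
  Self-maps of \<^const>\<open>JC\<close> are extensional functions, as in \<^const>\<open>BijGroup\<close>.
\<close>

definition E6 :: "(jc \<Rightarrow> jc) set" where
  "E6 = {\<alpha> \<in> Bij JC.
     (\<forall>X\<in>JC. \<forall>Y\<in>JC. \<alpha> (X + Y) = \<alpha> X + \<alpha> Y) \<and>
     (\<forall>c. \<forall>X\<in>JC. \<alpha> (c *\<^sub>c X) = c *\<^sub>c \<alpha> X) \<and>
     (\<forall>X\<in>JC. detC (\<alpha> X) = detC X) \<and>
     (\<forall>X\<in>JC. \<forall>Y\<in>JC. hermC (\<alpha> X) (\<alpha> Y) = hermC X Y)}"

definition entrywise :: "(cayley \<Rightarrow> cayley) \<Rightarrow> jc \<Rightarrow> jc" where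
  "entrywise f = (\<lambda>X\<in>JC. (\<chi> i j. f (fst X $ i $ j), \<chi> i j. f (snd X $ i $ j)))"

definition gamma :: "jc \<Rightarrow> jc" where "gamma = entrywise cay_gamma"
definition gammaH :: "jc \<Rightarrow> jc" where "gammaH = entrywise cay_gammaH"
definition gammaC :: "jc \<Rightarrow> jc" where "gammaC = entrywise cay_gammaC"

abbreviation comp_JC :: "(jc \<Rightarrow> jc) \<Rightarrow> (jc \<Rightarrow> jc) \<Rightarrow> jc \<Rightarrow> jc" (infixr "\<circ>\<^sub>J" 55) where
  "\<alpha> \<circ>\<^sub>J \<beta> \<equiv> compose JC \<alpha> \<beta>"

definition lam :: "(jc \<Rightarrow> jc) \<Rightarrow> jc \<Rightarrow> jc" where
  "lam \<alpha> = tau \<circ>\<^sub>J \<alpha> \<circ>\<^sub>J tau"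

definition E6_lam_gamma :: "(jc \<Rightarrow> jc) set" where
  "E6_lam_gamma = {\<alpha> \<in> E6. lam (gamma \<circ>\<^sub>J \<alpha> \<circ>\<^sub>J gamma) = \<alpha>}"

definition E6_lam_gamma_gammaC :: "(jc \<Rightarrow> jc) set" where
  "E6_lam_gamma_gammaC =
     {\<alpha> \<in> E6. lam (gamma \<circ>\<^sub>J gammaC \<circ>\<^sub>J \<alpha> \<circ>\<^sub>J gammaC \<circ>\<^sub>J gamma) = \<alpha>}"

definition transf_group :: "(jc \<Rightarrow> jc) set \<Rightarrow> (jc \<Rightarrow> jc) monoid" where
  "transf_group S = (BijGroup JC)\<lparr>carrier := S\<rparr>"


section \<open>The group (U(1) x SO(6))/Z2 and its semidirect product with Z2\<close>

definition U1 :: "quat set" where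
  "U1 = {a. (\<exists>x y :: real. a = (of_real x, of_real y)) \<and> hmult (hcnj a) a = (1, 0)}"

definition U1_group :: "quat monoid" where
  "U1_group = \<lparr>carrier = U1, mult = hmult, one = (1, 0)\<rparr>"

definition SO6 :: "(real ^ 6 ^ 6) set" where
  "SO6 = {A. rotation_matrix A}"

definition SO6_group :: "(real ^ 6 ^ 6) monoid" where
  "SO6_group = \<lparr>carrier = SO6, mult = (**), one = mat 1\<rparr>"

definition Z2_kernel :: "(quat \<times> (real ^ 6 ^ 6)) set" where
  "Z2_kernel = {((1, 0), mat 1), (- (1, 0), - mat 1)}"

definition U1_SO6_mod_Z2 :: "(quat \<times> (real ^ 6 ^ 6)) set monoid" where
  "U1_SO6_mod_Z2 = (U1_group \<times>\<times> SO6_group) Mod Z2_kernel"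

text \<open>
  The index type of \<open>6 \<times> 6\<close> matrices is \<open>{1, \<dots>, 6}\<close> with \<open>6 = 0\<close>, so the entries of \<open>I\<close> equal to
  \<open>1\<close> are those at the indices 1, 3, 5. The matrix below is \<open>iI\<close>.
\<close>

definition iI :: "complex ^ 6 ^ 6" where
  "iI = (\<chi> r s. if r = s then \<i> * (if r \<in> {1, 3, 5} then 1 else - 1) else 0)"

definition complexify :: "real ^ 'n ^ 'n \<Rightarrow> complex ^ 'n ^ 'n" where
  "complexify A = (\<chi> r s. complex_of_real (A $ r $ s))"

text \<open>
  Conjugation of a real matrix by \<open>iI\<close> gives a real matrix, see \<open>complexify_conj_iI\<close>; the
  real part only moves the result back to type \<^typ>\<open>real ^ 6 ^ 6\<close>.
\<close>

definition conj_iI :: "real ^ 6 ^ 6 \<Rightarrow> real ^ 6 ^ 6" where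
  "conj_iI A = (\<chi> r s. Re ((iI ** complexify A ** matrix_inv iI) $ r $ s))"

lemma iI_sq: "iI ** (- iI) = mat 1" "(- iI) ** iI = mat 1"
  by (auto simp: vec_eq_iff matrix_matrix_mult_def iI_def mat_def sum.delta
      if_distrib [where f = "\<lambda>x. x * _"] if_distrib [where f = "\<lambda>x. _ * x"]
      if_distrib [where f = uminus] cong: if_cong)

lemma matrix_inv_iI: "matrix_inv iI = - iI"
proof -
  have "iI ** matrix_inv iI = mat 1 \<and> matrix_inv iI ** iI = mat 1"
    unfolding matrix_inv_def by (rule someI [of _ "- iI"]) (simp add: iI_sq)
  then have "- iI = (- iI) ** (iI ** matrix_inv iI)"
    by simp
  also have "\<dots> = matrix_inv iI"
    by (simp add: matrix_mul_assoc iI_sq)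
  finally show ?thesis by simp
qed

lemma iI_conj_entry:
  "(iI ** complexify A ** matrix_inv iI) $ r $ s =
     of_real ((if r \<in> {1, 3, 5} then 1 else - 1) * A $ r $ s * (if s \<in> {1, 3, 5} then 1 else - 1))"
proof -
  define d :: "6 \<Rightarrow> complex" where "d = (\<lambda>r. \<i> * (if r \<in> {1, 3, 5} then 1 else - 1))"
  have diag: "iI = (\<chi> r s. if r = s then d r else 0)"
    unfolding iI_def d_def ..
  have 1: "(iI ** complexify A) $ r $ k = d r * of_real (A $ r $ k)" for k
    by (simp add: diag matrix_matrix_mult_def complexify_def
        if_distrib [where f = "\<lambda>x. x * _"] cong: if_cong)
  have "(iI ** complexify A ** (- iI)) $ r $ s = (\<Sum>k\<in>UNIV. d r * of_real (A $ r $ k) * - (iI $ k $ s))"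
    by (subst matrix_matrix_mult_def) (simp add: 1)
  also have "\<dots> = (\<Sum>k\<in>UNIV. if k = s then d r * of_real (A $ r $ s) * (- d s) else 0)"
    by (rule sum.cong) (auto simp: diag)
  finally have "(iI ** complexify A ** (- iI)) $ r $ s = d r * of_real (A $ r $ s) * (- d s)"
    by simp
  moreover have "d k = \<i> * of_real (if k \<in> {1, 3, 5} then 1 else - 1)" for k
    by (simp add: d_def)
  ultimately show ?thesis
    unfolding matrix_inv_iI by (simp only: complex_eq_iff) (simp add: mult.assoc)
qed

lemma complexify_conj_iI: "complexify (conj_iI A) = iI ** complexify A ** matrix_inv iI"
proof -
  have "complexify (conj_iI A) $ r $ s = of_real (Re ((iI ** complexify A ** matrix_inv iI) $ r $ s))" for r s
    by (simp only: complexify_def conj_iI_def vec_lambda_beta)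
  then have "complexify (conj_iI A) $ r $ s = (iI ** complexify A ** matrix_inv iI) $ r $ s" for r s
    by (simp only: iI_conj_entry Re_complex_of_real)
  then show ?thesis by (simp add: vec_eq_iff)
qed

definition Z2_act :: "(jc \<Rightarrow> jc) \<Rightarrow> (quat \<times> (real ^ 6 ^ 6)) set \<Rightarrow> (quat \<times> (real ^ 6 ^ 6)) set" where
  "Z2_act h K = (if h = gammaH then (\<lambda>(a, A). (hcnj a, conj_iI A)) ` K else K)"

definition Z2_gammaH :: "(jc \<Rightarrow> jc) set" where
  "Z2_gammaH = {\<one>\<^bsub>BijGroup JC\<^esub>, gammaH}"

definition semidirect ::
    "('a, 'c) monoid_scheme \<Rightarrow> ('b, 'd) monoid_scheme \<Rightarrow> ('b \<Rightarrow> 'a \<Rightarrow> 'a) \<Rightarrow> ('a \<times> 'b) monoid" where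
  "semidirect N H act =
     \<lparr>carrier = carrier N \<times> carrier H,
      mult = (\<lambda>(n, h) (n', h'). (n \<otimes>\<^bsub>N\<^esub> act h n', h \<otimes>\<^bsub>H\<^esub> h')),
      one = (\<one>\<^bsub>N\<^esub>, \<one>\<^bsub>H\<^esub>)\<rparr>"


section \<open>Topologies\<close>

text \<open>
  Sets of \<open>C\<close>-linear maps carry the topology of pointwise convergence (the topology of the function
  type), which on linear maps of a finite-dimensional space is the usual one.
\<close>

definition quotient_topology :: "'a topology \<Rightarrow> ('a \<Rightarrow> 'b) \<Rightarrow> 'b topology" where
  "quotient_topology X p =
     topology (\<lambda>U. U \<subseteq> p ` topspace X \<and> openin X {x \<in> topspace X. p x \<in> U})"

lemma openin_quotient_topology:
  "openin (quotient_topology X p) U \<longleftrightarrow> U \<subseteq> p ` topspace X \<and> openin X {x \<in> topspace X. p x \<in> U}"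
proof -
  have inter: "{x \<in> topspace X. p x \<in> S \<inter> T} =
      {x \<in> topspace X. p x \<in> S} \<inter> {x \<in> topspace X. p x \<in> T}" for S T
    by auto
  have union: "{x \<in> topspace X. p x \<in> \<Union>\<K>} = (\<Union>K\<in>\<K>. {x \<in> topspace X. p x \<in> K})" for \<K>
    by auto
  have "istopology (\<lambda>U. U \<subseteq> p ` topspace X \<and> openin X {x \<in> topspace X. p x \<in> U})"
    unfolding istopology_def inter union by blast
  then show ?thesis
    by (simp add: quotient_topology_def)
qed

lemma quotient_map_quotient_topology: "quotient_map X (quotient_topology X p) p"
proof -
  have "{x \<in> topspace X. p x \<in> p ` topspace X} = topspace X"
    by auto
  then have "openin (quotient_topology X p) (p ` topspace X)"
    by (simp add: openin_quotient_topology)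
  then have "topspace (quotient_topology X p) = p ` topspace X"
    by (metis openin_quotient_topology openin_subset openin_topspace subset_antisym)
  then show ?thesis
    by (auto simp: quotient_map_def openin_quotient_topology)
qed

definition U1_SO6_mod_Z2_topology :: "(quat \<times> (real ^ 6 ^ 6)) set topology" where
  "U1_SO6_mod_Z2_topology =
     quotient_topology (top_of_set (U1 \<times> SO6)) (\<lambda>x. Z2_kernel #>\<^bsub>U1_group \<times>\<times> SO6_group\<^esub> x)"

end

(*
  J^C is identified with the space of triples (S, u, v), where S is a skew-symmetric complex
  6 x 6 matrix and u, v are vectors in C^6, so that det X = Pf S + u^T S v and <X, Y> is the standard
  Hermitian form. Then tau gamma is complex conjugation, gamma_C is (S, -u, -v), and
  gamma_H is (-ISI, -Iu, Iv). The group in question therefore consists of the real isometries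
  of the form (S, u, v) -> (g S, h(u, v)) that preserve the cubic form. It contains
  (a, A) -> (A S A^T, A(xu - yv), A(yu + xv)) for a = x + y e_2 in U(1) and A in SO(6).

  Conversely, invariance of the cubic form gives g(u /\ v) = u' /\ v' for (u', v') = h(u, v), so h preserves
  the tensors of rank one in R^6 (x) R^2 and is a tensor product of two orthogonal maps
  A and B. Then g = det(B) A /\ A, and invariance of the Pfaffian forces det A = det B. If this sign is
  1, the element is the image of a pair; if it is -1, it is such an image times gamma_H. The kernel
  is {(1, E), (-1, -E)}, and the resulting continuous bijection from a compact space to a Hausdorff
  space is a homeomorphism.
*)

theory Submission
  imports Defs
begin

section \<open>The Pfaffian of a skew-symmetric 6 by 6 matrix\<close>

text \<open>The two defining conditions say that an element commutes with tau gamma and with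
  gamma_C: the first gives a real structure, the second separates S from (u, v). Rank one is the
  delicate point. A linear map into R^n (x) R^2 whose values have rank at most one may, besides u ->
  A u (x) y, also have the form u -> x (x) L u. For an isometry of R^n this second form is excluded
  as soon as n >= 3, because three orthonormal vectors do not fit into a plane; this is where the
  size of 6 against 2 enters.

  Since the Pfaffian is cubic, its invariance reads (det B)^3 det A = 1, which links the two signs.
  The involution gamma_H is itself I (x) diag(-1, 1), with both determinants equal to -1; this
  explains at once the conjugation of a and the conjugation of A by I.

  The isomorphism is built from the semidirect product towards the transformations, since the
  universal property of the quotient and compactness serve that direction. The map in the statement
  is its inverse.\<close>

lemma UNIV_6: "(UNIV :: 6 set) = {1, 2, 3, 4, 5, 6}"
proof -
  have "card {1, 2, 3, 4, 5, 6 :: 6} = card (UNIV :: 6 set)" by simp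
  then show ?thesis by (metis card_subset_eq finite top_greatest)
qed

lemma forall_6: "(\<forall>i::6. P i) \<longleftrightarrow> P 1 \<and> P 2 \<and> P 3 \<and> P 4 \<and> P 5 \<and> P 6"
proof
  assume "P 1 \<and> P 2 \<and> P 3 \<and> P 4 \<and> P 5 \<and> P 6"
  then have "\<forall>i\<in>{1, 2, 3, 4, 5, 6 :: 6}. P i" by simp
  then show "\<forall>i. P i" using UNIV_6 by blast
qed auto

lemma sum_6: "(\<Sum>i\<in>(UNIV :: 6 set). f i) = f 1 + f 2 + f 3 + f 4 + f 5 + f 6"
  unfolding UNIV_6 by (simp add: ac_simps)

lemma prod_6: "(\<Prod>i\<in>(UNIV :: 6 set). f i) = f 1 * f 2 * f 3 * f 4 * f 5 * f 6"
  unfolding UNIV_6 by (simp add: ac_simps)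

lemma exhaust_6: "i = 1 \<or> i = 2 \<or> i = 3 \<or> i = 4 \<or> i = 5 \<or> i = (6::6)"
  using UNIV_6 by auto

definition skew :: "complex ^ 6 ^ 6 \<Rightarrow> bool" where
  "skew S \<longleftrightarrow> (\<forall>i j. S $ i $ j = - S $ j $ i)"

text \<open>Expansion along the first row. The fifteen terms are the perfect matchings of six
  indices, and only entries above the diagonal occur.\<close>

definition Pf :: "complex ^ 6 ^ 6 \<Rightarrow> complex" where
  "Pf S = S$1$2 * (S$3$4 * S$5$6 - S$3$5 * S$4$6 + S$3$6 * S$4$5)
        - S$1$3 * (S$2$4 * S$5$6 - S$2$5 * S$4$6 + S$2$6 * S$4$5)
        + S$1$4 * (S$2$3 * S$5$6 - S$2$5 * S$3$6 + S$2$6 * S$3$5)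
        - S$1$5 * (S$2$3 * S$4$6 - S$2$4 * S$3$6 + S$2$6 * S$3$4)
        + S$1$6 * (S$2$3 * S$4$5 - S$2$4 * S$3$5 + S$2$5 * S$3$4)"

text \<open>The action of \<open>A\<close> on the second exterior power, with bivectors written as
  skew matrices.\<close>

definition cong_act :: "real ^ 6 ^ 6 \<Rightarrow> complex ^ 6 ^ 6 \<Rightarrow> complex ^ 6 ^ 6" where
  "cong_act A S = complexify A ** S ** transpose (complexify A)"

lemma skew_lower:
  assumes "skew S"
  shows "S$1$1 = 0" "S$2$2 = 0" "S$3$3 = 0" "S$4$4 = 0" "S$5$5 = 0" "S$6$6 = 0"
    "S$2$1 = - S$1$2" "S$3$1 = - S$1$3" "S$4$1 = - S$1$4" "S$5$1 = - S$1$5" "S$6$1 = - S$1$6"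
    "S$3$2 = - S$2$3" "S$4$2 = - S$2$4" "S$5$2 = - S$2$5" "S$6$2 = - S$2$6"
    "S$4$3 = - S$3$4" "S$5$3 = - S$3$5" "S$6$3 = - S$3$6"
    "S$5$4 = - S$4$5" "S$6$4 = - S$4$6" "S$6$5 = - S$5$6"
proof -
  have "S$i$i = 0" for i
  proof -
    have "S$i$i = - S$i$i" using assms unfolding skew_def by blast
    then show ?thesis by simp
  qed
  then show "S$1$1 = 0" "S$2$2 = 0" "S$3$3 = 0" "S$4$4 = 0" "S$5$5 = 0" "S$6$6 = 0" by auto
qed (use assms in \<open>unfold skew_def, blast\<close>)+

lemma complexify_mult: "complexify (A ** B) = complexify A ** complexify B"
  by (simp add: complexify_def matrix_matrix_mult_def vec_eq_iff)

lemma complexify_transpose: "complexify (transpose A) = transpose (complexify A)"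
  by (simp add: complexify_def transpose_def vec_eq_iff)

lemma cong_act_mult: "cong_act (A ** B) S = cong_act A (cong_act B S)"
  by (simp add: cong_act_def complexify_mult matrix_transpose_mul matrix_mul_assoc)

lemma cong_act_nth:
  "cong_act A S $ i $ j = (\<Sum>k\<in>UNIV. \<Sum>l\<in>UNIV. of_real (A$i$k) * S$k$l * of_real (A$j$l))"
proof -
  have "cong_act A S $ i $ j = (\<Sum>l\<in>UNIV. \<Sum>k\<in>UNIV. of_real (A$i$k) * S$k$l * of_real (A$j$l))"
    by (simp add: cong_act_def matrix_matrix_mult_def transpose_def complexify_def sum_distrib_right)
  then show ?thesis by (subst sum.swap) simp
qed

lemma skew_cong_act:
  assumes "skew S" shows "skew (cong_act A S)"
  unfolding skew_def
proof (intro allI)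
  fix i j
  have s: "S $ l $ k = - S $ k $ l" for k l using assms unfolding skew_def by blast
  have "cong_act A S $ j $ i = (\<Sum>k\<in>UNIV. \<Sum>l\<in>UNIV. of_real (A$i$k) * S$l$k * of_real (A$j$l))"
    unfolding cong_act_nth by (subst sum.swap) (simp add: mult_ac)
  also have "\<dots> = - (\<Sum>k\<in>UNIV. \<Sum>l\<in>UNIV. of_real (A$i$k) * S$k$l * of_real (A$j$l))"
    unfolding sum_negf[symmetric]
  proof (intro sum.cong refl)
    fix k l
    show "of_real (A$i$k) * S$l$k * of_real (A$j$l) = - (of_real (A$i$k) * S$k$l * of_real (A$j$l))"
      using s[of l k] by simp
  qed
  finally show "cong_act A S $ i $ j = - cong_act A S $ j $ i"
    unfolding cong_act_nth by simp
qed

text \<open>Diagonal and elementary matrices have indicator entries; these four shapes collapse the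
  double sum of \<open>cong_act_nth\<close> for them.\<close>

lemma sum_of_bool_mult:
  "(\<Sum>k\<in>UNIV. of_real (of_bool (i = k)) * f k) = (f (i::'n::finite) :: complex)"
  "(\<Sum>k\<in>UNIV. of_real (of_bool (k = i)) * f k) = f i"
  "(\<Sum>k\<in>UNIV. f k * of_real (of_bool (i = k))) = f i"
  "(\<Sum>k\<in>UNIV. f k * of_real (of_bool (k = i))) = f i"
  by (simp_all add: of_bool_def if_distrib[of of_real] if_distrib[of "\<lambda>x. x * _"] if_distrib[of "\<lambda>x. _ * x"] cong: if_cong)

text \<open>Both sides are multiplicative in \<open>A\<close>, so the law is checked on matrices
  with a zero row, diagonal matrices, transpositions and elementary row additions. \<open>S\<close>
  has to vary, because a product acts by one factor on the result of the other.\<close>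

lemma Pf_congr:
  "skew S \<Longrightarrow> Pf (cong_act A S) = of_real (det A) * Pf S"
proof (induction A arbitrary: S rule: induct_matrix_elementary_alt)
  case (1 A B)
  then show ?case by (simp add: cong_act_mult skew_cong_act det_mul mult_ac)
next
  case (2 A i)
  have r: "A $ i $ k = 0" for k using 2(1) by (simp add: row_def vec_eq_iff)
  have a: "cong_act A S $ i $ k = 0" for k by (simp add: cong_act_nth r)
  have b: "cong_act A S $ k $ i = 0" for k by (simp add: cong_act_nth r)
  have "Pf (cong_act A S) = 0"
    using exhaust_6[of i] a b by (elim disjE) (simp_all add: Pf_def)
  then show ?case using 2(1) by (simp add: det_zero_row)
next
  case (3 A)
  define d where "d i = A $ i $ i" for i
  have e: "A $ i $ j = d i * of_bool (i = j)" for i j using 3(1) by (simp add: d_def)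
  have "cong_act A S $ i $ j = of_real (d i) * S$i$j * of_real (d j)" for i j
  proof -
    have "cong_act A S $ i $ j = (\<Sum>k\<in>UNIV. of_real (of_bool (i = k)) * (\<Sum>l\<in>UNIV. (of_real (d i) * S$k$l * of_real (d j)) * of_real (of_bool (j = l))))"
      unfolding cong_act_nth e sum_distrib_left by (intro sum.cong refl) (simp only: of_real_mult mult_ac)
    then show ?thesis unfolding sum_of_bool_mult .
  qed
  moreover have "det A = d 1 * d 2 * d 3 * d 4 * d 5 * d 6"
    using 3(1) by (simp add: det_diagonal prod_6 d_def)
  ultimately show ?case by (simp add: Pf_def algebra_simps)
next
  case (4 m n)
  define t where "t = Transposition.transpose m n"
  let ?A = "(\<chi> i j. mat 1 $ i $ Transposition.transpose m n j) :: real^6^6"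
  have tt: "t (t i) = i" for i by (simp add: t_def)
  have "?A $ i $ k = of_bool (t i = k)" for i k
    using tt by (auto simp: mat_def t_def[symmetric])
  then have c: "cong_act ?A S $ i $ j = S $ (t i) $ (t j)" for i j
    unfolding cong_act_nth by (simp add: sum_of_bool_mult flip: sum_distrib_right)
  have "det ?A = - 1"
  proof -
    have "?A = (\<chi> i. (mat 1 :: real^6^6) $ t i)"
      using tt by (auto simp: mat_def vec_eq_iff t_def[symmetric])
    moreover have "det (\<chi> i. (mat 1 :: real^6^6) $ t i) = of_int (sign t) * det (mat 1 :: real^6^6)"
      by (rule det_permute_rows) (simp add: t_def permutes_swap_id)
    ultimately show ?thesis using 4(1) by (simp add: t_def sign_swap_id)
  qed
  moreover have "Pf (cong_act ?A S) = - Pf S"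
    using 4(1) exhaust_6[of m] exhaust_6[of n]
    unfolding Pf_def c
    by (elim disjE) (simp_all add: t_def Transposition.transpose_def skew_lower[OF 4(2)] algebra_simps)
  ultimately show ?case by simp
next
  case (5 m n)
  let ?A = "(\<chi> i j. of_bool (i = m \<and> j = n \<or> i = j)) :: real^6^6"
  have "?A $ i $ k = of_bool (i = k) + of_bool (i = m) * of_bool (n = k)" for i k
    using 5(1) by auto
  \<comment> \<open>Row and column \<open>n\<close> are added to row and column \<open>m\<close>;
    the innermost term is the overlap at \<open>(m, m)\<close>.\<close>
  then have c: "cong_act ?A S $ i $ j = S$i$j + of_bool (i = m) * S$n$j + of_bool (j = m) * (S$i$n + of_bool (i = m) * S$n$n)" for i j
    unfolding cong_act_nth
    by (simp add: sum_of_bool_mult distrib_left distrib_right sum.distrib flip: sum_distrib_right)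
  have "det ?A = 1"
  proof -
    have "?A = (\<chi> k. if k = m then row m (mat 1) + 1 *s row n (mat 1) else row k (mat 1))"
      using 5(1) by (auto simp: mat_def vec_eq_iff row_def)
    then show ?thesis using det_row_operation[OF 5(1), of "mat 1 :: real^6^6" 1] by simp
  qed
  moreover have "Pf (cong_act ?A S) = Pf S"
    using 5(1) exhaust_6[of m] exhaust_6[of n]
    unfolding Pf_def c
    by (elim disjE) (simp_all add: skew_lower[OF 5(2)] algebra_simps)
  ultimately show ?case by simp
qed

section \<open>Coordinates on the complexified Jordan algebra\<close>

definition vec6 :: "'a \<Rightarrow> 'a \<Rightarrow> 'a \<Rightarrow> 'a \<Rightarrow> 'a \<Rightarrow> 'a \<Rightarrow> 'a ^ 6" where
  "vec6 a b c d e f = (\<chi> r. if r = 1 then a else if r = 2 then b else if r = 3 then c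
     else if r = 4 then d else if r = 5 then e else f)"

lemma vec6_nth [simp]:
  "vec6 a b c d e f $ 1 = a" "vec6 a b c d e f $ 2 = b" "vec6 a b c d e f $ 3 = c"
  "vec6 a b c d e f $ 4 = d" "vec6 a b c d e f $ 5 = e" "vec6 a b c d e f $ 6 = f"
  by (simp_all add: vec6_def)

lemma vec6_eq_iff: "(x :: 'a ^ 6) = y \<longleftrightarrow>
    x$1 = y$1 \<and> x$2 = y$2 \<and> x$3 = y$3 \<and> x$4 = y$4 \<and> x$5 = y$5 \<and> x$6 = y$6"
  by (simp add: vec_eq_iff forall_6)

type_synonym model = "(complex ^ 6 ^ 6) \<times> (complex ^ 6) \<times> (complex ^ 6)"

text \<open>The parameters are the entries above the diagonal, read row by row.\<close>

definition skew6 where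
  "skew6 a b c d e f g h i j k l m n p = vec6
     (vec6 0 a b c d e) (vec6 (- a) 0 f g h i) (vec6 (- b) (- f) 0 j k l)
     (vec6 (- c) (- g) (- j) 0 m n) (vec6 (- d) (- h) (- k) (- m) 0 p)
     (vec6 (- e) (- i) (- l) (- n) (- p) (0 :: complex))"

lemma skew_skew6 [simp]: "skew (skew6 a b c d e f g h i j k l m n p)"
  by (simp add: skew_def forall_6 skew6_def)

text \<open>Coordinates with respect to 1, e1, e2, e3, e4, e1 e4, e2 e4, e3 e4.\<close>

definition c0 :: "cayley \<Rightarrow> real" where "c0 x = Re (fst (fst x))"
definition c1 :: "cayley \<Rightarrow> real" where "c1 x = Im (fst (fst x))"
definition c2 :: "cayley \<Rightarrow> real" where "c2 x = Re (snd (fst x))"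
definition c3 :: "cayley \<Rightarrow> real" where "c3 x = Im (snd (fst x))"
definition c4 :: "cayley \<Rightarrow> real" where "c4 x = Re (fst (snd x))"
definition c5 :: "cayley \<Rightarrow> real" where "c5 x = Im (fst (snd x))"
definition c6 :: "cayley \<Rightarrow> real" where "c6 x = Re (snd (snd x))"
definition c7 :: "cayley \<Rightarrow> real" where "c7 x = Im (snd (snd x))"
lemmas coord_defs = c0_def c1_def c2_def c3_def c4_def c5_def c6_def c7_def

definition coords :: "(cayley \<Rightarrow> real) set" where
  "coords = {c0, c1, c2, c3, c4, c5, c6, c7}"

lemma cayley_eqI: "(\<And>f. f \<in> coords \<Longrightarrow> f x = f y) \<Longrightarrow> x = y"
proof -
  assume a: "\<And>f. f \<in> coords \<Longrightarrow> f x = f y"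
  have "c0 x = c0 y" "c1 x = c1 y" "c2 x = c2 y" "c3 x = c3 y" "c4 x = c4 y" "c5 x = c5 y" "c6 x = c6 y" "c7 x = c7 y"
    by (rule a, simp add: coords_def)+
  then show ?thesis by (simp add: prod_eq_iff complex_eq_iff coord_defs)
qed

lemma linear_coord: "f \<in> coords \<Longrightarrow> linear f"
  by (auto simp: coords_def coord_defs[abs_def] intro!: linearI)

text \<open>Entries of an element of J^C lie in the complexified Cayley algebra. This reads off one
  of their eight coordinates over C and turns the pair into an honest complex number, so that later
  identities are polynomial identities over a field.\<close>

definition cayC :: "(cayley \<Rightarrow> real) \<Rightarrow> jc \<Rightarrow> 3 \<Rightarrow> 3 \<Rightarrow> complex" where
  "cayC f X i j = Complex (f (fst X $ i $ j)) (f (snd X $ i $ j))"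

lemma jc_eqI:
  assumes "\<And>f i j. f \<in> coords \<Longrightarrow> cayC f X i j = cayC f Y i j" shows "X = Y"
proof -
  have "fst X $ i $ j = fst Y $ i $ j" "snd X $ i $ j = snd Y $ i $ j" for i j
    using assms[of _ i j] by (auto simp: cayC_def intro!: cayley_eqI)
  then show ?thesis by (simp add: prod_eq_iff vec_eq_iff)
qed

lemma cayC_add: "f \<in> coords \<Longrightarrow> cayC f (X + Y) i j = cayC f X i j + cayC f Y i j"
  by (simp add: cayC_def linear_add[OF linear_coord] complex_eq_iff)

lemma cayC_diff: "f \<in> coords \<Longrightarrow> cayC f (X - Y) i j = cayC f X i j - cayC f Y i j"
  by (simp add: cayC_def linear_diff[OF linear_coord] complex_eq_iff)

lemma cayC_cscale: "f \<in> coords \<Longrightarrow> cayC f (c *\<^sub>c X) i j = c * cayC f X i j"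
  by (simp add: cayC_def cscale_def linear_add[OF linear_coord] linear_diff[OF linear_coord]
      linear_scale[OF linear_coord] complex_eq_iff)

lemma coords_mem [simp]: "c0 \<in> coords" "c1 \<in> coords" "c2 \<in> coords" "c3 \<in> coords"
  "c4 \<in> coords" "c5 \<in> coords" "c6 \<in> coords" "c7 \<in> coords"
  by (auto simp: coords_def)

definition octonion :: "real \<Rightarrow> real \<Rightarrow> real \<Rightarrow> real \<Rightarrow> real \<Rightarrow> real \<Rightarrow> real \<Rightarrow> real \<Rightarrow> cayley" where
  "octonion x0 x1 x2 x3 x4 x5 x6 x7 = ((Complex x0 x1, Complex x2 x3), (Complex x4 x5, Complex x6 x7))"

lemma coord_octonion [simp]:
  "c0 (octonion x0 x1 x2 x3 x4 x5 x6 x7) = x0" "c1 (octonion x0 x1 x2 x3 x4 x5 x6 x7) = x1"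
  "c2 (octonion x0 x1 x2 x3 x4 x5 x6 x7) = x2" "c3 (octonion x0 x1 x2 x3 x4 x5 x6 x7) = x3"
  "c4 (octonion x0 x1 x2 x3 x4 x5 x6 x7) = x4" "c5 (octonion x0 x1 x2 x3 x4 x5 x6 x7) = x5"
  "c6 (octonion x0 x1 x2 x3 x4 x5 x6 x7) = x6" "c7 (octonion x0 x1 x2 x3 x4 x5 x6 x7) = x7"
  by (simp_all add: coord_defs octonion_def)

lemma coord_cay_cnj [simp]:
  "c0 (cay_cnj x) = c0 x" "c1 (cay_cnj x) = - c1 x" "c2 (cay_cnj x) = - c2 x" "c3 (cay_cnj x) = - c3 x"
  "c4 (cay_cnj x) = - c4 x" "c5 (cay_cnj x) = - c5 x" "c6 (cay_cnj x) = - c6 x" "c7 (cay_cnj x) = - c7 x"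
  by (simp_all add: coord_defs cay_cnj_def hcnj_def split_beta)

lemma coord_cay_mult:
  "c0 (cay_mult x y) = c0 x * c0 y - c1 x * c1 y - c2 x * c2 y - c3 x * c3 y - c4 x * c4 y - c5 x * c5 y - c6 x * c6 y - c7 x * c7 y"
  "c1 (cay_mult x y) = c0 x * c1 y + c1 x * c0 y + c2 x * c3 y - c3 x * c2 y + c4 x * c5 y - c5 x * c4 y - c6 x * c7 y + c7 x * c6 y"
  "c2 (cay_mult x y) = c0 x * c2 y - c1 x * c3 y + c2 x * c0 y + c3 x * c1 y + c4 x * c6 y + c5 x * c7 y - c6 x * c4 y - c7 x * c5 y"
  "c3 (cay_mult x y) = c0 x * c3 y + c1 x * c2 y - c2 x * c1 y + c3 x * c0 y + c4 x * c7 y - c5 x * c6 y + c6 x * c5 y - c7 x * c4 y"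
  "c4 (cay_mult x y) = c0 x * c4 y - c1 x * c5 y - c2 x * c6 y - c3 x * c7 y + c4 x * c0 y + c5 x * c1 y + c6 x * c2 y + c7 x * c3 y"
  "c5 (cay_mult x y) = c0 x * c5 y + c1 x * c4 y - c2 x * c7 y + c3 x * c6 y - c4 x * c1 y + c5 x * c0 y - c6 x * c3 y + c7 x * c2 y"
  "c6 (cay_mult x y) = c0 x * c6 y + c1 x * c7 y + c2 x * c4 y - c3 x * c5 y - c4 x * c2 y + c5 x * c3 y + c6 x * c0 y - c7 x * c1 y"
  "c7 (cay_mult x y) = c0 x * c7 y - c1 x * c6 y + c2 x * c5 y + c3 x * c4 y - c4 x * c3 y - c5 x * c2 y + c6 x * c1 y + c7 x * c0 y"
  by (simp_all add: coord_defs cay_mult_def hmult_def hcnj_def split_beta)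

text \<open>The product of two entries in the complexified Cayley algebra, one coordinate at a
  time.\<close>

definition multC :: "(cayley \<Rightarrow> real) \<Rightarrow> jc \<Rightarrow> 3 \<Rightarrow> 3 \<Rightarrow> jc \<Rightarrow> 3 \<Rightarrow> 3 \<Rightarrow> complex" where
  "multC f X i j Y k l =
     Complex (f (cay_mult (fst X $ i $ j) (fst Y $ k $ l)) - f (cay_mult (snd X $ i $ j) (snd Y $ k $ l)))
             (f (cay_mult (fst X $ i $ j) (snd Y $ k $ l)) + f (cay_mult (snd X $ i $ j) (fst Y $ k $ l)))"

text \<open>The extension is C-bilinear, so the real multiplication table carries over
  unchanged.\<close>

lemma multC_coord:
  "multC c0 X i j Y k l =
     cayC c0 X i j * cayC c0 Y k l - cayC c1 X i j * cayC c1 Y k l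
     - cayC c2 X i j * cayC c2 Y k l - cayC c3 X i j * cayC c3 Y k l
     - cayC c4 X i j * cayC c4 Y k l - cayC c5 X i j * cayC c5 Y k l
     - cayC c6 X i j * cayC c6 Y k l - cayC c7 X i j * cayC c7 Y k l"
  "multC c1 X i j Y k l =
     cayC c0 X i j * cayC c1 Y k l + cayC c1 X i j * cayC c0 Y k l
     + cayC c2 X i j * cayC c3 Y k l - cayC c3 X i j * cayC c2 Y k l
     + cayC c4 X i j * cayC c5 Y k l - cayC c5 X i j * cayC c4 Y k l
     - cayC c6 X i j * cayC c7 Y k l + cayC c7 X i j * cayC c6 Y k l"
  "multC c2 X i j Y k l =
     cayC c0 X i j * cayC c2 Y k l - cayC c1 X i j * cayC c3 Y k l
     + cayC c2 X i j * cayC c0 Y k l + cayC c3 X i j * cayC c1 Y k l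
     + cayC c4 X i j * cayC c6 Y k l + cayC c5 X i j * cayC c7 Y k l
     - cayC c6 X i j * cayC c4 Y k l - cayC c7 X i j * cayC c5 Y k l"
  "multC c3 X i j Y k l =
     cayC c0 X i j * cayC c3 Y k l + cayC c1 X i j * cayC c2 Y k l
     - cayC c2 X i j * cayC c1 Y k l + cayC c3 X i j * cayC c0 Y k l
     + cayC c4 X i j * cayC c7 Y k l - cayC c5 X i j * cayC c6 Y k l
     + cayC c6 X i j * cayC c5 Y k l - cayC c7 X i j * cayC c4 Y k l"
  "multC c4 X i j Y k l =
     cayC c0 X i j * cayC c4 Y k l - cayC c1 X i j * cayC c5 Y k l
     - cayC c2 X i j * cayC c6 Y k l - cayC c3 X i j * cayC c7 Y k l
     + cayC c4 X i j * cayC c0 Y k l + cayC c5 X i j * cayC c1 Y k l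
     + cayC c6 X i j * cayC c2 Y k l + cayC c7 X i j * cayC c3 Y k l"
  "multC c5 X i j Y k l =
     cayC c0 X i j * cayC c5 Y k l + cayC c1 X i j * cayC c4 Y k l
     - cayC c2 X i j * cayC c7 Y k l + cayC c3 X i j * cayC c6 Y k l
     - cayC c4 X i j * cayC c1 Y k l + cayC c5 X i j * cayC c0 Y k l
     - cayC c6 X i j * cayC c3 Y k l + cayC c7 X i j * cayC c2 Y k l"
  "multC c6 X i j Y k l =
     cayC c0 X i j * cayC c6 Y k l + cayC c1 X i j * cayC c7 Y k l
     + cayC c2 X i j * cayC c4 Y k l - cayC c3 X i j * cayC c5 Y k l
     - cayC c4 X i j * cayC c2 Y k l + cayC c5 X i j * cayC c3 Y k l
     + cayC c6 X i j * cayC c0 Y k l - cayC c7 X i j * cayC c1 Y k l"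
  "multC c7 X i j Y k l =
     cayC c0 X i j * cayC c7 Y k l - cayC c1 X i j * cayC c6 Y k l
     + cayC c2 X i j * cayC c5 Y k l + cayC c3 X i j * cayC c4 Y k l
     - cayC c4 X i j * cayC c3 Y k l - cayC c5 X i j * cayC c2 Y k l
     + cayC c6 X i j * cayC c1 Y k l + cayC c7 X i j * cayC c0 Y k l"
  by (simp_all add: multC_def cayC_def coord_cay_mult complex_eq_iff)

lemma cayC_jordanC:
  assumes f: "f \<in> coords"
  shows "cayC f (jordanC X Y) i j = 1 / 2 * (\<Sum>m\<in>UNIV. multC f X i m Y m j + multC f Y i m X m j)"
  by (simp add: complex_eq_iff cayC_def jordanC_def split_beta jordan_def cmat_mult_def multC_def
      linear_add[OF linear_coord[OF f]] linear_diff[OF linear_coord[OF f]] linear_sum[OF linear_coord[OF f]]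
      linear_scale[OF linear_coord[OF f]] sum.distrib sum_subtractf algebra_simps
      add_divide_distrib diff_divide_distrib)

section \<open>Closure of J^C under the Jordan operations\<close>

lemma cay_cnj_mult: "cay_cnj (cay_mult x y) = cay_mult (cay_cnj y) (cay_cnj x)"
  by (simp add: prod_eq_iff complex_eq_iff cay_cnj_def cay_mult_def hmult_def hcnj_def split_beta algebra_simps)

lemma linear_cay_cnj: "linear cay_cnj"
  by (rule linearI) (simp_all add: prod_eq_iff complex_eq_iff cay_cnj_def hcnj_def split_beta)

lemma J_iff: "X \<in> J \<longleftrightarrow> (\<forall>i j. cay_cnj (X $ j $ i) = X $ i $ j)"
  by (auto simp: J_def cmat_adj_def vec_eq_iff)

lemma subspace_J: "subspace J"
  by (auto simp: subspace_def J_iff linear_add[OF linear_cay_cnj] linear_scale[OF linear_cay_cnj]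
      linear_0[OF linear_cay_cnj])

lemma J_jordan: assumes "X \<in> J" "Y \<in> J" shows "jordan X Y \<in> J"
proof -
  have X: "cay_cnj (X $ j $ i) = X $ i $ j" and Y: "cay_cnj (Y $ j $ i) = Y $ i $ j" for i j
    using assms unfolding J_iff by metis+
  show ?thesis
    unfolding J_iff jordan_def cmat_mult_def
    by (simp add: linear_add[OF linear_cay_cnj] linear_scale[OF linear_cay_cnj]
      linear_sum[OF linear_cay_cnj] cay_cnj_mult X Y sum.distrib add.commute)
qed

lemma JC_iff: "X \<in> JC \<longleftrightarrow> fst X \<in> J \<and> snd X \<in> J"
  by (auto simp: JC_def mem_Times_iff)

lemma subspace_JC: "subspace JC"
  unfolding JC_def by (rule subspace_Times) (rule subspace_J)+

lemma JC_cscale: "X \<in> JC \<Longrightarrow> c *\<^sub>c X \<in> JC"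
  by (simp add: JC_iff cscale_def subspace_add subspace_diff subspace_scale subspace_J)

lemma JC_jordanC: "X \<in> JC \<Longrightarrow> Y \<in> JC \<Longrightarrow> jordanC X Y \<in> JC"
  by (simp add: JC_iff jordanC_def split_beta subspace_add subspace_diff subspace_J J_jordan)

lemma JC_oneC: "oneC \<in> JC"
  by (simp add: JC_iff oneC_def subspace_0 subspace_J)
     (simp add: J_iff cmat_one_def cay_one_def cay_cnj_def hcnj_def zero_prod_def)

lemma JC_crossC: "X \<in> JC \<Longrightarrow> Y \<in> JC \<Longrightarrow> crossC X Y \<in> JC"
  by (simp add: crossC_def JC_cscale subspace_add subspace_diff subspace_JC JC_jordanC JC_oneC)

lemma cayC_JC:
  assumes "X \<in> JC"
  shows "cayC c0 X j i = cayC c0 X i j" "cayC c1 X j i = - cayC c1 X i j" "cayC c2 X j i = - cayC c2 X i j"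
    "cayC c3 X j i = - cayC c3 X i j" "cayC c4 X j i = - cayC c4 X i j" "cayC c5 X j i = - cayC c5 X i j"
    "cayC c6 X j i = - cayC c6 X i j" "cayC c7 X j i = - cayC c7 X i j"
proof -
  have "fst X $ j $ i = cay_cnj (fst X $ i $ j)" "snd X $ j $ i = cay_cnj (snd X $ i $ j)"
    using assms unfolding JC_iff J_iff by metis+
  then show "cayC c0 X j i = cayC c0 X i j" "cayC c1 X j i = - cayC c1 X i j" "cayC c2 X j i = - cayC c2 X i j"
    "cayC c3 X j i = - cayC c3 X i j" "cayC c4 X j i = - cayC c4 X i j" "cayC c5 X j i = - cayC c5 X i j"
    "cayC c6 X j i = - cayC c6 X i j" "cayC c7 X j i = - cayC c7 X i j"
    by (simp_all add: cayC_def complex_eq_iff)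
qed

lemma cayC_JC_diag:
  assumes "X \<in> JC"
  shows "cayC c1 X i i = 0" "cayC c2 X i i = 0" "cayC c3 X i i = 0" "cayC c4 X i i = 0"
    "cayC c5 X i i = 0" "cayC c6 X i i = 0" "cayC c7 X i i = 0"
  using cayC_JC(2-8)[OF assms, of i i] by (simp_all add: eq_neg_iff_add_eq_0)

section \<open>The trace form, the cross product and the determinant in coordinates\<close>

lemma trC_eq: "trC X = cayC c0 X 1 1 + cayC c0 X 2 2 + cayC c0 X 3 3"
  by (simp add: trC_def split_beta trJ_def cay_Re_def cayC_def c0_def sum_3 complex_eq_iff)

definition dotC :: "jc \<Rightarrow> jc \<Rightarrow> 3 \<Rightarrow> 3 \<Rightarrow> complex" where
  "dotC X Y i j = cayC c0 X i j * cayC c0 Y i j + cayC c1 X i j * cayC c1 Y i j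
     + cayC c2 X i j * cayC c2 Y i j + cayC c3 X i j * cayC c3 Y i j
     + cayC c4 X i j * cayC c4 Y i j + cayC c5 X i j * cayC c5 Y i j
     + cayC c6 X i j * cayC c6 Y i j + cayC c7 X i j * cayC c7 Y i j"

lemma dotC_commute: "dotC Y X i m = dotC X Y i m"
  unfolding dotC_def by (simp only: mult.commute)

lemma dotC_swap: "X \<in> JC \<Longrightarrow> Y \<in> JC \<Longrightarrow> dotC X Y m i = dotC X Y i m"
  unfolding dotC_def cayC_JC[of X m i] cayC_JC[of Y m i] by simp

lemma dotC_diag: "X \<in> JC \<Longrightarrow> dotC X Y i i = cayC c0 X i i * cayC c0 Y i i"
  unfolding dotC_def by (simp add: cayC_JC_diag)

lemma multC_dotC: "Y \<in> JC \<Longrightarrow> multC c0 X i m Y m i = dotC X Y i m"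
  unfolding multC_coord dotC_def cayC_JC[of Y m i] by simp

text \<open>The positions (1, 2), (2, 3), (3, 1) carry the independent off-diagonal entries. Each
  counts twice, since the transposed position holds its conjugate.\<close>

lemma formC_eq:
  assumes X: "X \<in> JC" and Y: "Y \<in> JC"
  shows "formC X Y = cayC c0 X 1 1 * cayC c0 Y 1 1 + cayC c0 X 2 2 * cayC c0 Y 2 2 + cayC c0 X 3 3 * cayC c0 Y 3 3
    + 2 * (dotC X Y 1 2 + dotC X Y 2 3 + dotC X Y 3 1)"
proof -
  have "formC X Y = (\<Sum>i\<in>UNIV. \<Sum>m\<in>UNIV. dotC X Y i m)"
    by (simp add: formC_def trC_eq cayC_jordanC multC_dotC X Y dotC_commute[of Y X] sum_3 add_divide_distrib)
  then show ?thesis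
    by (simp add: sum_3 dotC_diag[OF X] dotC_swap[OF X Y, of 2 1] dotC_swap[OF X Y, of 3 2]
        dotC_swap[OF X Y, of 1 3])
qed

lemma cayC_oneC:
  "cayC c0 oneC i j = of_bool (i = j)" "cayC c1 oneC i j = 0" "cayC c2 oneC i j = 0" "cayC c3 oneC i j = 0"
  "cayC c4 oneC i j = 0" "cayC c5 oneC i j = 0" "cayC c6 oneC i j = 0" "cayC c7 oneC i j = 0"
  by (simp_all add: cayC_def oneC_def cmat_one_def cay_one_def coord_defs complex_eq_iff)

lemma cayC_crossC:
  assumes f: "f \<in> coords"
  shows "cayC f (crossC X X) i j = (\<Sum>m\<in>UNIV. multC f X i m X m j) - trC X * cayC f X i j
    + 1 / 2 * ((trC X)^2 - formC X X) * cayC f oneC i j"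
  unfolding crossC_def
  by (simp add: cayC_add[OF f] cayC_diff[OF f] cayC_cscale[OF f] cayC_jordanC[OF f] sum.distrib
      power2_eq_square field_simps flip: sum_distrib_left)

text \<open>X x X is the adjugate of X; its diagonal consists of the principal 2 x 2 minors.\<close>

lemma crossC_diag:
  assumes X: "X \<in> JC"
  shows "cayC c0 (crossC X X) 1 1 = cayC c0 X 2 2 * cayC c0 X 3 3 - dotC X X 2 3"
    "cayC c0 (crossC X X) 2 2 = cayC c0 X 3 3 * cayC c0 X 1 1 - dotC X X 3 1"
    "cayC c0 (crossC X X) 3 3 = cayC c0 X 1 1 * cayC c0 X 2 2 - dotC X X 1 2"
  by (simp_all add: cayC_crossC multC_dotC[OF X] sum_3 cayC_oneC trC_eq formC_eq[OF X X] dotC_diag[OF X]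
     dotC_swap[OF X X, of 2 1] dotC_swap[OF X X, of 3 2] dotC_swap[OF X X, of 1 3] power2_eq_square field_simps)

lemma multC_diag:
  assumes X: "X \<in> JC" and f: "f \<in> coords"
  shows "multC f X i i X i j = cayC c0 X i i * cayC f X i j" "multC f X j i X i i = cayC c0 X i i * cayC f X j i"
  using f unfolding coords_def by (auto simp: multC_coord cayC_JC_diag[OF X])

lemma crossC_offdiag:
  assumes X: "X \<in> JC" and f: "f \<in> coords"
  shows "cayC f (crossC X X) 1 2 = multC f X 1 3 X 3 2 - cayC c0 X 3 3 * cayC f X 1 2"
    "cayC f (crossC X X) 2 3 = multC f X 2 1 X 1 3 - cayC c0 X 1 1 * cayC f X 2 3"
    "cayC f (crossC X X) 3 1 = multC f X 3 2 X 2 1 - cayC c0 X 2 2 * cayC f X 3 1"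
proof -
  have "cayC f oneC 1 2 = 0" "cayC f oneC 2 3 = 0" "cayC f oneC 3 1 = 0"
    using f unfolding coords_def by (auto simp: cayC_oneC)
  then show "cayC f (crossC X X) 1 2 = multC f X 1 3 X 3 2 - cayC c0 X 3 3 * cayC f X 1 2"
    "cayC f (crossC X X) 2 3 = multC f X 2 1 X 1 3 - cayC c0 X 1 1 * cayC f X 2 3"
    "cayC f (crossC X X) 3 1 = multC f X 3 2 X 2 1 - cayC c0 X 2 2 * cayC f X 3 1"
    by (simp_all add: cayC_crossC[OF f] sum_3 multC_diag[OF X f] trC_eq algebra_simps)
qed

text \<open>For Hermitian X this is the scalar coordinate of x_ki (x_ij x_jk), written as the inner
  product of x_ik with x_ij x_jk.\<close>

definition tripleC :: "jc \<Rightarrow> 3 \<Rightarrow> 3 \<Rightarrow> 3 \<Rightarrow> complex" where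
  "tripleC X i j k = cayC c0 X i k * multC c0 X i j X j k + cayC c1 X i k * multC c1 X i j X j k
     + cayC c2 X i k * multC c2 X i j X j k + cayC c3 X i k * multC c3 X i j X j k
     + cayC c4 X i k * multC c4 X i j X j k + cayC c5 X i k * multC c5 X i j X j k
     + cayC c6 X i k * multC c6 X i j X j k + cayC c7 X i k * multC c7 X i j X j k"

text \<open>The scalar part of a triple product of octonions is cyclic although the product is not
  associative; here this is verified by expansion.\<close>

lemma tripleC_cycle:
  assumes X: "X \<in> JC" shows "tripleC X i j k = tripleC X j k i"
  unfolding tripleC_def multC_coord cayC_JC[OF X, of i k] cayC_JC[OF X, of i j]
  by (simp add: algebra_simps)

text \<open>Freudenthal's formula for the determinant of a Hermitian octonion matrix. The three
  off-diagonal positions give cyclic rearrangements of one triple product, and the resulting factor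
  3 cancels the 1/3 in the definition.\<close>

lemma detC_eq:
  assumes X: "X \<in> JC"
  shows "detC X = cayC c0 X 1 1 * cayC c0 X 2 2 * cayC c0 X 3 3 - cayC c0 X 1 1 * dotC X X 2 3
    - cayC c0 X 2 2 * dotC X X 3 1 - cayC c0 X 3 3 * dotC X X 1 2 + 2 * tripleC X 1 3 2"
proof -
  have "dotC X (crossC X X) 1 2 = tripleC X 1 3 2 - cayC c0 X 3 3 * dotC X X 1 2"
    "dotC X (crossC X X) 2 3 = tripleC X 2 1 3 - cayC c0 X 1 1 * dotC X X 2 3"
    "dotC X (crossC X X) 3 1 = tripleC X 3 2 1 - cayC c0 X 2 2 * dotC X X 3 1"
    unfolding dotC_def tripleC_def by (simp_all add: crossC_offdiag[OF X] algebra_simps)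
  note 1 = this
  have 2: "tripleC X 2 1 3 = tripleC X 1 3 2" "tripleC X 3 2 1 = tripleC X 1 3 2"
    using tripleC_cycle[OF X] by metis+
  have "formC X (crossC X X) = 3 * (cayC c0 X 1 1 * cayC c0 X 2 2 * cayC c0 X 3 3 - cayC c0 X 1 1 * dotC X X 2 3
    - cayC c0 X 2 2 * dotC X X 3 1 - cayC c0 X 3 3 * dotC X X 1 2 + 2 * tripleC X 1 3 2)"
    unfolding formC_eq[OF X JC_crossC[OF X X]] crossC_diag[OF X] 1 2 by (simp add: algebra_simps)
  then show ?thesis
    by (simp add: detC_def)
qed

section \<open>The model of skew matrices and pairs of vectors\<close>

text \<open>
  Under \<open>SU(6) \<times> SU(2)\<close> the space \<open>J\<^sup>C\<close> is the sum of the second exterior power of \<open>C\<^sup>6\<close> and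
  \<open>C\<^sup>6 \<otimes> C\<^sup>2\<close>. The indices 1, 2 | 3, 4 | 5, 6 of \<open>C\<^sup>6\<close> belong to the rows 1 | 2 | 3 of a matrix in
  \<open>J\<^sup>C\<close>. The entry at \<open>(i, j)\<close> contributes its coordinates 0, 2, 4, 6 to the \<open>2 \<times> 2\<close> block \<open>(i, j)\<close> of
  the skew matrix, and its coordinates 1, 3, 5, 7 to the components of the two vectors that belong
  to the remaining row. The scalars are chosen so that \<open>\<tau>\<gamma>\<close> becomes complex conjugation.
\<close>

definition to_model :: "jc \<Rightarrow> model" where
  "to_model X = (let x = (\<lambda>f. cayC f X 1 2); y = (\<lambda>f. cayC f X 2 3); z = (\<lambda>f. cayC f X 3 1) in
    (skew6 (cayC c0 X 1 1) (- x c2 - \<i> * x c6) (x c0 - \<i> * x c4) (z c2 + \<i> * z c6) (z c0 + \<i> * z c4)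
       (- x c0 - \<i> * x c4) (- x c2 + \<i> * x c6) (\<i> * z c4 - z c0) (z c2 - \<i> * z c6)
       (cayC c0 X 2 2) (- y c2 - \<i> * y c6) (y c0 - \<i> * y c4) (- y c0 - \<i> * y c4) (- y c2 + \<i> * y c6)
       (cayC c0 X 3 3),
     vec6 (y c3 + \<i> * y c7) (y c1 - \<i> * y c5) (z c3 + \<i> * z c7) (z c1 - \<i> * z c5) (x c3 + \<i> * x c7) (x c1 - \<i> * x c5),
     vec6 (y c1 + \<i> * y c5) (\<i> * y c7 - y c3) (z c1 + \<i> * z c5) (\<i> * z c7 - z c3) (x c1 + \<i> * x c5) (\<i> * x c7 - x c3)))"

definition cubicM :: "model \<Rightarrow> complex" where
  "cubicM = (\<lambda>(S, u, v). Pf S + (\<Sum>r\<in>UNIV. \<Sum>s\<in>UNIV. S $ r $ s * u $ r * v $ s))"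

definition hermM :: "model \<Rightarrow> model \<Rightarrow> complex" where
  "hermM = (\<lambda>(S, u, v) (S', u', v'). 1 / 2 * (\<Sum>r\<in>UNIV. \<Sum>s\<in>UNIV. cnj (S $ r $ s) * S' $ r $ s)
     + (\<Sum>r\<in>UNIV. cnj (u $ r) * u' $ r) + (\<Sum>r\<in>UNIV. cnj (v $ r) * v' $ r))"

text \<open>A cubic identity in 27 complex variables. The entries at (1, 3) and (3, 2) are first
  expressed through those at (3, 1) and (2, 3), after which both sides can be expanded and
  compared.\<close>

lemma cubicM_to_model:
  assumes X: "X \<in> JC" shows "cubicM (to_model X) = detC X"
  unfolding detC_eq[OF X] tripleC_def multC_coord dotC_def
    cayC_JC[OF X, of 1 3] cayC_JC[OF X, of 3 2] cubicM_def to_model_def Let_def split_conv sum_6 Pf_def skew6_def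
    vec6_nth
  by (simp add: algebra_simps)

lemma tau_JC: "X \<in> JC \<Longrightarrow> tau X \<in> JC"
  by (simp add: tau_def JC_iff subspace_neg subspace_J)

lemma cayC_tau: "X \<in> JC \<Longrightarrow> f \<in> coords \<Longrightarrow> cayC f (tau X) i j = cnj (cayC f X i j)"
  by (simp add: tau_def cayC_def linear_neg[OF linear_coord] complex_eq_iff)

text \<open>Off-diagonal coordinates enter the model in pairs p + i q and p - i q up to sign, and |p
  + i q|^2 + |p - i q|^2 = 2 (|p|^2 + |q|^2) yields the factor 2 of \<open>formC_eq\<close>. The 1/2
  in \<open>hermM\<close> compensates that each entry of a skew matrix occurs twice.\<close>

lemma hermM_to_model:
  assumes X: "X \<in> JC" and Y: "Y \<in> JC" shows "hermM (to_model X) (to_model Y) = hermC X Y"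
  unfolding hermC_def formC_eq[OF tau_JC[OF X] Y] dotC_def
  unfolding hermM_def to_model_def Let_def split_conv sum_6 skew6_def vec6_nth
  by (simp add: algebra_simps cayC_tau[OF X])

definition vec3 :: "'a \<Rightarrow> 'a \<Rightarrow> 'a \<Rightarrow> 'a ^ 3" where
  "vec3 a b c = (\<chi> i. if i = 1 then a else if i = 2 then b else c)"

lemma vec3_nth [simp]: "vec3 a b c $ 1 = a" "vec3 a b c $ 2 = b" "vec3 a b c $ 3 = c"
  by (simp_all add: vec3_def)

definition herm3 :: "real \<Rightarrow> real \<Rightarrow> real \<Rightarrow> cayley \<Rightarrow> cayley \<Rightarrow> cayley \<Rightarrow> cmat3" where
  "herm3 a b c x y z = vec3 (vec3 (octonion a 0 0 0 0 0 0 0) x (cay_cnj z))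
     (vec3 (cay_cnj x) (octonion b 0 0 0 0 0 0 0) y) (vec3 z (cay_cnj y) (octonion c 0 0 0 0 0 0 0))"

lemma herm3_J: "herm3 a b c x y z \<in> J"
  by (simp add: J_iff forall_3 herm3_def octonion_def cay_cnj_def hcnj_def split_beta complex_eq_iff)

text \<open>The pairs p + i q, p - i q of \<open>to_model\<close> are solved for p and q, which
  gives the denominators 2. With \<open>f\<close> equal to \<open>Re\<close> or \<open>Im\<close>
  this is one of the two halves of the inverse of \<open>to_model\<close>.\<close>

definition model_part :: "(complex \<Rightarrow> real) \<Rightarrow> model \<Rightarrow> cmat3" where
  "model_part f = (\<lambda>(S, u, v). herm3 (f (S$1$2)) (f (S$3$4)) (f (S$5$6))
     (octonion (f ((S$1$4 - S$2$3) / 2)) (f ((u$6 + v$5) / 2)) (f (- (S$1$3 + S$2$4) / 2)) (f ((u$5 - v$6) / 2))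
        (f (\<i> * (S$1$4 + S$2$3) / 2)) (f (\<i> * (u$6 - v$5) / 2)) (f (\<i> * (S$1$3 - S$2$4) / 2)) (f (- \<i> * (u$5 + v$6) / 2)))
     (octonion (f ((S$3$6 - S$4$5) / 2)) (f ((u$2 + v$1) / 2)) (f (- (S$3$5 + S$4$6) / 2)) (f ((u$1 - v$2) / 2))
        (f (\<i> * (S$3$6 + S$4$5) / 2)) (f (\<i> * (u$2 - v$1) / 2)) (f (\<i> * (S$3$5 - S$4$6) / 2)) (f (- \<i> * (u$1 + v$2) / 2)))
     (octonion (f ((S$1$6 - S$2$5) / 2)) (f ((u$4 + v$3) / 2)) (f ((S$1$5 + S$2$6) / 2)) (f ((u$3 - v$4) / 2))
        (f (- \<i> * (S$1$6 + S$2$5) / 2)) (f (\<i> * (u$4 - v$3) / 2)) (f (- \<i> * (S$1$5 - S$2$6) / 2)) (f (- \<i> * (u$3 + v$4) / 2))))"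

definition of_model :: "model \<Rightarrow> jc" where
  "of_model M = (model_part Re M, model_part Im M)"

lemma of_model_JC [simp]: "of_model M \<in> JC"
  by (cases M) (simp add: JC_iff of_model_def model_part_def herm3_J)

lemma cayC_of_model:
  fixes S :: "complex ^ 6 ^ 6"
  shows "cayC c0 (of_model (S, u, v)) 1 1 = S$1$2" "cayC c0 (of_model (S, u, v)) 2 2 = S$3$4" 
  "cayC c0 (of_model (S, u, v)) 3 3 = S$5$6"
  "cayC c0 (of_model (S, u, v)) 1 2 = (S$1$4 - S$2$3) / 2" "cayC c1 (of_model (S, u, v)) 1 2 = (u$6 + v$5) / 2"
  "cayC c2 (of_model (S, u, v)) 1 2 = - (S$1$3 + S$2$4) / 2" "cayC c3 (of_model (S, u, v)) 1 2 = (u$5 - v$6) / 2"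
  "cayC c4 (of_model (S, u, v)) 1 2 = \<i> * (S$1$4 + S$2$3) / 2" "cayC c5 (of_model (S, u, v)) 1 2 = \<i> * (u$6 - v$5) / 2"
  "cayC c6 (of_model (S, u, v)) 1 2 = \<i> * (S$1$3 - S$2$4) / 2" "cayC c7 (of_model (S, u, v)) 1 2 = - \<i> * (u$5 + v$6) / 2"
  "cayC c0 (of_model (S, u, v)) 2 3 = (S$3$6 - S$4$5) / 2" "cayC c1 (of_model (S, u, v)) 2 3 = (u$2 + v$1) / 2"
  "cayC c2 (of_model (S, u, v)) 2 3 = - (S$3$5 + S$4$6) / 2" "cayC c3 (of_model (S, u, v)) 2 3 = (u$1 - v$2) / 2"
  "cayC c4 (of_model (S, u, v)) 2 3 = \<i> * (S$3$6 + S$4$5) / 2" "cayC c5 (of_model (S, u, v)) 2 3 = \<i> * (u$2 - v$1) / 2"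
  "cayC c6 (of_model (S, u, v)) 2 3 = \<i> * (S$3$5 - S$4$6) / 2" "cayC c7 (of_model (S, u, v)) 2 3 = - \<i> * (u$1 + v$2) / 2"
  "cayC c0 (of_model (S, u, v)) 3 1 = (S$1$6 - S$2$5) / 2" "cayC c1 (of_model (S, u, v)) 3 1 = (u$4 + v$3) / 2"
  "cayC c2 (of_model (S, u, v)) 3 1 = (S$1$5 + S$2$6) / 2" "cayC c3 (of_model (S, u, v)) 3 1 = (u$3 - v$4) / 2"
  "cayC c4 (of_model (S, u, v)) 3 1 = - \<i> * (S$1$6 + S$2$5) / 2" "cayC c5 (of_model (S, u, v)) 3 1 = \<i> * (u$4 - v$3) / 2"
  "cayC c6 (of_model (S, u, v)) 3 1 = - \<i> * (S$1$5 - S$2$6) / 2" "cayC c7 (of_model (S, u, v)) 3 1 = - \<i> * (u$3 + v$4) / 2"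
  unfolding cayC_def of_model_def model_part_def split_conv herm3_def fst_conv snd_conv vec3_nth coord_octonion
  by (simp_all only: complex.collapse)

lemma to_model_of_model: "skew S \<Longrightarrow> to_model (of_model (S, u, v)) = (S, u, v)"
  unfolding to_model_def Let_def cayC_of_model
  by (simp add: vec6_eq_iff skew6_def skew_lower field_simps)

lemma JC_eqI:
  assumes X: "X \<in> JC" and Y: "Y \<in> JC"
    and d: "cayC c0 X 1 1 = cayC c0 Y 1 1" "cayC c0 X 2 2 = cayC c0 Y 2 2" "cayC c0 X 3 3 = cayC c0 Y 3 3"
    and o: "\<And>f. f \<in> coords \<Longrightarrow> cayC f X 1 2 = cayC f Y 1 2" "\<And>f. f \<in> coords \<Longrightarrow> cayC f X 2 3 = cayC f Y 2 3"
      "\<And>f. f \<in> coords \<Longrightarrow> cayC f X 3 1 = cayC f Y 3 1"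
  shows "X = Y"
proof (rule jc_eqI)
  fix f and i j :: 3 assume f: "f \<in> coords"
  have d': "cayC f X i i = cayC f Y i i" if "cayC c0 X i i = cayC c0 Y i i" for i
    using f that unfolding coords_def by (auto simp: cayC_JC_diag[OF X] cayC_JC_diag[OF Y])
  have o': "cayC f X j i = cayC f Y j i" if "\<And>f. f \<in> coords \<Longrightarrow> cayC f X i j = cayC f Y i j" for i j
    using f that[OF f] unfolding coords_def by (auto simp: cayC_JC[OF X, of j i] cayC_JC[OF Y, of j i])
  show "cayC f X i j = cayC f Y i j"
    using d' d o[OF f] o'[OF o(1)] o'[OF o(2)] o'[OF o(3)] exhaust_3[of i] exhaust_3[of j] by auto
qed

lemma of_model_to_model:
  assumes X: "X \<in> JC" shows "of_model (to_model X) = X"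
proof -
  have "cayC f (of_model (to_model X)) 1 2 = cayC f X 1 2 \<and> cayC f (of_model (to_model X)) 2 3 = cayC f X 2 3
    \<and> cayC f (of_model (to_model X)) 3 1 = cayC f X 3 1" if "f \<in> coords" for f
    using that unfolding coords_def
    by (auto simp: to_model_def Let_def cayC_of_model skew6_def algebra_simps)
  then show ?thesis
    by (intro JC_eqI) (simp_all add: X to_model_def Let_def cayC_of_model skew6_def)
qed

text \<open>The type \<open>model\<close> admits arbitrary matrices; the skew ones form the image of
  \<open>to_model\<close>.\<close>

definition model_space :: "model set" where "model_space = {M. skew (fst M)}"

lemma to_model_model_space [simp]: "to_model X \<in> model_space"
  by (simp add: to_model_def Let_def model_space_def)

lemma to_model_of_model_model_space: "M \<in> model_space \<Longrightarrow> to_model (of_model M) = M"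
  by (cases M) (simp add: model_space_def to_model_of_model)

definition mscale :: "complex \<Rightarrow> model \<Rightarrow> model" where
  "mscale c = (\<lambda>(S, u, v). (\<chi> r. c *s S $ r, c *s u, c *s v))"

lemma to_model_add: "to_model (X + Y) = to_model X + to_model Y"
  unfolding to_model_def Let_def by (simp add: cayC_add skew6_def vec6_eq_iff algebra_simps)

lemma to_model_cscale: "to_model (c *\<^sub>c X) = mscale c (to_model X)"
  unfolding to_model_def Let_def mscale_def by (simp add: cayC_cscale skew6_def vec6_eq_iff algebra_simps)

lemma to_model_inj: "X \<in> JC \<Longrightarrow> Y \<in> JC \<Longrightarrow> to_model X = to_model Y \<Longrightarrow> X = Y"
  by (metis of_model_to_model)

section \<open>The involutions in the coordinates of the model\<close>

definition cnjM :: "model \<Rightarrow> model" where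
  "cnjM = (\<lambda>(S, u, v). (\<chi> r s. cnj (S $ r $ s), \<chi> r. cnj (u $ r), \<chi> r. cnj (v $ r)))"

lemma coord_gamma:
  "c0 (cay_gamma x) = c0 x" "c1 (cay_gamma x) = c1 x" "c2 (cay_gamma x) = c2 x" "c3 (cay_gamma x) = c3 x"
  "c4 (cay_gamma x) = - c4 x" "c5 (cay_gamma x) = - c5 x" "c6 (cay_gamma x) = - c6 x" "c7 (cay_gamma x) = - c7 x"
  "c0 (cay_gammaH x) = c0 x" "c1 (cay_gammaH x) = c1 x" "c2 (cay_gammaH x) = - c2 x" "c3 (cay_gammaH x) = - c3 x"
  "c4 (cay_gammaH x) = c4 x" "c5 (cay_gammaH x) = c5 x" "c6 (cay_gammaH x) = - c6 x" "c7 (cay_gammaH x) = - c7 x"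
  "c0 (cay_gammaC x) = c0 x" "c1 (cay_gammaC x) = - c1 x" "c2 (cay_gammaC x) = c2 x" "c3 (cay_gammaC x) = - c3 x"
  "c4 (cay_gammaC x) = c4 x" "c5 (cay_gammaC x) = - c5 x" "c6 (cay_gammaC x) = c6 x" "c7 (cay_gammaC x) = - c7 x"
  by (simp_all add: coord_defs cay_gamma_def cay_gammaH_def cay_gammaC_def quat_gammaH_def quat_gammaC_def split_beta)

lemma gamma_cnj:
  "cay_gamma (cay_cnj x) = cay_cnj (cay_gamma x)" "cay_gammaH (cay_cnj x) = cay_cnj (cay_gammaH x)"
  "cay_gammaC (cay_cnj x) = cay_cnj (cay_gammaC x)"
  by (simp_all add: prod_eq_iff cay_cnj_def hcnj_def cay_gamma_def cay_gammaH_def cay_gammaC_def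
      quat_gammaH_def quat_gammaC_def split_beta)

lemma entrywise_JC: "X \<in> JC \<Longrightarrow> (\<And>x. g (cay_cnj x) = cay_cnj (g x)) \<Longrightarrow> entrywise g X \<in> JC"
  by (simp add: entrywise_def JC_iff J_iff) metis

lemma cayC_gamma:
  "X \<in> JC \<Longrightarrow> f \<in> {c0, c1, c2, c3} \<Longrightarrow> cayC f (gamma X) i j = cayC f X i j"
  "X \<in> JC \<Longrightarrow> f \<in> {c4, c5, c6, c7} \<Longrightarrow> cayC f (gamma X) i j = - cayC f X i j"
  by (auto simp: gamma_def entrywise_def coord_gamma cayC_def complex_eq_iff)

lemma cayC_gammaH:
  "X \<in> JC \<Longrightarrow> f \<in> {c0, c1, c4, c5} \<Longrightarrow> cayC f (gammaH X) i j = cayC f X i j"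
  "X \<in> JC \<Longrightarrow> f \<in> {c2, c3, c6, c7} \<Longrightarrow> cayC f (gammaH X) i j = - cayC f X i j"
  by (auto simp: gammaH_def entrywise_def coord_gamma cayC_def complex_eq_iff)

lemma cayC_gammaC:
  "X \<in> JC \<Longrightarrow> f \<in> {c0, c2, c4, c6} \<Longrightarrow> cayC f (gammaC X) i j = cayC f X i j"
  "X \<in> JC \<Longrightarrow> f \<in> {c1, c3, c5, c7} \<Longrightarrow> cayC f (gammaC X) i j = - cayC f X i j"
  by (auto simp: gammaC_def entrywise_def coord_gamma cayC_def complex_eq_iff)

lemma gamma_JC:
  "X \<in> JC \<Longrightarrow> gamma X \<in> JC" "X \<in> JC \<Longrightarrow> gammaH X \<in> JC" "X \<in> JC \<Longrightarrow> gammaC X \<in> JC"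
  by (simp_all add: gamma_def gammaH_def gammaC_def entrywise_JC gamma_cnj)

text \<open>The diagonal of the matrix I in the action of gamma_H.\<close>

definition sgn6 :: "6 \<Rightarrow> real" where "sgn6 r = (if r \<in> {1, 3, 5} then 1 else - 1)"

text \<open>gamma negates the coordinates 4 to 7, which are exactly those that
  \<open>to_model\<close> multiplies by i. Hence i changes sign together with the conjugation of the
  coordinates by tau.\<close>

lemma to_model_tau_gamma: "X \<in> JC \<Longrightarrow> to_model (tau (gamma X)) = cnjM (to_model X)"
  unfolding to_model_def Let_def cnjM_def
  by (simp add: cayC_tau gamma_JC cayC_gamma skew6_def vec6_eq_iff)

lemma to_model_gammaC: "X \<in> JC \<Longrightarrow> to_model (gammaC X) = (\<lambda>(S, u, v). (S, - u, - v)) (to_model X)"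
  unfolding to_model_def Let_def
  by (simp add: cayC_gammaC skew6_def vec6_eq_iff)

text \<open>gamma_H negates the coordinates 2, 3, 6, 7. They sit in S where both indices have the
  same parity (apart from the diagonal), in u at the odd indices and in v at the even ones.\<close>

lemma to_model_gammaH: "X \<in> JC \<Longrightarrow> to_model (gammaH X) =
   (\<lambda>(S, u, v). (\<chi> r s. - of_real (sgn6 r * sgn6 s) * S$r$s, \<chi> r. - of_real (sgn6 r) * u$r, \<chi> r. of_real (sgn6 r) * v$r)) (to_model X)"
  unfolding to_model_def Let_def
  by (simp add: cayC_gammaH skew6_def vec6_eq_iff sgn6_def)

section \<open>Isometries preserving tensors of rank one\<close>

text \<open>All 2 x 2 minors of the matrix with columns \<open>x\<close> and \<open>y\<close>
  vanish: the tensor (x, y) in R^n (x) R^2 has rank at most one.\<close>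

definition parallel :: "real ^ 'n \<Rightarrow> real ^ 'n \<Rightarrow> bool" where
  "parallel x y \<longleftrightarrow> (\<forall>r s. x $ r * y $ s = y $ r * x $ s)"

lemma parallel_scaleR: "parallel x y \<Longrightarrow> x \<noteq> 0 \<Longrightarrow> \<exists>t. y = t *\<^sub>R x"
proof -
  assume p: "parallel x y" and "x \<noteq> 0"
  then obtain r where r: "x $ r \<noteq> 0" by (auto simp: vec_eq_iff)
  have "y = (y $ r / x $ r) *\<^sub>R x"
    using p r by (auto simp: vec_eq_iff parallel_def field_simps)
  then show ?thesis ..
qed

lemma parallel_unit:
  assumes "parallel x w" "norm w = 1" shows "x = (w \<bullet> x) *\<^sub>R w"
proof -
  have "parallel w x" using assms by (simp add: parallel_def mult.commute)
  moreover have "w \<noteq> 0" using assms by auto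
  ultimately obtain t where "x = t *\<^sub>R w" using parallel_scaleR by blast
  then show ?thesis using assms by (simp add: dot_square_norm)
qed

text \<open>A linear change of the pair multiplies its minors by the determinant, here
  \<open>b * b + c * c\<close>.\<close>

lemma parallel_rotate: "parallel x y \<Longrightarrow> parallel (b *\<^sub>R x + c *\<^sub>R y) (b *\<^sub>R y - c *\<^sub>R x)"
  unfolding parallel_def
proof (intro allI)
  fix r s assume "\<forall>r s. x $ r * y $ s = y $ r * x $ s"
  then have h: "x $ r * y $ s = y $ r * x $ s" by blast
  have "(b *\<^sub>R x + c *\<^sub>R y) $ r * (b *\<^sub>R y - c *\<^sub>R x) $ s - (b *\<^sub>R y - c *\<^sub>R x) $ r * (b *\<^sub>R x + c *\<^sub>R y) $ s
     = (b * b + c * c) * (x $ r * y $ s - y $ r * x $ s)"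
    by (simp add: algebra_simps)
  then show "(b *\<^sub>R x + c *\<^sub>R y) $ r * (b *\<^sub>R y - c *\<^sub>R x) $ s = (b *\<^sub>R y - c *\<^sub>R x) $ r * (b *\<^sub>R x + c *\<^sub>R y) $ s"
    using h by simp
qed

lemma norm_rotate:
  assumes "b\<^sup>2 + c\<^sup>2 = 1"
  shows "(norm (b *\<^sub>R x + c *\<^sub>R y))\<^sup>2 + (norm (b *\<^sub>R y - c *\<^sub>R x))\<^sup>2 = (norm x)\<^sup>2 + (norm (y :: 'a :: real_inner))\<^sup>2"
proof -
  define p q r where "p = x \<bullet> x" and "q = y \<bullet> y" and "r = x \<bullet> y"
  have "(norm (b *\<^sub>R x + c *\<^sub>R y))\<^sup>2 = b * b * p + 2 * b * c * r + c * c * q"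
    by (simp only: power2_norm_eq_inner inner_add_left inner_add_right inner_scaleR_left inner_scaleR_right
        inner_commute[of y x] p_def[symmetric] q_def[symmetric] r_def[symmetric]) (simp add: algebra_simps)
  moreover have "(norm (b *\<^sub>R y - c *\<^sub>R x))\<^sup>2 = b * b * q - 2 * b * c * r + c * c * p"
    by (simp only: power2_norm_eq_inner inner_diff_left inner_diff_right inner_scaleR_left inner_scaleR_right
        inner_commute[of y x] p_def[symmetric] q_def[symmetric] r_def[symmetric]) (simp add: algebra_simps)
  ultimately have "(norm (b *\<^sub>R x + c *\<^sub>R y))\<^sup>2 + (norm (b *\<^sub>R y - c *\<^sub>R x))\<^sup>2 = (b\<^sup>2 + c\<^sup>2) * (p + q)"
    by (simp add: power2_eq_square algebra_simps)
  then show ?thesis using assms by (simp add: p_def q_def power2_norm_eq_inner)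
qed

text \<open>
  If \<open>Q\<close> were nonzero, \<open>P\<close> and \<open>Q\<close> would both take values in the line through \<open>P (axis i 1)\<close>, and \<open>u \<mapsto> (P u, Q u)\<close> would
  embed three orthonormal vectors into a plane.
\<close>

lemma parallel_isometry_fixed:
  fixes P Q :: "real ^ 'n \<Rightarrow> real ^ 'n"
  assumes "linear P" "linear Q"
    and parallel: "\<And>u. parallel (P u) (Q u)" and iso: "\<And>u. (norm (P u))\<^sup>2 + (norm (Q u))\<^sup>2 = (norm u)\<^sup>2"
    and ijk: "i \<noteq> j" "i \<noteq> k" "j \<noteq> (k :: 'n)"
    and Qe: "Q (axis i 1) = 0"
  shows "Q u = 0"
proof -
  interpret P: linear P by fact
  interpret Q: linear Q by fact
  define e where "e = (axis i 1 :: real ^ 'n)"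
  define w where "w = P e"
  have w: "norm w = 1" using iso[of e] Qe by (simp add: e_def w_def abs_square_eq_1)
  \<comment> \<open>Subtracting the condition at \<open>v\<close> from the one at
    \<open>e + v\<close> leaves the mixed terms; with \<open>Q e = 0\<close> they say that
    \<open>Q v\<close> is parallel to \<open>w\<close>.\<close>
  have Qw: "Q v = (w \<bullet> Q v) *\<^sub>R w" for v
  proof (rule parallel_unit[OF _ w])
    show "parallel (Q v) w" unfolding parallel_def
    proof (intro allI)
      fix r s
      have "P (e + v) $ r * Q (e + v) $ s = Q (e + v) $ r * P (e + v) $ s"
        "P v $ r * Q v $ s = Q v $ r * P v $ s" using parallel unfolding parallel_def by blast+
      then show "Q v $ r * w $ s = w $ r * Q v $ s"
        using Qe by (simp add: P.add Q.add e_def[symmetric] w_def algebra_simps)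
    qed
  qed
  have Qr: "Q v $ r = (w \<bullet> Q v) * w $ r" for v r
    by (subst Qw) simp
  have "w \<bullet> Q v0 = 0" for v0
  proof (rule ccontr)
    assume v0: "w \<bullet> Q v0 \<noteq> 0"
    \<comment> \<open>\<open>Q v\<close> is a nonzero multiple of \<open>w\<close> here, and
      \<open>P v\<close> is parallel to \<open>Q v\<close>.\<close>
    have Pw': "P v = (w \<bullet> P v) *\<^sub>R w" if "w \<bullet> Q v \<noteq> 0" for v
    proof (rule parallel_unit[OF _ w])
      show "parallel (P v) w" unfolding parallel_def
      proof (intro allI)
        fix r s
        have "P v $ r * Q v $ s = Q v $ r * P v $ s" using parallel unfolding parallel_def by blast
        then have "(w \<bullet> Q v) * (P v $ r * w $ s) = (w \<bullet> Q v) * (w $ r * P v $ s)"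
          unfolding Qr[of v] by (simp only: mult.left_commute mult.assoc mult.commute)
        then show "P v $ r * w $ s = w $ r * P v $ s" using that by simp
      qed
    qed
    have Pw: "P v = (w \<bullet> P v) *\<^sub>R w" for v
    proof (cases "w \<bullet> Q v = 0")
      case True
      \<comment> \<open>A vector annihilated by \<open>Q\<close> is the difference of two vectors to
        which \<open>Pw'\<close> applies.\<close>
      then have "w \<bullet> Q (v + v0) \<noteq> 0" using v0 by (simp add: Q.add inner_add_right)
      note h = Pw'[OF this] Pw'[OF v0]
      have "P v = P (v + v0) - P v0" by (simp add: P.add)
      also have "\<dots> = (w \<bullet> P (v + v0)) *\<^sub>R w - (w \<bullet> P v0) *\<^sub>R w"
        by (rule arg_cong2[where f = minus]) (fact h)+
      also have "\<dots> = (w \<bullet> P v) *\<^sub>R w" by (simp add: P.add inner_add_right scaleR_add_left)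
      finally show ?thesis .
    qed (rule Pw')
    have sq: "(w \<bullet> P v)\<^sup>2 + (w \<bullet> Q v)\<^sup>2 = (norm v)\<^sup>2" for v
    proof -
      have "(norm (P v))\<^sup>2 = (w \<bullet> P v)\<^sup>2" by (subst Pw) (simp add: w)
      moreover have "(norm (Q v))\<^sup>2 = (w \<bullet> Q v)\<^sup>2" by (subst Qw) (simp add: w)
      ultimately show ?thesis using iso[of v] by simp
    qed
    \<comment> \<open>Polarization of \<open>sq\<close>: sending v to (w . P v, w . Q v) preserves
      inner products and has values in a plane. As e goes to (1, 0), both f and g go to (0, 1) or
      (0, -1), which contradicts their orthogonality.\<close>
    have bil: "(w \<bullet> P u) * (w \<bullet> P v) + (w \<bullet> Q u) * (w \<bullet> Q v) = u \<bullet> v" for u v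
    proof -
      have "(norm (u + v))\<^sup>2 = (norm u)\<^sup>2 + (norm v)\<^sup>2 + 2 * (u \<bullet> v)"
        by (simp add: power2_norm_eq_inner inner_add_left inner_add_right inner_commute)
      then show ?thesis using sq[of "u + v"] sq[of u] sq[of v]
        by (simp add: P.add Q.add inner_add_right power2_eq_square algebra_simps)
    qed
    define f g where "f = (axis j 1 :: real ^ 'n)" and "g = (axis k 1 :: real ^ 'n)"
    have "w \<bullet> P e = 1" "w \<bullet> Q e = 0" using w Qe by (simp_all add: w_def dot_square_norm e_def)
    moreover have "e \<bullet> f = 0" "e \<bullet> g = 0" "f \<bullet> g = 0" "f \<bullet> f = 1" "g \<bullet> g = 1"
      using ijk by (simp_all add: e_def f_def g_def inner_axis_axis)
    ultimately have "w \<bullet> P f = 0" "w \<bullet> P g = 0" "(w \<bullet> Q f) * (w \<bullet> Q f) = 1" "(w \<bullet> Q g) * (w \<bullet> Q g) = 1"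
      "(w \<bullet> Q f) * (w \<bullet> Q g) = 0"
      using bil[of e f] bil[of e g] bil[of f f] bil[of g g] bil[of f g] by auto
    then show False by auto
  qed
  then show ?thesis by (subst Qw) simp
qed

text \<open>A rotation of the plane factor makes the second component vanish at one basis vector.
  Then \<open>parallel_isometry_fixed\<close> makes it vanish everywhere, and undoing the rotation
  gives \<open>b\<close> and \<open>c\<close>.\<close>

lemma parallel_isometry:
  fixes P Q :: "real ^ 'n \<Rightarrow> real ^ 'n"
  assumes "linear P" "linear Q"
    and parallel: "\<And>u. parallel (P u) (Q u)" and iso: "\<And>u. (norm (P u))\<^sup>2 + (norm (Q u))\<^sup>2 = (norm u)\<^sup>2"
    and ijk: "i \<noteq> j" "i \<noteq> k" "j \<noteq> (k :: 'n)"
  obtains A b c where "linear A" "\<And>u. norm (A u) = norm u" "b\<^sup>2 + c\<^sup>2 = (1 :: real)"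
    "\<And>u. P u = b *\<^sub>R A u" "\<And>u. Q u = c *\<^sub>R A u"
proof -
  define e where "e = (axis i 1 :: real ^ 'n)"
  \<comment> \<open>\<open>P e\<close> and \<open>Q e\<close> lie on one line; \<open>(b, c)\<close>
    are their coordinates along a unit vector of it.\<close>
  obtain b c w where bcw: "P e = b *\<^sub>R w" "Q e = c *\<^sub>R w" "norm w = 1"
  proof (cases "P e = 0")
    case True
    then have "norm (Q e) = 1" using iso[of e] by (simp add: e_def abs_square_eq_1)
    then show thesis using that[of 0 "Q e" 1] True by simp
  next
    case False
    then obtain t where "Q e = t *\<^sub>R P e" using parallel_scaleR parallel by blast
    then show thesis using that[of "norm (P e)" "P e /\<^sub>R norm (P e)" "t * norm (P e)"] False by simp
  qed
  have bc: "b\<^sup>2 + c\<^sup>2 = 1" using iso[of e] bcw by (simp add: e_def power_mult_distrib)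
  define P' Q' where "P' u = b *\<^sub>R P u + c *\<^sub>R Q u" and "Q' u = b *\<^sub>R Q u - c *\<^sub>R P u" for u
  have lin: "linear P'" "linear Q'"
    unfolding P'_def Q'_def
    by (intro linear_compose_add linear_compose_sub linear_compose_scale_right assms(1,2))+
  have parallel': "parallel (P' u) (Q' u)" for u
    unfolding P'_def Q'_def by (intro parallel_rotate parallel)
  have iso': "(norm (P' u))\<^sup>2 + (norm (Q' u))\<^sup>2 = (norm u)\<^sup>2" for u
    unfolding P'_def Q'_def norm_rotate[OF bc] by (rule iso)
  have "Q' (axis i 1) = 0"
    using bcw unfolding Q'_def e_def[symmetric] by simp
  then have Q0: "Q' u = 0" for u
    using parallel_isometry_fixed[OF lin parallel' iso' ijk] by blast
  have "norm (P' u) = norm u" for u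
    using iso'[of u] Q0[of u] by simp
  moreover have "P u = b *\<^sub>R P' u" for u
  proof -
    have "b *\<^sub>R P' u - c *\<^sub>R Q' u = (b\<^sup>2 + c\<^sup>2) *\<^sub>R P u"
      by (simp add: P'_def Q'_def algebra_simps power2_eq_square)
    then show ?thesis using Q0 bc by simp
  qed
  moreover have "Q u = c *\<^sub>R P' u" for u
  proof -
    have "c *\<^sub>R P' u + b *\<^sub>R Q' u = (b\<^sup>2 + c\<^sup>2) *\<^sub>R Q u"
      by (simp add: P'_def Q'_def algebra_simps power2_eq_square)
    then show ?thesis using Q0 bc by simp
  qed
  ultimately show thesis using that[of P' b c] lin bc by blast
qed

text \<open>The map (u, v) to (P u + R v, Q u + T v) is treated on the two summands first, which
  gives A (x) (b, c) and A' (x) (b', c'). Orthogonality of the summands determines (b', c') up to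
  sign, and tensors with u = v force A' to be A up to sign.\<close>

lemma rank_one_isometry:
  fixes P Q R T :: "real ^ 'n \<Rightarrow> real ^ 'n"
  assumes lin: "linear P" "linear Q" "linear R" "linear T"
    and parallel: "\<And>u v. parallel u v \<Longrightarrow> parallel (P u + R v) (Q u + T v)"
    and iso: "\<And>u v. (norm (P u + R v))\<^sup>2 + (norm (Q u + T v))\<^sup>2 = (norm u)\<^sup>2 + (norm v)\<^sup>2"
    and ijk: "i \<noteq> j" "i \<noteq> k" "j \<noteq> (k :: 'n)"
  obtains A b c t where "orthogonal_matrix A" "b\<^sup>2 + c\<^sup>2 = (1 :: real)" "t = 1 \<or> t = (- 1 :: real)"
    "\<And>u. P u = b *\<^sub>R (A *v u)" "\<And>u. Q u = c *\<^sub>R (A *v u)"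
    "\<And>u. R u = - (t * c) *\<^sub>R (A *v u)" "\<And>u. T u = (t * b) *\<^sub>R (A *v u)"
proof -
  have 0: "P 0 = 0" "Q 0 = 0" "R 0 = 0" "T 0 = 0" using lin by (simp_all add: linear_0)
  have p0: "parallel u 0" "parallel 0 u" "parallel u u" for u :: "real ^ 'n" by (simp_all add: parallel_def)
  have "parallel (P u) (Q u)" "(norm (P u))\<^sup>2 + (norm (Q u))\<^sup>2 = (norm u)\<^sup>2" for u
    using parallel[OF p0(1), of u] iso[of u 0] by (simp_all add: 0)
  from parallel_isometry[OF lin(1,2) this ijk] obtain A b c where
    A: "linear A" "\<And>u. norm (A u) = norm u" and bc: "b\<^sup>2 + c\<^sup>2 = 1" and
    PQ: "\<And>u. P u = b *\<^sub>R A u" "\<And>u. Q u = c *\<^sub>R A u" by metis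
  have "parallel (R u) (T u)" "(norm (R u))\<^sup>2 + (norm (T u))\<^sup>2 = (norm u)\<^sup>2" for u
    using parallel[OF p0(2), of u] iso[of 0 u] by (simp_all add: 0)
  from parallel_isometry[OF lin(3,4) this ijk] obtain A' b' c' where
    A': "linear A'" "\<And>u. norm (A' u) = norm u" and bc': "b'\<^sup>2 + c'\<^sup>2 = 1" and
    RT: "\<And>u. R u = b' *\<^sub>R A' u" "\<And>u. T u = c' *\<^sub>R A' u" by metis
  have oA: "orthogonal_transformation A" using A by (simp add: orthogonal_transformation)
  have "surj A" using oA by (rule orthogonal_transformation_surj)
  \<comment> \<open>For this \<open>u\<close> and \<open>v = axis i 1\<close> both images have the
    same direction in R^n, so the norm identity speaks only of (b, c) and (b', c') and makes them
    orthogonal.\<close>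
  then obtain u where u: "A u = A' (axis i 1)" by (metis surjD)
  define v where "v = (axis i 1 :: real ^ 'n)"
  have nv: "norm v = 1" "norm u = 1" using u A(2)[of u] A'(2)[of v] by (simp_all add: v_def)
  have "P u + R v = (b + b') *\<^sub>R A u" "Q u + T v = (c + c') *\<^sub>R A u"
    by (simp_all add: PQ RT u v_def algebra_simps)
  then have "(b + b')\<^sup>2 + (c + c')\<^sup>2 = 2" using iso[of u v] by (simp add: nv A power_mult_distrib)
  then have orth: "b * b' + c * c' = 0" using bc bc' by (simp add: power2_eq_square algebra_simps)
  \<comment> \<open>The determinant of two orthonormal vectors of the plane, so that (b', c') = s
    (-c, b) and s is 1 or -1. The map \<open>B\<close> below absorbs this sign.\<close>
  define s where "s = b * c' - c * b'"
  have "b' = (b\<^sup>2 + c\<^sup>2) * b'" using bc by simp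
  also have "\<dots> = - s * c + b * (b * b' + c * c')" by (simp add: s_def algebra_simps power2_eq_square)
  finally have b': "b' = - s * c" using orth by simp
  have "c' = (b\<^sup>2 + c\<^sup>2) * c'" using bc by simp
  also have "\<dots> = s * b + c * (b * b' + c * c')" by (simp add: s_def algebra_simps power2_eq_square)
  finally have c': "c' = s * b" using orth by simp
  have s2: "s\<^sup>2 = 1" 
  proof -
    have "s\<^sup>2 * (b\<^sup>2 + c\<^sup>2) = 1" using bc' unfolding b' c' by (simp add: power_mult_distrib algebra_simps)
    then show ?thesis using bc by simp
  qed
  define B where "B u = s *\<^sub>R A' u" for u
  have linB: "linear B" unfolding B_def using A'(1) by (intro linear_compose_scale_right)
  have nB: "norm (B u) = norm u" for u
    using s2 by (auto simp: B_def A' power2_eq_1_iff)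
  have RT': "R u = - c *\<^sub>R B u" "T u = b *\<^sub>R B u" for u
    by (simp_all add: RT b' c' B_def)
  \<comment> \<open>On the diagonal u = v the minors of the image are
    \<open>b\<^sup>2 + c\<^sup>2\<close> times those of (A u, B u).\<close>
  have parAB: "parallel (A u) (B u)" for u
    unfolding parallel_def
  proof (intro allI)
    fix r s
    have "parallel (b *\<^sub>R A u - c *\<^sub>R B u) (c *\<^sub>R A u + b *\<^sub>R B u)"
      using parallel[OF p0(3), of u] by (simp add: PQ RT')
    then have "(b *\<^sub>R A u - c *\<^sub>R B u) $ r * (c *\<^sub>R A u + b *\<^sub>R B u) $ s = (c *\<^sub>R A u + b *\<^sub>R B u) $ r * (b *\<^sub>R A u - c *\<^sub>R B u) $ s"
      unfolding parallel_def by blast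
    then have "(b\<^sup>2 + c\<^sup>2) * (A u $ r * B u $ s) = (b\<^sup>2 + c\<^sup>2) * (B u $ r * A u $ s)"
      by (simp add: algebra_simps power2_eq_square)
    then show "A u $ r * B u $ s = B u $ r * A u $ s" using bc by simp
  qed
  \<comment> \<open>The scaling by \<open>h\<close> makes \<open>(A, B)\<close> an isometry, so that \<open>parallel_isometry\<close> applies once more.\<close>
  define h where "h = sqrt 2 / 2"
  have h: "h * h = 1 / 2" by (simp add: h_def)
  have "linear (\<lambda>u. h *\<^sub>R A u)" by (rule linear_compose_scale_right) fact
  moreover have "linear (\<lambda>u. h *\<^sub>R B u)" by (rule linear_compose_scale_right) fact
  moreover have "parallel (h *\<^sub>R A u) (h *\<^sub>R B u)" for u using parAB[of u] by (simp add: parallel_def algebra_simps)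
  moreover have "(norm (h *\<^sub>R A u))\<^sup>2 + (norm (h *\<^sub>R B u))\<^sup>2 = (norm u)\<^sup>2" for u
    using h by (simp add: A nB power_mult_distrib power2_eq_square)
  ultimately obtain D x y where D: "\<And>u. norm (D u) = norm u" "\<And>u. h *\<^sub>R A u = x *\<^sub>R D u" "\<And>u. h *\<^sub>R B u = y *\<^sub>R D u"
    using parallel_isometry[of "\<lambda>u. h *\<^sub>R A u" "\<lambda>u. h *\<^sub>R B u" i j k] ijk by metis
  have "\<bar>h\<bar> = \<bar>x\<bar>" "\<bar>h\<bar> = \<bar>y\<bar>"
    using arg_cong[OF D(2)[of v], of norm] arg_cong[OF D(3)[of v], of norm] by (simp_all add: A nB D(1) nv)
  then have hx: "x = h \<or> x = - h" "y = h \<or> y = - h" and h0: "h \<noteq> 0" using h by (auto simp: abs_if split: if_splits)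
  \<comment> \<open>Both \<open>x\<close> and \<open>y\<close> are \<open>h\<close> or
    \<open>- h\<close>; this is their relative sign.\<close>
  define t where "t = x * y / (h * h)"
  have t: "t = 1 \<or> t = - 1" using hx h0 by (auto simp: t_def)
  have BA: "B u = t *\<^sub>R A u" for u
  proof -
    have "h *\<^sub>R B u = h *\<^sub>R (t *\<^sub>R A u)"
    proof -
      have "h *\<^sub>R (t *\<^sub>R A u) = t *\<^sub>R (x *\<^sub>R D u)" using D(2)[of u] by (metis scaleR_left_commute)
      also have "\<dots> = y *\<^sub>R D u" using hx h0 by (auto simp: t_def)
      finally show ?thesis using D(3) by simp
    qed
    with h0 show ?thesis by (rule scaleR_left_imp_eq)
  qed
  have AM: "A u = matrix A *v u" for u using A(1) by (simp add: matrix_works)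
  have oM: "orthogonal_matrix (matrix A)" using oA orthogonal_transformation_matrix by blast
  have "R u = - (t * c) *\<^sub>R A u" "T u = (t * b) *\<^sub>R A u" for u
    unfolding RT' BA by (simp_all add: mult.commute)
  then have 1: "R u = - (t * c) *\<^sub>R (matrix A *v u)" "T u = (t * b) *\<^sub>R (matrix A *v u)"
    "P u = b *\<^sub>R (matrix A *v u)" "Q u = c *\<^sub>R (matrix A *v u)" for u
    using PQ AM by metis+
  show thesis
    by (rule that[of "matrix A" b c t]) (rule oM bc t 1)+
qed

section \<open>Automorphisms of the model\<close>

lemma skewI: "(\<And>i j. S $ i $ j = - S $ j $ i) \<Longrightarrow> skew S"
  unfolding skew_def by blast

lemma skewD: "skew S \<Longrightarrow> S $ j $ i = - S $ i $ j"
  unfolding skew_def by blast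

lemma model_space_add:
  assumes "M \<in> model_space" "N \<in> model_space" shows "M + N \<in> model_space"
proof -
  have "fst (M + N) $ i $ j = - fst (M + N) $ j $ i" for i j
    using skewD[of "fst M" i j] skewD[of "fst N" i j] assms by (simp add: model_space_def)
  then show ?thesis unfolding model_space_def by (intro CollectI skewI)
qed

lemma model_space_mscale:
  assumes "M \<in> model_space" shows "mscale c M \<in> model_space"
proof -
  have "fst (mscale c M) $ i $ j = - fst (mscale c M) $ j $ i" for i j
    using skewD[of "fst M" i j] assms by (simp add: model_space_def mscale_def split_beta)
  then show ?thesis unfolding model_space_def by (intro CollectI skewI)
qed

lemma model_space_cnjM:
  assumes "M \<in> model_space" shows "cnjM M \<in> model_space"
proof -
  have "fst (cnjM M) $ i $ j = - fst (cnjM M) $ j $ i" for i j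
    using skewD[of "fst M" i j] assms by (simp add: model_space_def cnjM_def split_beta)
  then show ?thesis unfolding model_space_def by (intro CollectI skewI)
qed

text \<open>
  On the model, \<open>flipM\<close> is \<open>\<gamma>\<^sub>C\<close> and \<open>gamM\<close> is \<open>\<gamma>\<^sub>H\<close>; \<open>cnjM\<close> is \<open>\<tau>\<gamma>\<close>.
\<close>

definition flipM :: "model \<Rightarrow> model" where "flipM = (\<lambda>(S, u, v). (S, - u, - v))"

definition gamM :: "model \<Rightarrow> model" where
  "gamM = (\<lambda>(S, u, v). (\<chi> r s. - of_real (sgn6 r * sgn6 s) * S$r$s,
     \<chi> r. - of_real (sgn6 r) * u$r, \<chi> r. of_real (sgn6 r) * v$r))"

lemma model_space_flipM: "M \<in> model_space \<Longrightarrow> flipM M \<in> model_space"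
  by (auto simp: model_space_def flipM_def split_beta)

lemma model_space_gamM:
  assumes "M \<in> model_space" shows "gamM M \<in> model_space"
proof -
  have "fst (gamM M) $ i $ j = - fst (gamM M) $ j $ i" for i j
    using skewD[of "fst M" i j] assms by (simp add: model_space_def gamM_def split_beta mult.commute)
  then show ?thesis unfolding model_space_def by (intro CollectI skewI)
qed

lemma of_model_add: "M \<in> model_space \<Longrightarrow> N \<in> model_space \<Longrightarrow> of_model (M + N) = of_model M + of_model N"
  by (rule to_model_inj) (simp_all add: to_model_add to_model_of_model_model_space model_space_add subspace_add subspace_JC)

lemma of_model_mscale: "M \<in> model_space \<Longrightarrow> of_model (mscale c M) = c *\<^sub>c of_model M"
  by (rule to_model_inj) (simp_all add: to_model_cscale to_model_of_model_model_space model_space_mscale JC_cscale)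

section \<open>Transfer of automorphisms between the model and J^C\<close>

definition model_auto :: "(model \<Rightarrow> model) \<Rightarrow> bool" where
  "model_auto \<beta> \<longleftrightarrow> bij_betw \<beta> model_space model_space \<and> (\<forall>M\<in>model_space. \<forall>N\<in>model_space. \<beta> (M + N) = \<beta> M + \<beta> N) \<and>
     (\<forall>c. \<forall>M\<in>model_space. \<beta> (mscale c M) = mscale c (\<beta> M)) \<and> (\<forall>M\<in>model_space. cubicM (\<beta> M) = cubicM M) \<and>
     (\<forall>M\<in>model_space. \<forall>N\<in>model_space. hermM (\<beta> M) (\<beta> N) = hermM M N)"

text \<open>Restricted to \<open>JC\<close>, because the elements of \<open>E6\<close> are
  extensional functions.\<close>

definition lift_model :: "(model \<Rightarrow> model) \<Rightarrow> jc \<Rightarrow> jc" where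
  "lift_model \<beta> = (\<lambda>X\<in>JC. of_model (\<beta> (to_model X)))"

definition on_model :: "(jc \<Rightarrow> jc) \<Rightarrow> model \<Rightarrow> model" where
  "on_model \<alpha> M = to_model (\<alpha> (of_model M))"

lemma bij_to_model: "bij_betw to_model JC model_space"
  by (rule bij_betw_byWitness[of _ of_model])
     (auto simp: of_model_to_model to_model_of_model_model_space)

lemma bij_of_model: "bij_betw of_model model_space JC"
  by (rule bij_betw_byWitness[of _ to_model])
     (auto simp: of_model_to_model to_model_of_model_model_space)

lemma cubicM_on: "M \<in> model_space \<Longrightarrow> detC (of_model M) = cubicM M"
  using cubicM_to_model[of "of_model M"] by (simp add: to_model_of_model_model_space)

lemma hermM_on: "M \<in> model_space \<Longrightarrow> N \<in> model_space \<Longrightarrow> hermC (of_model M) (of_model N) = hermM M N"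
  using hermM_to_model[of "of_model M" "of_model N"] by (simp add: to_model_of_model_model_space)

lemma lift_model_E6:
  assumes b: "model_auto \<beta>" shows "lift_model \<beta> \<in> E6"
proof -
  have m: "\<beta> M \<in> model_space" if "M \<in> model_space" for M
    using b that unfolding model_auto_def by (auto dest: bij_betwE)
  have "bij_betw (of_model \<circ> (\<beta> \<circ> to_model)) JC JC"
    using bij_betw_trans[OF bij_betw_trans[OF bij_to_model] bij_of_model] b
    unfolding model_auto_def by blast
  then have "bij_betw (lift_model \<beta>) JC JC"
    by (subst bij_betw_cong[of _ _ "of_model \<circ> (\<beta> \<circ> to_model)"]) (auto simp: lift_model_def)
  then have "lift_model \<beta> \<in> Bij JC" by (simp add: Bij_def lift_model_def)
  then show ?thesis
    using b unfolding E6_def model_auto_def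
    by (auto simp: lift_model_def subspace_add[OF subspace_JC] to_model_add of_model_add m JC_cscale
       to_model_cscale of_model_mscale cubicM_on hermM_on cubicM_to_model hermM_to_model)
qed

lemma E6_D:
  assumes "\<alpha> \<in> E6"
  shows "\<alpha> \<in> extensional JC" "bij_betw \<alpha> JC JC" "X \<in> JC \<Longrightarrow> \<alpha> X \<in> JC"
    "X \<in> JC \<Longrightarrow> Y \<in> JC \<Longrightarrow> \<alpha> (X + Y) = \<alpha> X + \<alpha> Y"
    "X \<in> JC \<Longrightarrow> \<alpha> (c *\<^sub>c X) = c *\<^sub>c \<alpha> X"
    "X \<in> JC \<Longrightarrow> detC (\<alpha> X) = detC X"
    "X \<in> JC \<Longrightarrow> Y \<in> JC \<Longrightarrow> hermC (\<alpha> X) (\<alpha> Y) = hermC X Y"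
  using assms unfolding E6_def Bij_def by (auto dest: bij_betwE)

lemma on_model_auto:
  assumes a: "\<alpha> \<in> E6" shows "model_auto (on_model \<alpha>)"
proof -
  have "bij_betw (to_model \<circ> (\<alpha> \<circ> of_model)) model_space model_space"
    using bij_betw_trans[OF bij_betw_trans[OF bij_of_model E6_D(2)[OF a]] bij_to_model] by simp
  moreover have "to_model \<circ> (\<alpha> \<circ> of_model) = on_model \<alpha>" by (auto simp: on_model_def)
  ultimately show ?thesis
    by (simp add: model_auto_def on_model_def of_model_add of_model_mscale E6_D[OF a] to_model_add
      to_model_cscale cubicM_on hermM_on cubicM_to_model hermM_to_model)
qed

lemma of_model_on_model: "\<alpha> \<in> E6 \<Longrightarrow> X \<in> JC \<Longrightarrow> \<alpha> X = of_model (on_model \<alpha> (to_model X))"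
  by (simp add: on_model_def of_model_to_model E6_D)

lemma on_model_lift: "model_auto \<beta> \<Longrightarrow> M \<in> model_space \<Longrightarrow> on_model (lift_model \<beta>) M = \<beta> M"
  unfolding model_auto_def
  by (auto simp: on_model_def lift_model_def to_model_of_model_model_space dest: bij_betwE)

lemma to_model_gamma_tau: "X \<in> JC \<Longrightarrow> to_model (gamma (tau X)) = cnjM (to_model X)"
  unfolding to_model_def Let_def cnjM_def
  by (simp add: cayC_tau tau_JC cayC_gamma skew6_def vec6_eq_iff)

lemma cnjM_cnjM [simp]: "cnjM (cnjM M) = M"
  by (simp add: cnjM_def split_beta prod_eq_iff vec_eq_iff)

lemma flipM_flipM [simp]: "flipM (flipM M) = M"
  by (simp add: flipM_def split_beta)

lemma flipM_cnjM: "flipM (cnjM M) = cnjM (flipM M)"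
  by (simp add: flipM_def cnjM_def split_beta vec_eq_iff)

lemma to_model_flip: "X \<in> JC \<Longrightarrow> to_model (gammaC X) = flipM (to_model X)"
  by (simp add: to_model_gammaC flipM_def)

text \<open>Since lambda is conjugation by tau, the first condition means commuting with tau gamma
  and the second commuting with tau gamma gamma_C. Given the first, the second amounts to commuting
  with gamma_C.\<close>

lemma fixed_group_iff:
  assumes a: "\<alpha> \<in> E6"
  shows "\<alpha> \<in> E6_lam_gamma \<inter> E6_lam_gamma_gammaC \<longleftrightarrow>
    (\<forall>M\<in>model_space. on_model \<alpha> (cnjM M) = cnjM (on_model \<alpha> M) \<and> on_model \<alpha> (flipM M) = flipM (on_model \<alpha> M))"
proof -
  let ?g = "\<lambda>X. tau (gamma (\<alpha> (gamma (tau X))))"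
  let ?h = "\<lambda>X. tau (gamma (gammaC (\<alpha> (gammaC (gamma (tau X))))))"
  have gt: "gamma (tau X) = of_model (cnjM (to_model X))" if "X \<in> JC" for X
    by (rule to_model_inj) (simp_all add: that gamma_JC tau_JC to_model_gamma_tau to_model_of_model_model_space model_space_cnjM)
  have gct: "gammaC (gamma (tau X)) = of_model (flipM (cnjM (to_model X)))" if "X \<in> JC" for X
    by (rule to_model_inj)
      (simp_all add: that gamma_JC tau_JC to_model_gamma_tau to_model_flip to_model_of_model_model_space model_space_cnjM model_space_flipM)
  have mem: "?g X \<in> JC" "?h X \<in> JC" if "X \<in> JC" for X
    using that by (simp_all add: gamma_JC tau_JC E6_D(3)[OF a])
  have eqg: "to_model (?g X) = cnjM (on_model \<alpha> (cnjM (to_model X)))" if "X \<in> JC" for X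
    using that by (simp add: to_model_tau_gamma gamma_JC tau_JC E6_D(3)[OF a] on_model_def gt)
  have eqh: "to_model (?h X) = cnjM (flipM (on_model \<alpha> (flipM (cnjM (to_model X)))))" if "X \<in> JC" for X
    using that by (simp add: to_model_tau_gamma to_model_flip gamma_JC tau_JC E6_D(3)[OF a] on_model_def gct)
  have all: "(\<forall>X\<in>JC. P (to_model X)) \<longleftrightarrow> (\<forall>M\<in>model_space. P M)" for P
    by (metis of_model_JC to_model_model_space to_model_of_model_model_space)
  have "\<alpha> \<in> E6_lam_gamma \<longleftrightarrow> (\<forall>X\<in>JC. ?g X = \<alpha> X)"
    unfolding E6_lam_gamma_def lam_def using a E6_D(1)[OF a]
    by (auto simp: compose_def gamma_JC tau_JC fun_eq_iff extensional_def restrict_def)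
  also have "\<dots> \<longleftrightarrow> (\<forall>X\<in>JC. cnjM (on_model \<alpha> (cnjM (to_model X))) = on_model \<alpha> (to_model X))"
    using mem E6_D(3)[OF a] eqg by (metis on_model_def of_model_to_model to_model_inj)
  also have "\<dots> \<longleftrightarrow> (\<forall>M\<in>model_space. cnjM (on_model \<alpha> (cnjM M)) = on_model \<alpha> M)"
    by (rule all)
  finally have 1: "\<alpha> \<in> E6_lam_gamma \<longleftrightarrow> (\<forall>M\<in>model_space. cnjM (on_model \<alpha> (cnjM M)) = on_model \<alpha> M)" .
  have "\<alpha> \<in> E6_lam_gamma_gammaC \<longleftrightarrow> (\<forall>X\<in>JC. ?h X = \<alpha> X)"
    unfolding E6_lam_gamma_gammaC_def lam_def using a E6_D(1)[OF a]
    by (auto simp: compose_def gamma_JC tau_JC fun_eq_iff extensional_def restrict_def)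
  also have "\<dots> \<longleftrightarrow> (\<forall>X\<in>JC. cnjM (flipM (on_model \<alpha> (flipM (cnjM (to_model X))))) = on_model \<alpha> (to_model X))"
    using mem E6_D(3)[OF a] eqh by (metis on_model_def of_model_to_model to_model_inj)
  also have "\<dots> \<longleftrightarrow> (\<forall>M\<in>model_space. cnjM (flipM (on_model \<alpha> (flipM (cnjM M)))) = on_model \<alpha> M)"
    by (rule all)
  finally have 2: "\<alpha> \<in> E6_lam_gamma_gammaC \<longleftrightarrow> (\<forall>M\<in>model_space. cnjM (flipM (on_model \<alpha> (flipM (cnjM M)))) = on_model \<alpha> M)" .
  \<comment> \<open>Being fixed under conjugation by an involution is the same as commuting with
    it.\<close>
  have 3: "(\<forall>M\<in>model_space. cnjM (on_model \<alpha> (cnjM M)) = on_model \<alpha> M) \<longleftrightarrow> (\<forall>M\<in>model_space. on_model \<alpha> (cnjM M) = cnjM (on_model \<alpha> M))"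
    by (metis cnjM_cnjM)
  have 4: "(\<forall>M\<in>model_space. cnjM (flipM (on_model \<alpha> (flipM (cnjM M)))) = on_model \<alpha> M) \<longleftrightarrow>
      (\<forall>M\<in>model_space. on_model \<alpha> (flipM M) = flipM (on_model \<alpha> M))"
    if "\<forall>M\<in>model_space. on_model \<alpha> (cnjM M) = cnjM (on_model \<alpha> M)"
    using that by (metis cnjM_cnjM flipM_flipM flipM_cnjM model_space_flipM)
  show ?thesis using 1 2 3 4 by blast
qed

section \<open>The action on the model\<close>

text \<open>Bilinear, without conjugation: one form then serves the cubic form and, with
  \<open>cnjv\<close> in the first argument, the Hermitian form.\<close>

definition bdot :: "complex ^ 'n \<Rightarrow> complex ^ 'n \<Rightarrow> complex" where
  "bdot x y = (\<Sum>r\<in>UNIV. x $ r * y $ r)"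

definition frob :: "complex ^ 'n ^ 'm \<Rightarrow> complex ^ 'n ^ 'm \<Rightarrow> complex" where
  "frob X Y = (\<Sum>r\<in>UNIV. \<Sum>s\<in>UNIV. X $ r $ s * Y $ r $ s)"

lemma complexify_one: "complexify (mat 1) = mat 1"
  by (simp add: complexify_def mat_def vec_eq_iff)

lemma bdot_simps:
  "bdot (x + y) z = bdot x z + bdot y z" "bdot z (x + y) = bdot z x + bdot z y"
  "bdot (x - y) z = bdot x z - bdot y z" "bdot z (x - y) = bdot z x - bdot z y"
  "bdot (c *s x) z = c * bdot x z" "bdot z (c *s x) = c * bdot z x"
  by (simp_all add: bdot_def algebra_simps sum.distrib sum_subtractf sum_distrib_left)

lemma bdot_matrix: "bdot (A *v x) y = bdot x (transpose A *v y)"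
  unfolding bdot_def matrix_vector_mult_def transpose_def
  by (simp add: sum_distrib_left sum_distrib_right mult_ac) (subst sum.swap, simp add: mult_ac)

lemma orthogonal_complexify:
  assumes "orthogonal_matrix A"
  shows "transpose (complexify A) ** complexify A = mat 1" "complexify A ** transpose (complexify A) = mat 1"
  using assms
  by (simp_all add: orthogonal_matrix_def complexify_one complexify_mult[symmetric] complexify_transpose[symmetric])

lemma bdot_orthogonal:
  "orthogonal_matrix A \<Longrightarrow> bdot (complexify A *v x) (complexify A *v y) = bdot x y"
  by (simp add: bdot_matrix matrix_vector_mul_assoc orthogonal_complexify)

lemma frob_transpose: "frob (transpose X) (transpose Y) = frob X Y"
  unfolding frob_def transpose_def by (subst sum.swap) simp

lemma frob_bdot: "frob X Y = (\<Sum>s\<in>UNIV. bdot (column s X) (column s Y))"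
  unfolding frob_def bdot_def column_def by (subst sum.swap) simp

lemma column_mult: "column s (A ** B) = A *v column s B"
  by (simp add: column_def matrix_matrix_mult_def matrix_vector_mult_def vec_eq_iff)

lemma frob_orthogonal:
  "orthogonal_matrix A \<Longrightarrow> frob (complexify A ** X) (complexify A ** Y) = frob X Y"
  by (simp add: frob_bdot column_mult bdot_orthogonal)

text \<open>A X A^T is the transpose of A (A X)^T, so invariance under left multiplication, used
  twice, suffices.\<close>

lemma frob_cong_act:
  assumes "orthogonal_matrix A" shows "frob (cong_act A X) (cong_act A Y) = frob X Y"
proof -
  have e: "cong_act A X = transpose (complexify A ** transpose (complexify A ** X))" for X
    by (simp add: cong_act_def matrix_transpose_mul)
  show ?thesis unfolding e by (simp add: frob_transpose frob_orthogonal[OF assms])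
qed

lemma cubicM_eq: "cubicM (S, u, v) = Pf S + bdot u (S *v v)"
  by (simp add: cubicM_def bdot_def matrix_vector_mult_def sum_distrib_left mult_ac)

definition cnjv :: "complex ^ 'n \<Rightarrow> complex ^ 'n" where "cnjv x = (\<chi> r. cnj (x $ r))"
definition cnjm :: "complex ^ 'n ^ 'm \<Rightarrow> complex ^ 'n ^ 'm" where "cnjm x = (\<chi> r s. cnj (x $ r $ s))"

lemma hermM_eq: "hermM (S, u, v) (S', u', v') = 1 / 2 * frob (cnjm S) S' + bdot (cnjv u) u' + bdot (cnjv v) v'"
  by (simp add: hermM_def frob_def bdot_def cnjv_def cnjm_def)

lemma cnjM_eq: "cnjM (S, u, v) = (cnjm S, cnjv u, cnjv v)"
  by (simp add: cnjM_def cnjv_def cnjm_def)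

lemma cnjv_simps: "cnjv (x + y) = cnjv x + cnjv y" "cnjv (x - y) = cnjv x - cnjv y"
  "cnjv (of_real c *s x) = of_real c *s cnjv x" "cnjv (complexify A *v x) = complexify A *v cnjv x"
  by (simp_all add: cnjv_def vec_eq_iff matrix_vector_mult_def complexify_def)

lemma cnjm_cong_act: "cnjm (cong_act A S) = cong_act A (cnjm S)"
  by (simp add: cnjm_def vec_eq_iff cong_act_nth)

lemma skew_bdot:
  assumes "skew S" shows "bdot v (S *v u) = - bdot u (S *v v)" "bdot u (S *v u) = 0"
proof -
  have "transpose S = - S"
    using skewD[OF assms] unfolding vec_eq_iff transpose_def vec_lambda_beta uminus_vec_def by blast
  then have *: "bdot v (S *v u) = - bdot u (S *v v)" for u v
    using bdot_matrix[of S u v] by (simp add: bdot_def matrix_vector_mult_def sum_negf mult.commute)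
  show "bdot v (S *v u) = - bdot u (S *v v)" by (rule *)
  show "bdot u (S *v u) = 0" using *[of u u] by simp
qed

text \<open>The element \<open>x + y e\<^sub>2\<close> of \<open>U(1)\<close> rotates the plane \<open>C\<^sup>2\<close> in \<open>C\<^sup>6 \<otimes> C\<^sup>2\<close> by the angle of \<open>x + y i\<close>.\<close>

definition psiM :: "quat \<times> (real ^ 6 ^ 6) \<Rightarrow> model \<Rightarrow> model" where
  "psiM = (\<lambda>(a, A) (S, u, v). (cong_act A S, complexify A *v (fst a *s u - snd a *s v),
     complexify A *v (snd a *s u + fst a *s v)))"

lemma U1_cases:
  assumes "a \<in> U1" obtains x y where "a = (of_real x, of_real y)" "x * x + y * y = 1"
proof -
  obtain x y where a: "a = (of_real x, of_real y)" and h: "hmult (hcnj a) a = (1, 0)"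
    using assms unfolding U1_def by blast
  have "complex_of_real (x * x + y * y) = of_real 1" using h by (simp add: a hmult_def hcnj_def)
  then have "x * x + y * y = 1" by (simp only: of_real_eq_iff)
  then show thesis using that a by blast
qed

lemma U1_I: "x * x + y * y = 1 \<Longrightarrow> (of_real x, of_real y) \<in> U1"
  unfolding U1_def by (auto simp: hmult_def hcnj_def simp flip: of_real_mult of_real_add)

text \<open>On pairs of reals \<open>hmult\<close> is multiplication of complex numbers, hence
  composition of the plane rotations.\<close>

lemma psiM_mult:
  assumes "a \<in> U1" "b \<in> U1"
  shows "psiM (hmult a b, A ** B) M = psiM (a, A) (psiM (b, B) M)"
proof -
  obtain S u v where M: "M = (S, u, v)" by (cases M)
  obtain x y where a: "a = (of_real x, of_real y)" using U1_cases[OF assms(1)] by blast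
  obtain x' y' where b: "b = (of_real x', of_real y')" using U1_cases[OF assms(2)] by blast
  show ?thesis
    by (simp add: M a b psiM_def hmult_def cong_act_mult complexify_mult flip: matrix_vector_mul_assoc)
       (simp add: matrix_vector_right_distrib matrix_vector_mult_diff_distrib vector_scalar_commute[symmetric]
         vec_eq_iff algebra_simps)
qed

lemma psiM_one: "psiM ((1, 0), mat 1) M = M"
  by (cases M) (simp add: psiM_def cong_act_def complexify_one transpose_mat)

text \<open>The skew part is quadratic in \<open>A\<close> and the vector part bilinear in
  \<open>a\<close> and \<open>A\<close>, so a common sign cancels.\<close>

lemma psiM_neg: "psiM (- a, - A) M = psiM (a, A) M"
proof -
  have "complexify (- A) = - complexify A" by (simp add: complexify_def vec_eq_iff)
  moreover have "cong_act (- A) S = cong_act A S" for S by (simp add: vec_eq_iff cong_act_nth)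
  ultimately show ?thesis
    by (cases M) (simp add: psiM_def vec_eq_iff matrix_vector_mult_def sum_negf[symmetric] algebra_simps)
qed

lemma model_space_psiM: "M \<in> model_space \<Longrightarrow> psiM p M \<in> model_space"
  by (auto simp: psiM_def model_space_def split_beta skew_cong_act)

lemma cong_act_add: "cong_act A (S + T) = cong_act A S + cong_act A T"
  by (simp add: vec_eq_iff cong_act_nth algebra_simps sum.distrib)

lemma cong_act_scale: "cong_act A (\<chi> r. c *s S $ r) = (\<chi> r. c *s cong_act A S $ r)"
  by (simp add: vec_eq_iff cong_act_nth sum_distrib_left mult_ac)

lemma psiM_add: "psiM p (M + N) = psiM p M + psiM p N"
  by (simp add: psiM_def split_beta cong_act_add matrix_vector_right_distrib[symmetric])
     (simp add: algebra_simps vec_eq_iff)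

lemma psiM_mscale: "psiM p (mscale c M) = mscale c (psiM p M)"
  by (simp add: psiM_def mscale_def split_beta cong_act_scale vector_scalar_commute[symmetric])
     (simp add: algebra_simps vec_eq_iff vector_scalar_commute)

lemma hmult_hcnj_U1: "a \<in> U1 \<Longrightarrow> hmult a (hcnj a) = (1, 0)" "a \<in> U1 \<Longrightarrow> hmult (hcnj a) a = (1, 0)"
  "a \<in> U1 \<Longrightarrow> hcnj a \<in> U1"
proof -
  assume "a \<in> U1"
  then obtain x y where a: "a = (of_real x, of_real y)" and xy: "x * x + y * y = 1" using U1_cases by blast
  have e: "complex_of_real x * of_real x + of_real y * of_real y = 1"
    using xy by (metis of_real_1 of_real_add of_real_mult)
  show "hmult a (hcnj a) = (1, 0)" "hmult (hcnj a) a = (1, 0)"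
    using e by (simp_all add: a hmult_def hcnj_def)
  show "hcnj a \<in> U1" using U1_I[of x "- y"] xy by (simp add: a hcnj_def)
qed

lemma psiM_auto:
  assumes a: "a \<in> U1" and A: "A \<in> SO6"
  shows "model_auto (psiM (a, A))"
proof -
  have o: "orthogonal_matrix A" "det A = 1" using A by (auto simp: SO6_def rotation_matrix_def)
  obtain x y where xy: "a = (of_real x, of_real y)" "x * x + y * y = 1" using U1_cases[OF a] .
  have e: "complex_of_real x * of_real x + of_real y * of_real y = 1"
    using xy by (metis of_real_1 of_real_add of_real_mult)
  have oo: "A ** transpose A = mat 1" "transpose A ** A = mat 1"
    using o(1) by (simp_all add: orthogonal_matrix_def)
  have inv: "psiM (hcnj a, transpose A) (psiM (a, A) M) = M" "psiM (a, A) (psiM (hcnj a, transpose A) M) = M" for M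
    using a by (simp_all add: psiM_mult[symmetric] hmult_hcnj_U1 oo psiM_one)
  have "bij_betw (psiM (a, A)) model_space model_space"
    by (rule bij_betw_byWitness[of _ "psiM (hcnj a, transpose A)"]) (auto simp: inv model_space_psiM)
  moreover have "cubicM (psiM (a, A) M) = cubicM M" if "M \<in> model_space" for M
  proof -
    obtain S u v where M: "M = (S, u, v)" by (cases M)
    have S: "skew S" using that by (simp add: M model_space_def)
    have 1: "cong_act A S *v (complexify A *v w) = complexify A *v (S *v w)" for w
      unfolding cong_act_def by (metis matrix_mul_assoc matrix_vector_mul_assoc orthogonal_complexify(1)[OF o(1)] matrix_vector_mul_lid)
    \<comment> \<open>The form given by \<open>S\<close> is alternating, so the plane rotation acts
      on it through its determinant.\<close>
    have "bdot (of_real x *s u - of_real y *s v) (S *v (of_real y *s u + of_real x *s v))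
       = (of_real x * of_real x + of_real y * of_real y) * bdot u (S *v v)"
      by (simp add: matrix_vector_right_distrib vector_scalar_commute bdot_simps skew_bdot(2)[OF S]
          skew_bdot(1)[OF S, of v u] algebra_simps)
    then show ?thesis
      using e o by (simp add: M psiM_def xy(1) cubicM_eq Pf_congr[OF S] 1 bdot_orthogonal[OF o(1)])
  qed
  moreover have "hermM (psiM (a, A) M) (psiM (a, A) N) = hermM M N" for M N
  proof -
    obtain S u v where M: "M = (S, u, v)" by (cases M)
    obtain S' u' v' where N: "N = (S', u', v')" by (cases N)
    have "bdot (of_real x *s cnjv u - of_real y *s cnjv v) (of_real x *s u' - of_real y *s v') +
      bdot (of_real y *s cnjv u + of_real x *s cnjv v) (of_real y *s u' + of_real x *s v')
      = (of_real x * of_real x + of_real y * of_real y) * (bdot (cnjv u) u' + bdot (cnjv v) v')"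
      by (simp add: bdot_simps algebra_simps)
    then show ?thesis
      using e by (simp add: M N psiM_def xy(1) hermM_eq cnjm_cong_act frob_cong_act[OF o(1)] cnjv_simps
        bdot_orthogonal[OF o(1)] add.assoc)
  qed
  ultimately show ?thesis
    by (simp add: model_auto_def psiM_add psiM_mscale)
qed

lemma psiM_cnjM: "a \<in> U1 \<Longrightarrow> psiM (a, A) (cnjM M) = cnjM (psiM (a, A) M)"
  by (erule U1_cases, cases M) (simp add: psiM_def cnjM_eq cnjv_simps cnjm_cong_act)

lemma psiM_flipM: "psiM p (flipM M) = flipM (psiM p M)"
  by (simp add: psiM_def flipM_def split_beta vec_eq_iff matrix_vector_mult_def sum_negf[symmetric] algebra_simps)

section \<open>The involution gamma_H on the model\<close>

lemma gamM_gamM [simp]: "gamM (gamM M) = M"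
  by (cases M) (auto simp: gamM_def vec_eq_iff sgn6_def)

lemma gamM_auto: "model_auto gamM"
proof -
  have "bij_betw gamM model_space model_space"
    by (rule bij_betw_byWitness[of _ gamM]) (auto simp: model_space_gamM)
  moreover have "gamM (M + N) = gamM M + gamM N" for M N
    by (simp add: gamM_def split_beta vec_eq_iff algebra_simps)
  moreover have "gamM (mscale c M) = mscale c (gamM M)" for c M
    by (simp add: gamM_def mscale_def split_beta vec_eq_iff algebra_simps)
  moreover have "hermM (gamM M) (gamM N) = hermM M N" for M N
  proof -
    have "cnj (- of_real (sgn6 r * sgn6 s) * z) * (- of_real (sgn6 r * sgn6 s) * w) = cnj z * w"
      "cnj (- of_real (sgn6 r) * z) * (- of_real (sgn6 r) * w) = cnj z * w"
      "cnj (of_real (sgn6 r) * z) * (of_real (sgn6 r) * w) = cnj z * w" for r s z w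
      by (auto simp: sgn6_def)
    then show ?thesis
      by (simp only: hermM_def gamM_def split_beta vec_lambda_beta fst_conv snd_conv)
  qed
  moreover have "cubicM (gamM M) = cubicM M" for M
  proof -
    have 1: "- of_real (sgn6 r * sgn6 s) * z * (- of_real (sgn6 r) * x) * (of_real (sgn6 s) * y) = z * x * y" for r s x y z
      by (auto simp: sgn6_def)
    \<comment> \<open>The scalar -1 contributes (-1)^3, the congruence by I contributes det I =
      -1.\<close>
    have "Pf (\<chi> r s. - of_real (sgn6 r * sgn6 s) * S $ r $ s) = Pf S" for S
      by (simp add: Pf_def sgn6_def algebra_simps)
    then show ?thesis
      unfolding cubicM_def gamM_def split_beta vec_lambda_beta fst_conv snd_conv 1 by simp
  qed
  ultimately show ?thesis by (simp add: model_auto_def)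
qed

lemma gamM_cnjM: "gamM (cnjM M) = cnjM (gamM M)"
  by (simp add: gamM_def cnjM_def split_beta vec_eq_iff)

lemma gamM_flipM: "gamM (flipM M) = flipM (gamM M)"
  by (simp add: gamM_def flipM_def split_beta vec_eq_iff)

lemma conj_iI_nth: "conj_iI A $ r $ s = sgn6 r * A $ r $ s * sgn6 s"
  unfolding conj_iI_def vec_lambda_beta iI_conj_entry by (simp add: sgn6_def)

text \<open>gamma_H acts on the vectors as I (x) diag(-1, 1). Conjugation by I turns A into I A I,
  and conjugation by diag(-1, 1) inverts the rotation, which is the passage from a to its
  conjugate.\<close>

lemma gamM_psiM:
  assumes "a \<in> U1"
  shows "gamM (psiM (a, A) M) = psiM (hcnj a, conj_iI A) (gamM M)"
proof -
  obtain S u v where M: "M = (S, u, v)" by (cases M)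
  obtain x y where a: "a = (of_real x, of_real y)" using U1_cases[OF assms] by blast
  have "complexify (conj_iI A) $ r $ s = of_real (sgn6 r) * of_real (A $ r $ s) * of_real (sgn6 s)" for r s
    by (simp add: complexify_def conj_iI_nth)
  moreover have "cong_act (conj_iI A) (\<chi> r s. - of_real (sgn6 r * sgn6 s) * S $ r $ s) $ r $ s
     = - of_real (sgn6 r * sgn6 s) * cong_act A S $ r $ s" for r s
  proof -
    have "of_real (sgn6 r * A $ r $ k * sgn6 k) * (- of_real (sgn6 k * sgn6 l) * S $ k $ l) * of_real (sgn6 s * A $ s $ l * sgn6 l)
      = - of_real (sgn6 r * sgn6 s) * (of_real (A $ r $ k) * S $ k $ l * of_real (A $ s $ l))" for k l
      by (auto simp: sgn6_def)
    then show ?thesis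
      unfolding cong_act_nth conj_iI_nth vec_lambda_beta sum_distrib_left by (intro sum.cong refl)
  qed
  moreover have "(complexify (conj_iI A) *v (\<chi> r. of_real (sgn6 r) * w $ r)) $ r = of_real (sgn6 r) * (complexify A *v w) $ r" for w r
  proof -
    have "of_real (sgn6 r) * of_real (A $ r $ k) * of_real (sgn6 k) * (of_real (sgn6 k) * w $ k)
      = of_real (sgn6 r) * (of_real (A $ r $ k) * w $ k)" for k
      by (auto simp: sgn6_def)
    then show ?thesis
      unfolding matrix_vector_mult_def vec_lambda_beta calculation(1) sum_distrib_left complexify_def[of A]
      by (intro sum.cong refl)
  qed
  note 3 = this
  have 4: "(\<chi> r. - of_real (sgn6 r) * (complexify A *v w) $ r) = complexify (conj_iI A) *v (\<chi> r. - of_real (sgn6 r) * w $ r)"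
    "(\<chi> r. of_real (sgn6 r) * (complexify A *v w) $ r) = complexify (conj_iI A) *v (\<chi> r. of_real (sgn6 r) * w $ r)" for w
  proof -
    show "(\<chi> r. of_real (sgn6 r) * (complexify A *v w) $ r) = complexify (conj_iI A) *v (\<chi> r. of_real (sgn6 r) * w $ r)"
      by (simp add: vec_eq_iff 3)
    have "complexify (conj_iI A) *v (\<chi> r. - of_real (sgn6 r) * w $ r) = - (complexify (conj_iI A) *v (\<chi> r. of_real (sgn6 r) * w $ r))"
      by (simp add: vec_eq_iff matrix_vector_mult_def sum_negf)
    then show "(\<chi> r. - of_real (sgn6 r) * (complexify A *v w) $ r) = complexify (conj_iI A) *v (\<chi> r. - of_real (sgn6 r) * w $ r)"
      by (simp add: vec_eq_iff 3)
  qed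
  have 5: "(\<chi> r s. - of_real (sgn6 r * sgn6 s) * cong_act A S $ r $ s) = cong_act (conj_iI A) (\<chi> r s. - of_real (sgn6 r * sgn6 s) * S $ r $ s)"
    using calculation(2) by (simp add: vec_eq_iff)
  \<comment> \<open>The opposite signs on u and v reverse the angle, hence \<open>- y\<close> in
    place of \<open>y\<close>.\<close>
  have 6: "(\<chi> r. - of_real (sgn6 r) * (of_real x *s u - of_real y *s v) $ r) =
       of_real x *s (\<chi> r. - of_real (sgn6 r) * u $ r) - of_real (- y) *s (\<chi> r. of_real (sgn6 r) * v $ r)"
     "(\<chi> r. of_real (sgn6 r) * (of_real y *s u + of_real x *s v) $ r) =
       of_real (- y) *s (\<chi> r. - of_real (sgn6 r) * u $ r) + of_real x *s (\<chi> r. of_real (sgn6 r) * v $ r)"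
    by (simp_all add: vec_eq_iff algebra_simps)
  have 7: "hcnj (of_real x, of_real y) = (of_real x, of_real (- y))" by (simp add: hcnj_def)
  show ?thesis
    unfolding M a 7 psiM_def gamM_def split_conv fst_conv snd_conv 4 5 6 ..
qed

section \<open>Real automorphisms of the model\<close>

definition cvec :: "real ^ 'n \<Rightarrow> complex ^ 'n" where "cvec u = (\<chi> r. of_real (u $ r))"

definition wedge :: "complex ^ 6 \<Rightarrow> complex ^ 6 \<Rightarrow> complex ^ 6 ^ 6" where
  "wedge x y = (\<chi> r s. x $ r * y $ s - y $ r * x $ s)"

lemma skew_wedge [simp]: "skew (wedge x y)"
  by (rule skewI) (simp add: wedge_def)

lemma cvec_simps: "cvec (x + y) = cvec x + cvec y" "cvec (c *\<^sub>R x) = of_real c *s cvec x" "cvec 0 = 0"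
  "cvec (A *v x) = complexify A *v cvec x" "cnjv (cvec x) = cvec x"
  by (simp_all add: cvec_def vec_eq_iff matrix_vector_mult_def complexify_def cnjv_def)

lemma cnjv_fixed:
  assumes "cnjv x = x" shows "x = cvec (\<chi> r. Re (x $ r))"
proof -
  have "Im (x $ r) = 0" for r
  proof -
    have "cnj (x $ r) = x $ r" using assms unfolding cnjv_def vec_eq_iff vec_lambda_beta by blast
    then have "Im (cnj (x $ r)) = Im (x $ r)" by simp
    then show ?thesis by simp
  qed
  then show ?thesis by (simp add: cvec_def vec_eq_iff complex_eq_iff)
qed

lemma cnjm_wedge: "cnjm (wedge x y) = wedge (cnjv x) (cnjv y)"
  by (simp add: cnjm_def wedge_def cnjv_def vec_eq_iff)

text \<open>Up to the factor 2, the mixed term of the cubic form is the pairing of S with a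
  bivector. This lets an automorphism on skew matrices be compared with its action on
  vectors.\<close>

lemma frob_wedge:
  assumes "skew S" shows "frob (wedge x y) S = 2 * bdot x (S *v y)"
proof -
  have 1: "(\<Sum>r\<in>UNIV. \<Sum>s\<in>UNIV. x $ r * y $ s * S $ r $ s) = bdot x (S *v y)" for x y
    by (simp add: bdot_def matrix_vector_mult_def sum_distrib_left mult_ac)
  have "frob (wedge x y) S = bdot x (S *v y) - bdot y (S *v x)"
    unfolding frob_def wedge_def 1[symmetric] by (simp add: left_diff_distrib sum_subtractf)
  then show ?thesis using skew_bdot(1)[OF assms, of y x] by simp
qed

text \<open>The entries of the bivector are the minors in \<open>parallel\<close>; equivariance of
  \<open>wedge\<close> thus becomes preservation of rank one.\<close>

lemma wedge_eq_0_iff: "wedge (cvec u) (cvec v) = 0 \<longleftrightarrow> parallel u v"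
  by (simp add: wedge_def cvec_def vec_eq_iff parallel_def flip: of_real_mult)

lemma wedge_matrix: "wedge (complexify A *v x) (complexify A *v y) = cong_act A (wedge x y)"
proof -
  have "(\<Sum>k\<in>UNIV. \<Sum>l\<in>UNIV. of_real (A$i$k) * (x $ k * y $ l - y $ k * x $ l) * of_real (A$j$l))
     = (\<Sum>k\<in>UNIV. \<Sum>l\<in>UNIV. (of_real (A$i$k) * x $ k) * (of_real (A$j$l) * y $ l) - (of_real (A$i$k) * y $ k) * (of_real (A$j$l) * x $ l))" for i j
    by (intro sum.cong refl) (simp add: algebra_simps)
  then show ?thesis
    by (simp add: vec_eq_iff cong_act_nth wedge_def matrix_vector_mult_def complexify_def sum_product sum_subtractf)
qed

text \<open>An alternating form sees a change of the pair only through its determinant, here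
  \<open>t * (b * b + c * c)\<close>.\<close>

lemma wedge_comb:
  "wedge (of_real b *s x - of_real (t * c) *s y) (of_real c *s x + of_real (t * b) *s y)
    = (\<chi> r. of_real (t * (b * b + c * c)) *s wedge x y $ r)"
  by (simp add: wedge_def vec_eq_iff algebra_simps)

lemma bdot_cv: "bdot (cvec x) (cvec x) = of_real ((norm x)\<^sup>2)"
  by (simp add: bdot_def cvec_def power2_norm_eq_inner inner_vec_def)

lemma frob_cnjm_0: "frob (cnjm D) D = 0 \<longleftrightarrow> D = 0"
proof -
  have "frob (cnjm D) D = of_real (\<Sum>r\<in>UNIV. \<Sum>s\<in>UNIV. (cmod (D $ r $ s))\<^sup>2)"
    by (simp add: frob_def cnjm_def complex_norm_square mult.commute del: of_real_power)
  also have "\<dots> = 0 \<longleftrightarrow> D = 0"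
    by (simp only: of_real_eq_0_iff) (simp add: sum_nonneg_eq_0_iff sum_nonneg vec_eq_iff)
  finally show ?thesis .
qed

lemma mscale_simps: "mscale c (S, u, v) = (\<chi> r. c *s S $ r, c *s u, c *s v)"
  by (simp add: mscale_def)

lemma model_space_iff: "(S, u, v) \<in> model_space \<longleftrightarrow> skew S"
  by (simp add: model_space_def)

lemma skew_0 [simp]: "skew 0" by (rule skewI) simp

lemma skew_diff:
  assumes "skew S" "skew T" shows "skew (S - T)"
proof (rule skewI)
  fix i j
  show "(S - T) $ i $ j = - (S - T) $ j $ i"
    using skewD[OF assms(1), of i j] skewD[OF assms(2), of i j] by simp
qed

section \<open>Linear maps on the model are determined by real generators\<close>

definition model_linear :: "(model \<Rightarrow> model) \<Rightarrow> bool" where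
  "model_linear f \<longleftrightarrow> (\<forall>M\<in>model_space. \<forall>N\<in>model_space. f (M + N) = f M + f N) \<and> (\<forall>c. \<forall>M\<in>model_space. f (mscale c M) = mscale c (f M))"

lemma model_linear_eqI:
  assumes f: "model_linear f" and g: "model_linear g"
    and u: "\<And>r. f (0, cvec (axis r 1), 0) = g (0, cvec (axis r 1), 0)"
    and v: "\<And>r. f (0, 0, cvec (axis r 1)) = g (0, 0, cvec (axis r 1))"
    and w: "\<And>r s. f (wedge (cvec (axis r 1)) (cvec (axis s 1)), 0, 0) = g (wedge (cvec (axis r 1)) (cvec (axis s 1)), 0, 0)"
    and M: "M \<in> model_space"
  shows "f M = g M"
proof -
  define E where "E = {M \<in> model_space. f M = g M}"
  have E_add: "M + N \<in> E" if "M \<in> E" "N \<in> E" for M N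
    using that f g unfolding E_def model_linear_def by (simp add: model_space_add)
  have E_scale: "mscale c M \<in> E" if "M \<in> E" for M c
    using that f g unfolding E_def model_linear_def by (simp add: model_space_mscale)
  have gens: "(0, cvec (axis r 1), 0) \<in> E" "(0, 0, cvec (axis r 1)) \<in> E"
    "(wedge (cvec (axis r 1)) (cvec (axis s 1)), 0, 0) \<in> E" for r s
    using u v w by (simp_all add: E_def model_space_iff)
  have "mscale 0 (0, cvec (axis 1 1), 0) = 0" by (simp add: mscale_simps zero_prod_def vec_eq_iff)
  then have E_0: "0 \<in> E" using E_scale[OF gens(1)] by metis
  have E_sum: "(\<Sum>r\<in>F. m r) \<in> E" if "\<And>r. m r \<in> E" for m and F :: "6 set"
    by (induction F rule: infinite_finite_induct) (simp_all add: E_0 E_add that)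
  obtain S x y where Mxy: "M = (S, x, y)" by (cases M)
  have S: "S $ i $ j = - S $ j $ i" for i j using M skewD[of S j i] by (simp add: Mxy model_space_iff)
  have ax: "(\<Sum>r\<in>UNIV. z $ r *s cvec (axis r 1)) = z" for z :: "complex ^ 6"
  proof -
    have "cvec (axis r 1) $ i = of_real (of_bool (i = r))" for r i :: 6
      by (auto simp: cvec_def axis_def)
    then have "(\<Sum>r\<in>UNIV. z $ r *s cvec (axis r 1)) $ i = (\<Sum>r\<in>UNIV. z $ r * of_real (of_bool (i = r)))" for i
      by (simp only: sum_component vector_smult_component)
    then show ?thesis unfolding vec_eq_iff sum_of_bool_mult by blast
  qed
  have ms: "mscale z (0, p, 0) = (0, z *s p, 0)" "mscale z (0, 0, p) = (0, 0, z *s p)" for z p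
    by (simp_all add: mscale_simps vec_eq_iff)
  have x: "(0, x, 0) = (\<Sum>r\<in>UNIV. mscale (x $ r) (0, cvec (axis r 1), 0))"
    unfolding ms by (simp add: prod_eq_iff fst_sum snd_sum ax)
  have y: "(0, 0, y) = (\<Sum>r\<in>UNIV. mscale (y $ r) (0, 0, cvec (axis r 1)))"
    unfolding ms by (simp add: prod_eq_iff fst_sum snd_sum ax)
  \<comment> \<open>The sum runs over ordered pairs; (r, s) and (s, r) contribute equally by
    skewness, hence the division by 2.\<close>
  have Sij: "S $ i $ j = (\<Sum>r\<in>UNIV. \<Sum>s\<in>UNIV. S $ r $ s / 2 * wedge (cvec (axis r 1)) (cvec (axis s 1)) $ i $ j)" for i j
  proof -
    have e: "S $ r $ s / 2 * wedge (cvec (axis r 1)) (cvec (axis s 1)) $ i $ j =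
       (if r = i then (if s = j then S $ i $ j / 2 else 0) else 0) - (if r = j then (if s = i then S $ j $ i / 2 else 0) else 0)" for r s
      by (auto simp: wedge_def cvec_def axis_def)
    have d: "(\<Sum>r\<in>UNIV. \<Sum>s\<in>UNIV. (if r = k then (if s = l then z else 0) else 0)) = (z :: complex)" for k l :: 6 and z
    proof -
      have "(\<Sum>s\<in>UNIV. (if r = k then (if s = l then z else 0) else 0)) = (if r = k then z else 0)" for r
        by simp
      then show ?thesis by simp
    qed
    show ?thesis unfolding e sum_subtractf d using S[of j i] by simp
  qed
  have "(\<Sum>r\<in>UNIV. \<Sum>s\<in>UNIV. \<chi> k. (S $ r $ s / 2) *s wedge (cvec (axis r 1)) (cvec (axis s 1)) $ k) = S"
    unfolding vec_eq_iff
    by (intro allI) (simp only: sum_component vec_lambda_beta vector_smult_component Sij[symmetric])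
  then have S: "(S, 0, 0) = (\<Sum>r\<in>UNIV. \<Sum>s\<in>UNIV. mscale (S $ r $ s / 2) (wedge (cvec (axis r 1)) (cvec (axis s 1)), 0, 0))"
    by (simp add: prod_eq_iff fst_sum snd_sum mscale_simps)
  have "M = (S, 0, 0) + ((0, x, 0) + (0, 0, y))" by (simp add: Mxy)
  also have "\<dots> \<in> E" unfolding S x y by (intro E_add E_sum E_scale gens)
  finally show ?thesis by (simp add: E_def)
qed

lemma Pf_scale: "Pf (\<chi> r. c *s S $ r) = c ^ 3 * Pf S"
  by (simp add: Pf_def algebra_simps power3_eq_cube)

text \<open>The normal form of a real automorphism; the sign \<open>t\<close> is \<open>det A\<close>.\<close>

definition twistM :: "real \<Rightarrow> real \<Rightarrow> real \<Rightarrow> real ^ 6 ^ 6 \<Rightarrow> model \<Rightarrow> model" where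
  "twistM t b c A = (\<lambda>(S, u, v). (\<chi> r. of_real t *s cong_act A S $ r,
     complexify A *v (of_real b *s u - of_real (t * c) *s v),
     complexify A *v (of_real c *s u + of_real (t * b) *s v)))"

lemma twistM_linear: "model_linear (twistM t b c A)"
proof -
  have "twistM t b c A (M + N) = twistM t b c A M + twistM t b c A N" for M N
    by (simp add: twistM_def split_beta cong_act_add matrix_vector_right_distrib[symmetric])
       (simp add: algebra_simps vec_eq_iff)
  moreover have "twistM t b c A (mscale z M) = mscale z (twistM t b c A M)" for z M
    by (simp add: twistM_def mscale_def split_beta cong_act_scale vector_scalar_commute[symmetric])
       (simp add: algebra_simps vec_eq_iff vector_scalar_commute)
  ultimately show ?thesis by (simp add: model_linear_def)
qed

lemma twistM_1: "twistM 1 b c A M = psiM ((of_real b, of_real c), A) M"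
  by (cases M) (simp add: twistM_def psiM_def)

text \<open>The negative of the matrix \<open>I\<close>.\<close>

definition sgnK :: "real ^ 6 ^ 6" where "sgnK = (\<chi> r s. if r = s then - sgn6 r else 0)"

text \<open>gamma_H applies -I to u and I to v. A further -I makes this u and -v, while S becomes
  -S, which is the effect of the sign -1 in \<open>twistM\<close>.\<close>

lemma twistM_minus_1: "twistM (- 1) b c A M = psiM ((of_real b, of_real c), A ** sgnK) (gamM M)"
proof -
  obtain S u v where M: "M = (S, u, v)" by (cases M)
  have e: "sgnK $ i $ k = - sgn6 i * of_bool (i = k)" for i k by (simp add: sgnK_def)
  have K: "complexify sgnK *v w = (\<chi> r. - of_real (sgn6 r) * w $ r)" for w
  proof -
    have "(complexify sgnK *v w) $ i = (\<Sum>k\<in>UNIV. of_real (of_bool (i = k)) * (- of_real (sgn6 i) * w $ k))" for i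
      unfolding matrix_vector_mult_def complexify_def vec_lambda_beta e by (intro sum.cong refl) simp
    then show ?thesis unfolding sum_of_bool_mult vec_eq_iff vec_lambda_beta by blast
  qed
  have "cong_act sgnK X $ i $ j = of_real (sgn6 i * sgn6 j) * X $ i $ j" for X i j
  proof -
    have "cong_act sgnK X $ i $ j = (\<Sum>k\<in>UNIV. of_real (of_bool (i = k)) * (\<Sum>l\<in>UNIV. (of_real (sgn6 i * sgn6 j) * X $ k $ l) * of_real (of_bool (j = l))))"
      unfolding cong_act_nth e sum_distrib_left by (intro sum.cong refl) simp
    then show ?thesis unfolding sum_of_bool_mult .
  qed
  then have "cong_act sgnK (\<chi> r s. - of_real (sgn6 r * sgn6 s) * S $ r $ s) = - S"
    by (auto simp: vec_eq_iff sgn6_def)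
  moreover have "cong_act A (- S) = (\<chi> r. of_real (- 1) *s cong_act A S $ r)"
    by (simp add: vec_eq_iff cong_act_nth sum_negf)
  moreover have "complexify sgnK *v (of_real b *s (\<chi> r. - of_real (sgn6 r) * u $ r) - of_real c *s (\<chi> r. of_real (sgn6 r) * v $ r))
    = of_real b *s u - of_real (- 1 * c) *s v"
    unfolding K by (auto simp: vec_eq_iff sgn6_def algebra_simps)
  moreover have "complexify sgnK *v (of_real c *s (\<chi> r. - of_real (sgn6 r) * u $ r) + of_real b *s (\<chi> r. of_real (sgn6 r) * v $ r))
    = of_real c *s u + of_real (- 1 * b) *s v"
    unfolding K by (auto simp: vec_eq_iff sgn6_def algebra_simps)
  ultimately show ?thesis
    unfolding M psiM_def gamM_def twistM_def split_conv fst_conv snd_conv cong_act_mult complexify_mult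
      matrix_vector_mul_assoc[symmetric] by simp
qed

lemma sgnK_orthogonal: "orthogonal_matrix sgnK" "det sgnK = - 1"
proof -
  have "transpose sgnK ** sgnK = mat 1"
    by (simp add: vec_eq_iff forall_6 sum_6 matrix_matrix_mult_def transpose_def sgnK_def mat_def sgn6_def)
  then show "orthogonal_matrix sgnK" by (simp add: orthogonal_matrix)
  have "det sgnK = (\<Prod>r\<in>UNIV. sgnK $ r $ r)" by (rule det_diagonal) (simp add: sgnK_def)
  then show "det sgnK = - 1" by (simp add: prod_6 sgnK_def sgn6_def)
qed

lemma real_model_auto_cases:
  assumes auto: "model_auto \<beta>"
    and cnj: "\<And>M. M \<in> model_space \<Longrightarrow> \<beta> (cnjM M) = cnjM (\<beta> M)"
    and flip: "\<And>M. M \<in> model_space \<Longrightarrow> \<beta> (flipM M) = flipM (\<beta> M)"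
  obtains a A where "a \<in> U1" "A \<in> SO6"
    "(\<forall>M\<in>model_space. \<beta> M = psiM (a, A) M) \<or> (\<forall>M\<in>model_space. \<beta> M = psiM (a, A) (gamM M))"
proof -
  have bij: "bij_betw \<beta> model_space model_space" and add: "\<And>M N. M \<in> model_space \<Longrightarrow> N \<in> model_space \<Longrightarrow> \<beta> (M + N) = \<beta> M + \<beta> N"
    and scale: "\<And>c M. M \<in> model_space \<Longrightarrow> \<beta> (mscale c M) = mscale c (\<beta> M)"
    and cub: "\<And>M. M \<in> model_space \<Longrightarrow> cubicM (\<beta> M) = cubicM M"
    and herm: "\<And>M N. M \<in> model_space \<Longrightarrow> N \<in> model_space \<Longrightarrow> hermM (\<beta> M) (\<beta> N) = hermM M N"
    using auto unfolding model_auto_def by blast+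
  have mem: "\<beta> M \<in> model_space" if "M \<in> model_space" for M using bij that by (auto dest: bij_betwE)
  \<comment> \<open>\<open>flipM\<close> has the skew matrices as its fixed space and the pairs of
    vectors as its -1 eigenspace; commuting with it forces a block form.\<close>
  define g where "g S = fst (\<beta> (S, 0, 0))" for S
  have g: "\<beta> (S, 0, 0) = (g S, 0, 0)" if "skew S" for S
  proof -
    have "flipM (\<beta> (S, 0, 0)) = \<beta> (S, 0, 0)" using flip[of "(S, 0, 0)"] that by (simp add: model_space_iff flipM_def)
    then show ?thesis unfolding g_def by (cases "\<beta> (S, 0, 0)") (auto simp: flipM_def vec_eq_iff)
  qed
  have g_skew: "skew (g S)" if "skew S" for S
    using mem[of "(S, 0, 0)"] that by (simp add: model_space_iff g)
  \<comment> \<open>Taking real parts loses nothing: commuting with \<open>cnjM\<close> keeps real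
    vectors real, which \<open>h\<close> below records.\<close>
  define h1 where "h1 u v = (\<chi> r. Re (fst (snd (\<beta> (0, cvec u, cvec v))) $ r))" for u v
  define h2 where "h2 u v = (\<chi> r. Re (snd (snd (\<beta> (0, cvec u, cvec v))) $ r))" for u v
  have h: "\<beta> (0, cvec u, cvec v) = (0, cvec (h1 u v), cvec (h2 u v))" for u v
  proof -
    obtain S x y where e: "\<beta> (0, cvec u, cvec v) = (S, x, y)" by (cases "\<beta> (0, cvec u, cvec v)")
    have "mscale (- 1) (0, cvec u, cvec v) = flipM (0, cvec u, cvec v)"
      by (simp add: mscale_simps flipM_def vec_eq_iff)
    then have "mscale (- 1) (S, x, y) = flipM (S, x, y)"
      using flip[of "(0, cvec u, cvec v)"] scale[of "(0, cvec u, cvec v)" "- 1"] by (simp add: model_space_iff e)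
    then have S: "S = 0" by (simp add: mscale_simps flipM_def vec_eq_iff)
    have "cnjM (0, cvec u, cvec v) = (0, cvec u, cvec v)"
      by (simp add: cnjM_eq cvec_simps) (simp add: cnjm_def vec_eq_iff)
    then have "cnjM (S, x, y) = (S, x, y)" using cnj[of "(0, cvec u, cvec v)"] by (simp add: model_space_iff e)
    then have x: "cnjv x = x" and y: "cnjv y = y" by (simp_all add: cnjM_eq)
    have "x = cvec (h1 u v)"
      unfolding h1_def e fst_conv snd_conv by (rule cnjv_fixed) (rule x)
    moreover have "y = cvec (h2 u v)"
      unfolding h2_def e fst_conv snd_conv by (rule cnjv_fixed) (rule y)
    ultimately have "x = cvec (h1 u v)" "y = cvec (h2 u v)" .
    then show ?thesis using e S by simp
  qed
  have inj_cv: "cvec x = cvec y \<Longrightarrow> x = y" for x y :: "real ^ 6" by (simp add: cvec_def vec_eq_iff)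
  have h_add: "h1 (u + u') (v + v') = h1 u v + h1 u' v'" "h2 (u + u') (v + v') = h2 u v + h2 u' v'" for u u' v v'
  proof -
    have "\<beta> (0, cvec (u + u'), cvec (v + v')) = \<beta> (0, cvec u, cvec v) + \<beta> (0, cvec u', cvec v')"
      by (subst add[symmetric]) (simp_all add: model_space_iff cvec_simps)
    then have "cvec (h1 (u + u') (v + v')) = cvec (h1 u v + h1 u' v')" "cvec (h2 (u + u') (v + v')) = cvec (h2 u v + h2 u' v')"
      unfolding h by (simp_all add: cvec_simps(1))
    then show "h1 (u + u') (v + v') = h1 u v + h1 u' v'" "h2 (u + u') (v + v') = h2 u v + h2 u' v'"
      using inj_cv by blast+
  qed
  have h_scale: "h1 (c *\<^sub>R u) (c *\<^sub>R v) = c *\<^sub>R h1 u v" "h2 (c *\<^sub>R u) (c *\<^sub>R v) = c *\<^sub>R h2 u v" for u v c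
  proof -
    have "(0, cvec (c *\<^sub>R u), cvec (c *\<^sub>R v)) = mscale (of_real c) (0, cvec u, cvec v)"
      by (simp add: mscale_simps cvec_simps vec_eq_iff)
    then have "\<beta> (0, cvec (c *\<^sub>R u), cvec (c *\<^sub>R v)) = mscale (of_real c) (\<beta> (0, cvec u, cvec v))"
      using scale[of "(0, cvec u, cvec v)" "of_real c"] by (simp add: model_space_iff)
    then have "cvec (h1 (c *\<^sub>R u) (c *\<^sub>R v)) = cvec (c *\<^sub>R h1 u v)" "cvec (h2 (c *\<^sub>R u) (c *\<^sub>R v)) = cvec (c *\<^sub>R h2 u v)"
      unfolding h mscale_simps by (simp_all add: cvec_simps(2))
    then show "h1 (c *\<^sub>R u) (c *\<^sub>R v) = c *\<^sub>R h1 u v" "h2 (c *\<^sub>R u) (c *\<^sub>R v) = c *\<^sub>R h2 u v"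
      using inj_cv by blast+
  qed
  \<comment> \<open>The mixed part of the cubic form pairs \<open>S\<close> with \<open>wedge u v\<close>, so that invariance of the cubic and
    the Hermitian form makes \<open>wedge\<close> equivariant.\<close>
  have g_wedge: "g (wedge (cvec u) (cvec v)) = wedge (cvec (h1 u v)) (cvec (h2 u v))" for u v
  proof -
    \<comment> \<open>\<open>D\<close> measures the failure of the claim. If g S = D, the cubic form
      gives <W', D> = <W, S> and the Hermitian form gives <g W, D> = <W, S>. The difference is <D,
      D> = 0, and \<open>D\<close> is real.\<close>
    define W W' D where "W = wedge (cvec u) (cvec v)" and "W' = wedge (cvec (h1 u v)) (cvec (h2 u v))" and "D = W' - g W"
    have skW: "skew W" by (simp add: W_def)
    have "skew D" unfolding D_def W'_def by (intro skew_diff skew_wedge g_skew skW)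
    then have "(D, 0, 0) \<in> model_space" by (simp add: model_space_iff)
    then have "(D, 0, 0) \<in> \<beta> ` model_space" unfolding bij_betw_imp_surj_on[OF bij] .
    then obtain M where M: "M \<in> model_space" "\<beta> M = (D, 0, 0)" by (elim imageE) simp
    have "\<beta> (flipM M) = \<beta> M" using flip[OF M(1)] M(2) by (simp add: flipM_def)
    then have "flipM M = M"
      by (rule inj_onD[OF bij_betw_imp_inj_on[OF bij]]) (intro model_space_flipM M(1))+
    then obtain S where S: "M = (S, 0, 0)" by (cases M) (auto simp: flipM_def vec_eq_iff)
    have sk: "skew S" using M(1) by (simp add: S model_space_iff)
    have gS: "g S = D" using M(2) g[OF sk] by (simp add: S)
    have "\<beta> (S, cvec u, cvec v) = \<beta> (S, 0, 0) + \<beta> (0, cvec u, cvec v)"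
      by (subst add[symmetric]) (simp_all add: model_space_iff sk)
    then have "\<beta> (S, cvec u, cvec v) = (D, cvec (h1 u v), cvec (h2 u v))" by (simp add: g[OF sk] h gS)
    then have "Pf D + bdot (cvec (h1 u v)) (D *v cvec (h2 u v)) = Pf S + bdot (cvec u) (S *v cvec v)"
      using cub[of "(S, cvec u, cvec v)"] by (simp add: model_space_iff sk cubicM_eq)
    \<comment> \<open>The instance with zero vectors removes the Pfaffian from the identity and
      leaves the mixed term.\<close>
    moreover have "Pf D = Pf S"
      using cub[of "(S, 0, 0)"] g[OF sk] gS sk by (simp add: model_space_iff cubicM_eq bdot_def)
    ultimately have 1: "frob W' D = frob W S"
      using g_skew[OF sk] by (simp add: W_def W'_def frob_wedge sk gS)
    have rW: "cnjm W = W" "cnjm W' = W'" by (simp_all add: W_def W'_def cnjm_wedge cvec_simps)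
    have c0: "cnjv 0 = 0" by (simp add: cnjv_def vec_eq_iff)
    have rgW: "cnjm (g W) = g W"
      using cnj[of "(W, 0, 0)"] by (simp add: model_space_iff skW cnjM_eq rW c0 g[OF skW])
    have "frob (g W) D = frob W S"
      using herm[of "(W, 0, 0)" "(S, 0, 0)"] by (simp add: model_space_iff skW sk g gS hermM_eq rgW rW c0 bdot_def)
    then have "frob D D = 0" using 1 by (simp add: D_def frob_def left_diff_distrib sum_subtractf)
    moreover have "cnjm D = D" using rW rgW by (simp add: D_def cnjm_def vec_eq_iff)
    ultimately have "D = 0" using frob_cnjm_0[of D] by simp
    then show ?thesis by (simp add: D_def W_def W'_def)
  qed
  define P Q R T where "P u = h1 u 0" and "Q u = h2 u 0" and "R v = h1 0 v" and "T v = h2 0 v" for u v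
  have lin: "linear P" "linear Q" "linear R" "linear T"
    using h_add[of _ _ 0 0] h_add[of 0 0] h_scale[of _ _ 0] h_scale[of _ 0]
    unfolding P_def Q_def R_def T_def by (auto intro!: linearI)
  have h12: "h1 u v = P u + R v" "h2 u v = Q u + T v" for u v
    using h_add[of u 0 0 v] unfolding P_def Q_def R_def T_def by simp_all
  have parallel: "parallel (P u + R v) (Q u + T v)" if "parallel u v" for u v
  proof -
    have "mscale 0 (0, 0, 0) = (0, 0, 0)" by (simp add: mscale_simps vec_eq_iff)
    then have "\<beta> (0, 0, 0) = mscale 0 (\<beta> (0, 0, 0))" using scale[of "(0, 0, 0)" 0] by (simp add: model_space_iff)
    then have "g 0 = 0" using g[of 0] by (simp add: mscale_simps vec_eq_iff)
    then show ?thesis using g_wedge[of u v] that unfolding h12[symmetric] wedge_eq_0_iff[symmetric] by simp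
  qed
  have iso: "(norm (P u + R v))\<^sup>2 + (norm (Q u + T v))\<^sup>2 = (norm u)\<^sup>2 + (norm v)\<^sup>2" for u v
  proof -
    have "complex_of_real ((norm (h1 u v))\<^sup>2 + (norm (h2 u v))\<^sup>2) = of_real ((norm u)\<^sup>2 + (norm v)\<^sup>2)"
      using herm[of "(0, cvec u, cvec v)" "(0, cvec u, cvec v)"]
      by (simp add: model_space_iff h hermM_eq cvec_simps bdot_cv frob_def cnjm_def del: of_real_power)
    then show ?thesis unfolding h12 by (simp only: of_real_eq_iff)
  qed
  obtain A b c t where A: "orthogonal_matrix A" and bc: "b\<^sup>2 + c\<^sup>2 = 1" and t: "t = 1 \<or> t = - 1"
    and PQ: "\<And>u. P u = b *\<^sub>R (A *v u)" "\<And>u. Q u = c *\<^sub>R (A *v u)"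
    and RT: "\<And>u. R u = - (t * c) *\<^sub>R (A *v u)" "\<And>u. T u = (t * b) *\<^sub>R (A *v u)"
    by (rule rank_one_isometry[OF lin parallel iso, of 1 2 3]) auto
  have cvh: "cvec (h1 u v) = complexify A *v (of_real b *s cvec u - of_real (t * c) *s cvec v)"
    "cvec (h2 u v) = complexify A *v (of_real c *s cvec u + of_real (t * b) *s cvec v)" for u v
    unfolding h12 PQ RT cvec_simps(1,2,4)
    by (simp_all add: matrix_vector_right_distrib matrix_vector_mult_diff_distrib vector_scalar_commute)
  have \<beta>: "\<beta> M = twistM t b c A M" if "M \<in> model_space" for M
  proof (rule model_linear_eqI[OF _ twistM_linear _ _ _ that])
    show "model_linear \<beta>" using add scale by (simp add: model_linear_def)
    have c0: "cong_act A 0 = 0" by (simp add: vec_eq_iff cong_act_nth)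
    have tw: "twistM t b c A (0, cvec u, cvec v) = (0, cvec (h1 u v), cvec (h2 u v))" for u v
      unfolding cvh by (simp add: twistM_def c0 vec_eq_iff)
    show "\<beta> (0, cvec (axis r 1), 0) = twistM t b c A (0, cvec (axis r 1), 0)" for r
      using h[of "axis r 1" 0] tw[of "axis r 1" 0] by (simp add: cvec_simps)
    show "\<beta> (0, 0, cvec (axis r 1)) = twistM t b c A (0, 0, cvec (axis r 1))" for r
      using h[of 0 "axis r 1"] tw[of 0 "axis r 1"] by (simp add: cvec_simps)
    show "\<beta> (wedge (cvec (axis r 1)) (cvec (axis s 1)), 0, 0) = twistM t b c A (wedge (cvec (axis r 1)) (cvec (axis s 1)), 0, 0)" for r s
    proof -
      have "wedge (cvec (h1 u v)) (cvec (h2 u v)) = (\<chi> r. of_real t *s cong_act A (wedge (cvec u) (cvec v)) $ r)" for u v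
      proof -
        have "b * b + c * c = 1" using bc by (simp add: power2_eq_square)
        then show ?thesis unfolding cvh wedge_matrix wedge_comb cong_act_scale by simp
      qed
      then show ?thesis by (simp add: g g_wedge twistM_def)
    qed
  qed
  \<comment> \<open>Three standard symplectic 2 x 2 blocks on the diagonal, a matrix of Pfaffian 1;
    testing the cubic form on it gives \<open>t ^ 3 * det A = 1\<close>.\<close>
  define S0 where "S0 = skew6 1 0 0 0 0 0 0 0 0 1 0 0 0 0 1"
  have "skew S0" by (simp add: S0_def)
  moreover have "Pf S0 = 1" by (simp add: S0_def Pf_def skew6_def)
  ultimately have "of_real t ^ 3 * complex_of_real (det A) = 1"
    using cub[of "(S0, 0, 0)"] by (simp add: model_space_iff \<beta> twistM_def cubicM_eq Pf_scale Pf_congr bdot_def)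
  then have "complex_of_real (t ^ 3 * det A) = of_real 1" by simp
  then have "t ^ 3 * det A = 1" by (simp only: of_real_eq_iff)
  then have tdet: "det A = t" using t by auto
  have U: "(of_real b, of_real c) \<in> U1" using bc by (intro U1_I) (simp add: power2_eq_square)
  from t show thesis
  proof
    assume "t = 1"
    then show thesis using that[OF U, of A] A tdet \<beta> by (simp add: SO6_def rotation_matrix_def twistM_1)
  next
    assume t1: "t = - 1"
    have "A ** sgnK \<in> SO6"
      using A tdet t1 sgnK_orthogonal by (simp add: SO6_def rotation_matrix_def det_mul orthogonal_matrix_mul)
    then show thesis using that[OF U, of "A ** sgnK"] \<beta> t1 by (simp add: twistM_minus_1)
  qed
qed

section \<open>The group isomorphism\<close>

abbreviation fixed_group :: "(jc \<Rightarrow> jc) set" where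
  "fixed_group \<equiv> E6_lam_gamma \<inter> E6_lam_gamma_gammaC"

abbreviation pair_group :: "(quat \<times> (real ^ 6 ^ 6)) monoid" where
  "pair_group \<equiv> U1_group \<times>\<times> SO6_group"

abbreviation pair_coset :: "quat \<times> (real ^ 6 ^ 6) \<Rightarrow> (quat \<times> (real ^ 6 ^ 6)) set" where
  "pair_coset p \<equiv> Z2_kernel #>\<^bsub>pair_group\<^esub> p"

lemma model_auto_mem: "model_auto \<beta> \<Longrightarrow> M \<in> model_space \<Longrightarrow> \<beta> M \<in> model_space"
  unfolding model_auto_def by (auto dest: bij_betwE)

lemma compose_lift:
  assumes "model_auto g" shows "compose JC (lift_model f) (lift_model g) = lift_model (\<lambda>M. f (g M))"
  by (rule ext) (simp add: compose_def lift_model_def to_model_of_model_model_space model_auto_mem[OF assms])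

lemma lift_model_cong: "(\<And>M. M \<in> model_space \<Longrightarrow> f M = g M) \<Longrightarrow> lift_model f = lift_model g"
  by (auto simp: lift_model_def)

lemma lift_model_eqD:
  assumes "lift_model f = lift_model g" "model_auto f" "model_auto g" "M \<in> model_space" shows "f M = g M"
  using on_model_lift[OF assms(2,4)] on_model_lift[OF assms(3,4)] unfolding assms(1) by (rule subst)

lemma lift_id: "lift_model (\<lambda>M. M) = (\<lambda>X\<in>JC. X)"
  by (rule ext) (simp add: lift_model_def of_model_to_model)

lemma lift_gamM: "lift_model gamM = gammaH"
proof
  fix X show "lift_model gamM X = gammaH X"
  proof (cases "X \<in> JC")
    case True
    then have "to_model (gammaH X) = gamM (to_model X)" by (simp add: to_model_gammaH gamM_def)
    then have "lift_model gamM X = of_model (to_model (gammaH X))" using True by (simp add: lift_model_def)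
    also have "\<dots> = gammaH X" using True by (intro of_model_to_model gamma_JC(2))
    finally show ?thesis .
  qed (simp add: lift_model_def gammaH_def entrywise_def)
qed

lemma id_auto: "model_auto (\<lambda>M. M)"
  by (simp add: model_auto_def bij_betw_def)

lemma model_auto_comp:
  assumes f: "model_auto f" and g: "model_auto g" shows "model_auto (\<lambda>M. f (g M))"
proof -
  have "bij_betw (f \<circ> g) model_space model_space" using assms unfolding model_auto_def by (blast intro: bij_betw_trans)
  then have "bij_betw (\<lambda>M. f (g M)) model_space model_space" by (simp add: comp_def)
  then show ?thesis using f g model_auto_mem[OF g] unfolding model_auto_def by simp
qed

lemma lift_fixed:
  assumes "model_auto f" "\<And>M. M \<in> model_space \<Longrightarrow> f (cnjM M) = cnjM (f M)" "\<And>M. M \<in> model_space \<Longrightarrow> f (flipM M) = flipM (f M)"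
  shows "lift_model f \<in> fixed_group"
  unfolding fixed_group_iff[OF lift_model_E6[OF assms(1)]]
  by (simp add: on_model_lift[OF assms(1)] assms model_space_cnjM model_space_flipM)

definition psi :: "quat \<times> (real ^ 6 ^ 6) \<Rightarrow> jc \<Rightarrow> jc" where
  "psi p = lift_model (psiM p)"

lemma psi_fixed:
  assumes "p \<in> U1 \<times> SO6" shows "psi p \<in> fixed_group"
proof -
  obtain a A where p: "p = (a, A)" "a \<in> U1" "A \<in> SO6" using assms by blast
  show ?thesis unfolding psi_def p(1)
    by (rule lift_fixed) (simp_all add: psiM_cnjM psiM_flipM psiM_auto p)
qed

lemma psi_gamM_fixed:
  assumes "p \<in> U1 \<times> SO6" shows "compose JC (psi p) gammaH \<in> fixed_group"
proof -
  obtain a A where p: "p = (a, A)" "a \<in> U1" "A \<in> SO6" using assms by blast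
  show ?thesis unfolding psi_def p(1) lift_gamM[symmetric] compose_lift[OF gamM_auto]
    by (rule lift_fixed, rule model_auto_comp[OF psiM_auto[OF p(2,3)] gamM_auto])
      (simp_all add: psiM_cnjM psiM_flipM gamM_cnjM gamM_flipM p)
qed

lemma psi_id: "compose JC (psi p) (\<lambda>X\<in>JC. X) = psi p"
  unfolding lift_id[symmetric] psi_def by (simp add: compose_lift id_auto)

lemma fixed_group_cases:
  assumes "\<alpha> \<in> fixed_group"
  obtains p where "p \<in> U1 \<times> SO6" "\<alpha> = psi p \<or> \<alpha> = compose JC (psi p) gammaH"
proof -
  have E6: "\<alpha> \<in> E6" using assms by (simp add: E6_lam_gamma_def)
  have a: "\<alpha> = lift_model (on_model \<alpha>)"
    using E6_D(1)[OF E6] of_model_on_model[OF E6] by (auto simp: lift_model_def extensional_def)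
  have cn: "on_model \<alpha> (cnjM M) = cnjM (on_model \<alpha> M)" and fl: "on_model \<alpha> (flipM M) = flipM (on_model \<alpha> M)"
    if "M \<in> model_space" for M
    using fixed_group_iff[OF E6] assms that by blast+
  obtain a A where p: "a \<in> U1" "A \<in> SO6" and c: "(\<forall>M\<in>model_space. on_model \<alpha> M = psiM (a, A) M) \<or> (\<forall>M\<in>model_space. on_model \<alpha> M = psiM (a, A) (gamM M))"
    by (rule real_model_auto_cases[OF on_model_auto[OF E6] cn fl])
  have "\<alpha> = psi (a, A) \<or> \<alpha> = compose JC (psi (a, A)) gammaH"
    using c
  proof
    assume "\<forall>M\<in>model_space. on_model \<alpha> M = psiM (a, A) M"
    then have "lift_model (on_model \<alpha>) = psi (a, A)" unfolding psi_def by (intro lift_model_cong) simp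
    with a have "\<alpha> = psi (a, A)" by (rule trans)
    then show ?thesis ..
  next
    assume "\<forall>M\<in>model_space. on_model \<alpha> M = psiM (a, A) (gamM M)"
    then have "lift_model (on_model \<alpha>) = compose JC (psi (a, A)) gammaH"
      unfolding psi_def lift_gamM[symmetric] compose_lift[OF gamM_auto] by (intro lift_model_cong) simp
    with a have "\<alpha> = compose JC (psi (a, A)) gammaH" by (rule trans)
    then show ?thesis ..
  qed
  then show thesis using that[of "(a, A)"] p by simp
qed

section \<open>Products, the kernel and the two components\<close>

lemma U1_mult: "a \<in> U1 \<Longrightarrow> b \<in> U1 \<Longrightarrow> hmult a b \<in> U1"
proof -
  assume a: "a \<in> U1" and b: "b \<in> U1"
  obtain x y where x: "a = (of_real x, of_real y)" "x * x + y * y = 1" using U1_cases[OF a] .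
  obtain x' y' where y: "b = (of_real x', of_real y')" "x' * x' + y' * y' = 1" using U1_cases[OF b] .
  note ab = x y
  have e: "hmult a b = (of_real (x * x' - y * y'), of_real (x * y' + y * x'))" by (simp add: ab hmult_def)
  have "(x * x' - y * y') * (x * x' - y * y') + (x * y' + y * x') * (x * y' + y * x') = (x * x + y * y) * (x' * x' + y' * y')"
    by (simp add: algebra_simps)
  then show "hmult a b \<in> U1" unfolding e using ab(2,4) by (intro U1_I) simp
qed

lemma SO6_mult: "A \<in> SO6 \<Longrightarrow> B \<in> SO6 \<Longrightarrow> A ** B \<in> SO6"
  by (simp add: SO6_def rotation_matrix_def orthogonal_matrix_mul det_mul)

text \<open>The scalar i cancels, and I may be replaced by -I, so the conjugate is K A K with K =
  \<open>sgnK\<close>; the two determinants -1 cancel.\<close>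

lemma conj_iI_SO6:
  assumes "A \<in> SO6" shows "conj_iI A \<in> SO6"
proof -
  have K: "(sgnK ** B) $ i $ j = - sgn6 i * B $ i $ j" "(B ** sgnK) $ i $ j = - sgn6 j * B $ i $ j" for B i j
  proof -
    have "(sgnK ** B) $ i $ j = (\<Sum>k\<in>UNIV. if k = i then - sgn6 i * B $ i $ j else 0)"
      unfolding matrix_matrix_mult_def vec_lambda_beta by (intro sum.cong) (auto simp: sgnK_def)
    then show "(sgnK ** B) $ i $ j = - sgn6 i * B $ i $ j" by simp
    have "(B ** sgnK) $ i $ j = (\<Sum>k\<in>UNIV. if k = j then - sgn6 j * B $ i $ j else 0)"
      unfolding matrix_matrix_mult_def vec_lambda_beta by (intro sum.cong) (auto simp: sgnK_def)
    then show "(B ** sgnK) $ i $ j = - sgn6 j * B $ i $ j" by simp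
  qed
  have "conj_iI A = sgnK ** A ** sgnK"
    by (simp add: vec_eq_iff K conj_iI_nth)
  then show ?thesis
    using assms sgnK_orthogonal by (simp add: SO6_def rotation_matrix_def orthogonal_matrix_mul det_mul)
qed

lemma gammaH_psi:
  assumes "a \<in> U1" "A \<in> SO6"
  shows "compose JC gammaH (psi (a, A)) = compose JC (psi (hcnj a, conj_iI A)) gammaH"
  unfolding psi_def lift_gamM[symmetric] compose_lift[OF gamM_auto] compose_lift[OF psiM_auto[OF assms]]
  by (simp add: gamM_psiM[OF assms(1)])

lemma gammaH_gammaH: "compose JC gammaH gammaH = (\<lambda>X\<in>JC. X)"
  unfolding lift_gamM[symmetric] compose_lift[OF gamM_auto] by (simp add: lift_id)

lemma psi_mult:
  assumes "a \<in> U1" "b \<in> U1" "B \<in> SO6"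
  shows "compose JC (psi (a, A)) (psi (b, B)) = psi (hmult a b, A ** B)"
  unfolding psi_def compose_lift[OF psiM_auto[OF assms(2,3)]]
  by (rule lift_model_cong) (simp add: psiM_mult[OF assms(1,2)])

lemma psi_neg: "psi (- a, - A) = psi (a, A)"
  by (simp add: psi_def psiM_neg[abs_def])

lemma cvec_inj: "cvec x = cvec y \<Longrightarrow> x = y"
  by (simp add: cvec_def vec_eq_iff)

lemma matrix_mul_neg: "A ** (- B) = - (A ** B)" "(- A) ** B = - (A ** (B :: real ^ 'n ^ 'm))"
  by (simp_all add: vec_eq_iff matrix_matrix_mult_def sum_negf)

text \<open>Applied to (0, u, 0), a trivial action gives x A u = u and y A u = 0. Thus y = 0, x is 1
  or -1, and A = x E.\<close>

lemma psi_kernel: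
  assumes a: "a \<in> U1" and id: "\<And>M. M \<in> model_space \<Longrightarrow> psiM (a, A) M = M"
  shows "(a, A) = ((1, 0), mat 1) \<or> (a, A) = (- (1, 0), - mat 1)"
proof -
  obtain x y where xy: "a = (of_real x, of_real y)" "x * x + y * y = 1" using U1_cases[OF a] .
  have "cvec (x *\<^sub>R (A *v u)) = cvec u" "cvec (y *\<^sub>R (A *v u)) = cvec 0" for u
    using id[of "(0, cvec u, 0)"]
    by (simp_all add: model_space_iff psiM_def xy(1) cvec_simps vector_scalar_commute)
  then have 1: "x *\<^sub>R (A *v u) = u" "y *\<^sub>R (A *v u) = 0" for u
    using cvec_inj by blast+
  have "A *v axis 1 1 \<noteq> 0" using 1(1)[of "axis 1 1"] by (auto simp: axis_eq_0_iff)
  then have "y = 0" using 1(2)[of "axis 1 1"] by simp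
  then have x: "x = 1 \<or> x = - 1" using xy(2) by (simp add: square_eq_1_iff)
  have "A *v u = (x *\<^sub>R mat 1) *v u" for u
  proof -
    have "A *v u = x *\<^sub>R (x *\<^sub>R (A *v u))" using x by auto
    then show ?thesis unfolding 1 by (simp add: scaleR_matrix_vector_assoc[symmetric])
  qed
  then have "A = x *\<^sub>R mat 1" by (simp add: matrix_eq)
  then show ?thesis using x \<open>y = 0\<close> by (auto simp: xy(1) zero_prod_def)
qed

lemma psi_inj:
  assumes p: "a \<in> U1" "A \<in> SO6" and q: "b \<in> U1" "B \<in> SO6" and eq: "psi (a, A) = psi (b, B)"
  shows "(b, B) = (a, A) \<or> (b, B) = (- a, - A)"
proof -
  have o: "A ** transpose A = mat 1" "transpose A ** A = mat 1" "transpose A \<in> SO6"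
    using p(2) by (auto simp: SO6_def rotation_matrix_def orthogonal_matrix_def det_transpose)
  have "psiM (hmult (hcnj a) b, transpose A ** B) M = M" if "M \<in> model_space" for M
  proof -
    have "psiM (a, A) M = psiM (b, B) M"
      using lift_model_eqD[OF eq[unfolded psi_def] psiM_auto[OF p] psiM_auto[OF q] that] .
    then have "psiM (hmult (hcnj a) b, transpose A ** B) M = psiM (hmult (hcnj a) a, transpose A ** A) M"
      using p q hmult_hcnj_U1(3)[of a] by (simp add: psiM_mult)
    then show ?thesis using p o by (simp add: hmult_hcnj_U1 psiM_one)
  qed
  then have k: "(hmult (hcnj a) b, transpose A ** B) = ((1, 0), mat 1) \<or> (hmult (hcnj a) b, transpose A ** B) = (- (1, 0), - mat 1)"
    by (intro psi_kernel U1_mult hmult_hcnj_U1(3) p q)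
  have "hmult a (hmult (hcnj a) b) = hmult (hmult a (hcnj a)) b"
    by (simp add: hmult_def hcnj_def split_beta algebra_simps)
  then have b: "hmult a (hmult (hcnj a) b) = b"
    using p by (simp add: hmult_hcnj_U1) (simp add: hmult_def split_beta)
  have B: "A ** (transpose A ** B) = B" by (simp add: matrix_mul_assoc o)
  have neg: "hmult a (1, 0) = a" "hmult a (- (1, 0)) = - a" "A ** (- mat 1) = - A"
    by (simp_all add: hmult_def split_beta prod_eq_iff matrix_mul_neg)
  from k show ?thesis
  proof
    assume h: "(hmult (hcnj a) b, transpose A ** B) = ((1, 0), mat 1)"
    have "b = a" using b h neg by simp
    moreover have "B = A" using B h by simp
    ultimately show ?thesis by simp
  next
    assume h: "(hmult (hcnj a) b, transpose A ** B) = (- (1, 0), - mat 1)"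
    have "b = - a" using b h neg by simp
    moreover have "B = - A" using B h neg by simp
    ultimately show ?thesis by simp
  qed
qed

text \<open>Otherwise some \<open>psi (c, C)\<close> would be gamma_H. The diagonal blocks of
  \<open>psi (c, C)\<close> on u and v are both x C, whereas those of gamma_H are -I and I; they
  differ already at the first basis vector.\<close>

lemma psi_neq_gammaH:
  assumes p: "a \<in> U1" "A \<in> SO6" and q: "b \<in> U1" "B \<in> SO6"
  shows "psi (a, A) \<noteq> compose JC (psi (b, B)) gammaH"
proof
  assume "psi (a, A) = compose JC (psi (b, B)) gammaH"
  then have e: "lift_model (psiM (a, A)) = lift_model (\<lambda>M. psiM (b, B) (gamM M))"
    by (simp add: psi_def lift_gamM[symmetric] compose_lift gamM_auto)
  have o: "transpose B ** B = mat 1"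
    using q(2) by (auto simp: SO6_def rotation_matrix_def orthogonal_matrix_def)
  define c C where "c = hmult (hcnj b) a" and "C = transpose B ** A"
  have c: "c \<in> U1" unfolding c_def by (intro U1_mult hmult_hcnj_U1(3) p q)
  have 0: "psiM (c, C) M = gamM M" if "M \<in> model_space" for M
  proof -
    have "psiM (a, A) M = psiM (b, B) (gamM M)"
      using lift_model_eqD[OF e psiM_auto[OF p] model_auto_comp[OF psiM_auto[OF q] gamM_auto] that] .
    then have "psiM (c, C) M = psiM (hmult (hcnj b) b, transpose B ** B) (gamM M)"
      unfolding c_def C_def using p q hmult_hcnj_U1(3)[of b] by (simp add: psiM_mult)
    then show ?thesis using q o by (simp add: hmult_hcnj_U1 psiM_one)
  qed
  obtain x y where xy: "c = (of_real x, of_real y)" "x * x + y * y = 1" using U1_cases[OF c] .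
  let ?e = "cvec (axis 1 1) :: complex ^ 6"
  have g: "(\<chi> r. of_real (sgn6 r) * ?e $ r) = ?e" "(\<chi> r. - of_real (sgn6 r) * ?e $ r) = - ?e"
    by (auto simp: vec_eq_iff cvec_def axis_def sgn6_def)
  have "fst (snd (psiM (c, C) (0, ?e, 0))) = fst (snd (gamM (0, ?e, 0)))"
    using 0[of "(0, ?e, 0)"] by (simp add: model_space_iff)
  then have e1: "of_real x *s (complexify C *v ?e) = - ?e"
    unfolding psiM_def gamM_def xy(1) split_conv fst_conv snd_conv g by (simp add: vector_scalar_commute)
  have "snd (snd (psiM (c, C) (0, 0, ?e))) = snd (snd (gamM (0, 0, ?e)))"
    using 0[of "(0, 0, ?e)"] by (simp add: model_space_iff)
  then have e2: "of_real x *s (complexify C *v ?e) = ?e"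
    unfolding psiM_def gamM_def xy(1) split_conv fst_conv snd_conv g by (simp add: vector_scalar_commute)
  have "?e $ 1 = (- ?e) $ 1" unfolding e1[symmetric] e2 ..
  then show False by (simp add: cvec_def axis_def)
qed

section \<open>The quotient by Z2 and the semidirect product\<close>

lemma pair_coset_eq: "pair_coset (a, A) = {(a, A), (- a, - A)}"
proof -
  have "hmult (1, 0) a = a" "hmult (- (1, 0)) a = - a"
    by (simp_all add: hmult_def split_beta prod_eq_iff)
  then show ?thesis
    by (auto simp: r_coset_def Z2_kernel_def DirProd_def U1_group_def SO6_group_def matrix_mul_neg)
qed

text \<open>An arbitrary representative is chosen; by \<open>psi_neg\<close> the value is the same
  for both elements of the coset.\<close>

definition psi_coset :: "(quat \<times> (real ^ 6 ^ 6)) set \<Rightarrow> jc \<Rightarrow> jc" where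
  "psi_coset C = psi (SOME p. p \<in> C)"

lemma psi_coset_eq: "psi_coset (pair_coset p) = psi p"
proof -
  obtain a A where p: "p = (a, A)" by (cases p)
  have "(SOME q. q \<in> pair_coset p) \<in> pair_coset p"
    by (rule someI[of _ "(a, A)"]) (simp add: p pair_coset_eq)
  then show ?thesis
    unfolding psi_coset_def by (auto simp: p pair_coset_eq psi_neg)
qed

lemma carrier_mod: "carrier U1_SO6_mod_Z2 = pair_coset ` (U1 \<times> SO6)"
  by (auto simp: U1_SO6_mod_Z2_def FactGroup_def RCOSETS_def DirProd_def U1_group_def SO6_group_def)

lemma mult_mod: "pair_coset (a, A) \<otimes>\<^bsub>U1_SO6_mod_Z2\<^esub> pair_coset (b, B) = pair_coset (hmult a b, A ** B)"
proof -
  have "hmult (- a) b = - hmult a b" "hmult a (- b) = - hmult a b" "hmult (- a) (- b) = hmult a b"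
    by (simp_all add: hmult_def split_beta prod_eq_iff)
  then show ?thesis
    unfolding pair_coset_eq
    by (auto simp: U1_SO6_mod_Z2_def FactGroup_def set_mult_def DirProd_def U1_group_def SO6_group_def matrix_mul_neg)
qed

lemma one_Bij: "\<one>\<^bsub>BijGroup JC\<^esub> = (\<lambda>X\<in>JC. X)" by (simp add: BijGroup_def)

lemma gammaH_neq_one: "gammaH \<noteq> (\<lambda>X\<in>JC. X)"
proof
  assume h: "gammaH = (\<lambda>X\<in>JC. X)"
  have m: "(1, 0) \<in> U1" "mat 1 \<in> SO6"
    using U1_I[of 1 0] by (auto simp: SO6_def rotation_matrix_def orthogonal_matrix_id)
  have "psi ((1, 0), mat 1) = compose JC (psi ((1, 0), mat 1)) gammaH"
    unfolding h psi_id ..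
  then show False using psi_neq_gammaH[OF m m] by blast
qed

lemma act_gammaH: "Z2_act gammaH (pair_coset (a, A)) = pair_coset (hcnj a, conj_iI A)"
proof -
  have "hcnj (- a) = - hcnj a" by (simp add: hcnj_def split_beta prod_eq_iff)
  moreover have "conj_iI (- A) = - conj_iI A" by (simp add: vec_eq_iff conj_iI_nth)
  ultimately show ?thesis by (simp add: Z2_act_def pair_coset_eq)
qed

text \<open>\<open>Z2_act\<close> decides by equality with \<open>gammaH\<close>, so the identity
  acts trivially because it differs from \<open>gammaH\<close>.\<close>

lemma act_one: "Z2_act (\<lambda>X\<in>JC. X) C = C"
  using gammaH_neq_one by (simp add: Z2_act_def)

lemma mult_transf: "S \<subseteq> Bij JC \<Longrightarrow> f \<in> S \<Longrightarrow> g \<in> S \<Longrightarrow> f \<otimes>\<^bsub>transf_group S\<^esub> g = compose JC f g"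
  by (auto simp: transf_group_def BijGroup_def)

lemma carrier_transf [simp]: "carrier (transf_group S) = S"
  by (simp add: transf_group_def)

lemma E6_Bij: "E6 \<subseteq> Bij JC"
  by (auto simp: E6_def)

lemma fixed_Bij: "fixed_group \<subseteq> Bij JC"
  using E6_Bij by (auto simp: E6_lam_gamma_def)

lemma gammaH_E6: "gammaH \<in> E6"
  unfolding lift_gamM[symmetric] by (rule lift_model_E6) (rule gamM_auto)

lemma Z2_gammaH_eq: "Z2_gammaH = {\<lambda>X\<in>JC. X, gammaH}"
  by (simp add: Z2_gammaH_def one_Bij)

lemma Z2_gammaH_Bij: "Z2_gammaH \<subseteq> Bij JC"
  using gammaH_E6 E6_Bij by (auto simp: Z2_gammaH_eq Bij_def bij_betw_def)

lemma compose_gammaH_id [simp]: "compose JC gammaH (\<lambda>X\<in>JC. X) = gammaH"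
  "compose JC (\<lambda>X\<in>JC. X) gammaH = gammaH" "compose JC (\<lambda>X\<in>JC. X) (\<lambda>X\<in>JC. X) = (\<lambda>X\<in>JC. X)"
  unfolding lift_gamM[symmetric] lift_id[symmetric] compose_lift[OF gamM_auto] compose_lift[OF id_auto] by simp_all

lemma Z2_gammaH_closed: "h \<in> Z2_gammaH \<Longrightarrow> k \<in> Z2_gammaH \<Longrightarrow> compose JC h k \<in> Z2_gammaH"
  by (auto simp: Z2_gammaH_eq gammaH_gammaH)

text \<open>The natural map (n, h) to n h out of a semidirect product; its inverse is the
  isomorphism sought.\<close>

definition join_map :: "(quat \<times> (real ^ 6 ^ 6)) set \<times> (jc \<Rightarrow> jc) \<Rightarrow> jc \<Rightarrow> jc" where
  "join_map z = compose JC (psi_coset (fst z)) (snd z)"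

abbreviation semi_group :: "((quat \<times> (real ^ 6 ^ 6)) set \<times> (jc \<Rightarrow> jc)) monoid" where
  "semi_group \<equiv> semidirect U1_SO6_mod_Z2 (transf_group Z2_gammaH) Z2_act"

lemma carrier_semi: "carrier semi_group = pair_coset ` (U1 \<times> SO6) \<times> Z2_gammaH"
  by (simp add: semidirect_def carrier_mod)

lemma join_map_simps:
  "join_map (pair_coset p, \<lambda>X\<in>JC. X) = psi p" "join_map (pair_coset p, gammaH) = compose JC (psi p) gammaH"
  by (simp_all add: join_map_def psi_coset_eq psi_id)

lemma semi_cases:
  assumes "z \<in> carrier semi_group"
  obtains a A h where "z = (pair_coset (a, A), h)" "a \<in> U1" "A \<in> SO6" "h = (\<lambda>X\<in>JC. X) \<or> h = gammaH"
  using assms unfolding carrier_semi unfolding Z2_gammaH_eq by auto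

lemma join_map_image: "join_map ` carrier semi_group = fixed_group"
proof
  show "join_map ` carrier semi_group \<subseteq> fixed_group"
  proof (rule image_subsetI)
    fix z assume "z \<in> carrier semi_group"
    then obtain a A h where z: "z = (pair_coset (a, A), h)" "a \<in> U1" "A \<in> SO6" "h = (\<lambda>X\<in>JC. X) \<or> h = gammaH"
      by (rule semi_cases)
    from z(4) show "join_map z \<in> fixed_group"
      using psi_fixed[of "(a, A)"] psi_gamM_fixed[of "(a, A)"] z(2,3) unfolding z(1)
      by (elim disjE) (simp_all only: join_map_simps mem_Times_iff fst_conv snd_conv simp_thms)
  qed
  show "fixed_group \<subseteq> join_map ` carrier semi_group"
  proof
    fix \<alpha> assume "\<alpha> \<in> fixed_group"
    then obtain p where p: "p \<in> U1 \<times> SO6" "\<alpha> = psi p \<or> \<alpha> = compose JC (psi p) gammaH"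
      by (rule fixed_group_cases)
    have c: "(pair_coset p, \<lambda>X\<in>JC. X) \<in> carrier semi_group" "(pair_coset p, gammaH) \<in> carrier semi_group"
      using p(1) unfolding carrier_semi unfolding Z2_gammaH_eq by auto
    from p(2) show "\<alpha> \<in> join_map ` carrier semi_group"
      using imageI[OF c(1), of join_map] imageI[OF c(2), of join_map] unfolding join_map_simps by blast
  qed
qed

lemma compose_gammaH_cancel:
  assumes "p \<in> U1 \<times> SO6" "compose JC (psi p) gammaH = compose JC (psi q) gammaH" shows "psi p = psi q"
proof -
  have *: "compose JC (compose JC (psi p) gammaH) gammaH = psi p" for p
  proof -
    have "compose JC (compose JC (psi p) gammaH) gammaH = compose JC (psi p) (compose JC gammaH gammaH)"
      unfolding psi_def lift_gamM[symmetric] compose_lift[OF gamM_auto] by simp (simp add: lift_id[symmetric] compose_lift[OF id_auto])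
    then show ?thesis by (simp only: gammaH_gammaH psi_id)
  qed
  show ?thesis using arg_cong[OF assms(2), of "\<lambda>f. compose JC f gammaH"] unfolding * .
qed

lemma join_map_inj: "inj_on join_map (carrier semi_group)"
proof (rule inj_onI)
  fix z w assume "z \<in> carrier semi_group" "w \<in> carrier semi_group" and eq: "join_map z = join_map w"
  then obtain a A h b B k where z: "z = (pair_coset (a, A), h)" "a \<in> U1" "A \<in> SO6" "h = (\<lambda>X\<in>JC. X) \<or> h = gammaH"
    and w: "w = (pair_coset (b, B), k)" "b \<in> U1" "B \<in> SO6" "k = (\<lambda>X\<in>JC. X) \<or> k = gammaH"
    by (elim semi_cases)
  have same: "pair_coset (a, A) = pair_coset (b, B)" if "psi (a, A) = psi (b, B)"
    using psi_inj[OF z(2,3) w(2,3) that] by (auto simp: pair_coset_eq)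
  have c: "psi (a, A) = psi (b, B)" if "compose JC (psi (a, A)) gammaH = compose JC (psi (b, B)) gammaH"
    using compose_gammaH_cancel[OF _ that] z(2,3) by simp
  have n: "psi (a, A) \<noteq> compose JC (psi (b, B)) gammaH" "psi (b, B) \<noteq> compose JC (psi (a, A)) gammaH"
    by (rule psi_neq_gammaH[OF z(2,3) w(2,3)], rule psi_neq_gammaH[OF w(2,3) z(2,3)])
  from z(4) w(4) show "z = w"
  proof (elim disjE)
    assume hk: "h = (\<lambda>X\<in>JC. X)" "k = (\<lambda>X\<in>JC. X)"
    show ?thesis using eq same unfolding z(1) w(1) hk join_map_simps by blast
  next
    assume hk: "h = (\<lambda>X\<in>JC. X)" "k = gammaH"
    show ?thesis using eq n unfolding z(1) w(1) hk join_map_simps by blast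
  next
    assume hk: "h = gammaH" "k = (\<lambda>X\<in>JC. X)"
    show ?thesis using eq n unfolding z(1) w(1) hk join_map_simps by metis
  next
    assume hk: "h = gammaH" "k = gammaH"
    show ?thesis using eq same c unfolding z(1) w(1) hk join_map_simps by blast
  qed
qed

lemma join_map_mult:
  assumes "z \<in> carrier semi_group" "w \<in> carrier semi_group"
  shows "z \<otimes>\<^bsub>semi_group\<^esub> w \<in> carrier semi_group \<and>
    join_map (z \<otimes>\<^bsub>semi_group\<^esub> w) = compose JC (join_map z) (join_map w)"
proof -
  obtain a A h where z: "z = (pair_coset (a, A), h)" "a \<in> U1" "A \<in> SO6" "h = (\<lambda>X\<in>JC. X) \<or> h = gammaH"
    using semi_cases[OF assms(1)] .
  obtain b B k where w: "w = (pair_coset (b, B), k)" "b \<in> U1" "B \<in> SO6" "k = (\<lambda>X\<in>JC. X) \<or> k = gammaH"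
    using semi_cases[OF assms(2)] .
  have hk: "h \<in> Z2_gammaH" "k \<in> Z2_gammaH" using z(4) w(4) by (auto simp: Z2_gammaH_eq)
  have prod: "z \<otimes>\<^bsub>semi_group\<^esub> w = (pair_coset (a, A) \<otimes>\<^bsub>U1_SO6_mod_Z2\<^esub> Z2_act h (pair_coset (b, B)), compose JC h k)"
    by (simp add: semidirect_def z(1) w(1) mult_transf[OF Z2_gammaH_Bij hk])
  \<comment> \<open>The representative of the twisted coset, chosen so that its image is the
    conjugate of \<open>psi (b, B)\<close> by \<open>h\<close>.\<close>
  obtain b' B' where b': "Z2_act h (pair_coset (b, B)) = pair_coset (b', B')" "b' \<in> U1" "B' \<in> SO6"
    "compose JC h (psi (b, B)) = compose JC (psi (b', B')) h"
  proof (cases "h = gammaH")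
    case True
    show thesis
      by (rule that[of "hcnj b" "conj_iI B"])
        (simp_all only: True act_gammaH hmult_hcnj_U1(3) conj_iI_SO6 gammaH_psi w(2,3))
  next
    case False
    then have h: "h = (\<lambda>X\<in>JC. X)" using z(4) by simp
    have "compose JC h (psi (b, B)) = compose JC (psi (b, B)) h"
      unfolding h lift_id[symmetric] psi_def compose_lift[OF id_auto] compose_lift[OF psiM_auto[OF w(2,3)]] ..
    then show thesis by (intro that[of b B] w(2,3)) (simp_all only: h act_one)
  qed
  have 1: "z \<otimes>\<^bsub>semi_group\<^esub> w = (pair_coset (hmult a b', A ** B'), compose JC h k)"
    unfolding prod b'(1) mult_mod ..
  then have "z \<otimes>\<^bsub>semi_group\<^esub> w \<in> carrier semi_group"
    using U1_mult[OF z(2) b'(2)] SO6_mult[OF z(3) b'(3)] Z2_gammaH_closed[OF hk] by (auto simp: carrier_semi)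
  moreover have "join_map (z \<otimes>\<^bsub>semi_group\<^esub> w) = compose JC (join_map z) (join_map w)"
  proof -
    have J: "h ` JC \<subseteq> JC" "k ` JC \<subseteq> JC" "psi (b, B) ` JC \<subseteq> JC"
      using z(4) w(4) gamma_JC(2) by (auto simp: psi_def lift_model_def)
    have "join_map (z \<otimes>\<^bsub>semi_group\<^esub> w) = compose JC (compose JC (psi (a, A)) (psi (b', B'))) (compose JC h k)"
      unfolding 1 join_map_def fst_conv snd_conv psi_coset_eq psi_mult[OF z(2) b'(2,3)] ..
    \<comment> \<open>Reassociation brings \<open>h\<close> next to the twisted factor, where it can
      be moved across.\<close>
    also have "\<dots> = compose JC (psi (a, A)) (compose JC (compose JC (psi (b', B')) h) k)"
      using J by (intro ext) (auto simp: compose_def image_subset_iff)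
    also have "\<dots> = compose JC (psi (a, A)) (compose JC (compose JC h (psi (b, B))) k)"
      unfolding b'(4) ..
    also have "\<dots> = compose JC (compose JC (psi (a, A)) h) (compose JC (psi (b, B)) k)"
      using J by (intro ext) (auto simp: compose_def image_subset_iff)
    finally show ?thesis unfolding join_map_def z(1) w(1) fst_conv snd_conv psi_coset_eq .
  qed
  ultimately show ?thesis ..
qed

section \<open>The homeomorphism\<close>

lemma continuous_cay_cnj: "continuous_on S f \<Longrightarrow> continuous_on S (\<lambda>x. cay_cnj (f x))"
  by (rule bounded_linear.continuous_on[OF linear_conv_bounded_linear[THEN iffD1, OF linear_cay_cnj]])

lemma continuous_octonion:
  assumes "continuous_on S f0" "continuous_on S f1" "continuous_on S f2" "continuous_on S f3"
    "continuous_on S f4" "continuous_on S f5" "continuous_on S f6" "continuous_on S f7"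
  shows "continuous_on S (\<lambda>x. octonion (f0 x) (f1 x) (f2 x) (f3 x) (f4 x) (f5 x) (f6 x) (f7 x))"
  unfolding octonion_def Complex_eq by (intro continuous_intros assms)

lemma continuous_vec3:
  assumes "continuous_on S f" "continuous_on S g" "continuous_on S h"
  shows "continuous_on S (\<lambda>x. vec3 (f x) (g x) (h x))"
  unfolding vec3_def
proof (intro continuous_on_vec_lambda)
  fix i :: 3
  show "continuous_on S (\<lambda>x. if i = 1 then f x else if i = 2 then g x else h x)"
    using assms by (cases "i = 1"; cases "i = 2") simp_all
qed

lemma continuous_model_part:
  assumes f: "\<And>g. continuous_on S g \<Longrightarrow> continuous_on S (\<lambda>x. f (g x))"
    and S: "continuous_on S s" "continuous_on S u" "continuous_on S v"
  shows "continuous_on S (\<lambda>x. model_part f (s x, u x, v x))"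
  unfolding model_part_def split_conv herm3_def
  by (intro continuous_vec3 continuous_octonion continuous_cay_cnj f continuous_intros S) simp_all

lemma continuous_of_model:
  assumes "continuous_on S s" "continuous_on S u" "continuous_on S v"
  shows "continuous_on S (\<lambda>x. of_model (s x, u x, v x))"
  unfolding of_model_def
  by (intro continuous_on_Pair continuous_model_part assms continuous_on_Re continuous_on_Im)

text \<open>For fixed \<open>X\<close> the coordinates of the image are polynomials in the entries
  of \<open>p\<close>; in the pointwise topology this is the continuity that is wanted.\<close>

lemma continuous_psi: "continuous_on S (\<lambda>p. psi p X)"
proof (cases "X \<in> JC")
  case True
  obtain T u v where M: "to_model X = (T, u, v)" by (cases "to_model X")
  have "psi p X = of_model (cong_act (snd p) T, complexify (snd p) *v (fst (fst p) *s u - snd (fst p) *s v),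
     complexify (snd p) *v (snd (fst p) *s u + fst (fst p) *s v))" for p
    using True by (cases p) (simp add: psi_def lift_model_def M psiM_def)
  moreover have "continuous_on S (\<lambda>p. cong_act (snd p) T)"
  proof -
    have "cong_act (snd p) T = (\<chi> i j. \<Sum>k\<in>UNIV. \<Sum>l\<in>UNIV. of_real (snd p $ i $ k) * T $ k $ l * of_real (snd p $ j $ l))"
      for p :: "quat \<times> (real ^ 6 ^ 6)" by (simp add: vec_eq_iff cong_act_nth)
    then show ?thesis
      by simp (intro continuous_on_vec_lambda continuous_intros)
  qed
  moreover have "continuous_on S (\<lambda>p. complexify (snd p) *v (fst (fst p) *s u - snd (fst p) *s v))"
    unfolding complexify_def matrix_vector_mult_def vec_lambda_beta vector_minus_component vector_smult_component
    by (intro continuous_on_vec_lambda continuous_intros)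
  moreover have "continuous_on S (\<lambda>p. complexify (snd p) *v (snd (fst p) *s u + fst (fst p) *s v))"
    unfolding complexify_def matrix_vector_mult_def vec_lambda_beta vector_add_component vector_smult_component
    by (intro continuous_on_vec_lambda continuous_intros)
  ultimately show ?thesis by (simp add: continuous_of_model)
next
  case False
  then show ?thesis by (simp add: psi_def lift_model_def)
qed

section \<open>Compactness of the source and separation of the target\<close>

lemma compact_U1: "compact U1"
proof -
  have eq: "U1 = (\<lambda>z. (of_real (Re z), of_real (Im z))) ` sphere (0 :: complex) 1"
  proof
    show "U1 \<subseteq> (\<lambda>z. (of_real (Re z), of_real (Im z))) ` sphere (0 :: complex) 1"
    proof
      fix a assume "a \<in> U1"
      then obtain x y where xy: "a = (of_real x, of_real y)" "x * x + y * y = 1" by (rule U1_cases)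
      then have "Complex x y \<in> sphere 0 1" by (simp add: cmod_def power2_eq_square)
      then show "a \<in> (\<lambda>z. (of_real (Re z), of_real (Im z))) ` sphere (0 :: complex) 1"
        using xy(1) by (intro image_eqI[of _ _ "Complex x y"]) simp_all
    qed
    show "(\<lambda>z. (of_real (Re z), of_real (Im z))) ` sphere (0 :: complex) 1 \<subseteq> U1"
    proof (rule image_subsetI)
      fix z :: complex assume "z \<in> sphere 0 1"
      then have "Re z * Re z + Im z * Im z = 1" by (simp add: cmod_def power2_eq_square)
      then show "(of_real (Re z), of_real (Im z)) \<in> U1" by (rule U1_I)
    qed
  qed
  show ?thesis
    unfolding eq by (intro compact_continuous_image continuous_intros compact_sphere)
qed

lemma compact_SO6: "compact SO6"
proof -
  have "norm (A $ i) = 1" if "A \<in> SO6" for A and i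
  proof -
    have "A ** transpose A = mat 1"
      using that by (auto simp: SO6_def rotation_matrix_def orthogonal_matrix_def)
    then have "(A ** transpose A) $ i $ i = 1" by (simp add: mat_def)
    then have "A $ i \<bullet> A $ i = 1" by (simp add: matrix_matrix_mult_def transpose_def inner_vec_def)
    then show ?thesis by (simp add: norm_eq_1)
  qed
  \<comment> \<open>The norm is at most the sum of the norms of the six rows, which are unit
    vectors.\<close>
  then have "norm A \<le> 6" if "A \<in> SO6" for A
    using L2_set_le_sum[of UNIV "\<lambda>i. norm (A $ i)"] that by (simp add: norm_vec_def)
  then have "bounded SO6" by (auto simp: bounded_iff)
  moreover have "closed SO6"
  proof -
    have eq: "SO6 = {A. transpose A ** A = mat 1} \<inter> {A. det A = 1}"
      by (auto simp: SO6_def rotation_matrix_def orthogonal_matrix)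
    have "closed {A :: real ^ 6 ^ 6. transpose A ** A = mat 1}"
      unfolding matrix_matrix_mult_def transpose_def vec_lambda_beta
      by (intro closed_Collect_eq continuous_on_vec_lambda continuous_intros)
    moreover have "closed {A :: real ^ 6 ^ 6. det A = 1}"
      unfolding det_def by (intro closed_Collect_eq continuous_intros)
    ultimately show ?thesis unfolding eq by (rule closed_Int)
  qed
  ultimately show ?thesis by (simp add: compact_eq_bounded_closed)
qed

lemma topspace_mod: "topspace U1_SO6_mod_Z2_topology = pair_coset ` (U1 \<times> SO6)"
  using quotient_imp_surjective_map[OF quotient_map_quotient_topology[of "top_of_set (U1 \<times> SO6)" pair_coset]]
  by (simp add: U1_SO6_mod_Z2_topology_def)

lemma quotient_map_mod: "quotient_map (top_of_set (U1 \<times> SO6)) U1_SO6_mod_Z2_topology pair_coset"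
  unfolding U1_SO6_mod_Z2_topology_def by (rule quotient_map_quotient_topology)

lemma compact_space_mod: "compact_space U1_SO6_mod_Z2_topology"
proof -
  have "compactin (top_of_set (U1 \<times> SO6)) (U1 \<times> SO6)"
    by (simp add: compactin_subtopology compact_Times compact_U1 compact_SO6)
  from image_compactin[OF this quotient_imp_continuous_map[OF quotient_map_mod]]
  show ?thesis by (simp add: compact_space_def topspace_mod)
qed

text \<open>Pointwise convergence is the product topology, and products and subspaces of Hausdorff
  spaces are Hausdorff.\<close>

lemma Hausdorff_fun: "Hausdorff_space (top_of_set (S :: (jc \<Rightarrow> jc) set))"
proof -
  have "Hausdorff_space (product_topology (\<lambda>i :: jc. euclidean :: jc topology) UNIV)"
    by (simp add: Hausdorff_space_product_topology)
  then show ?thesis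
    unfolding euclidean_product_topology by (rule Hausdorff_space_subtopology)
qed

lemma discrete_Z2: "top_of_set Z2_gammaH = discrete_topology Z2_gammaH"
  by (rule finite_t1_space_imp_discrete_topology)
    (auto simp: Z2_gammaH_eq intro: Hausdorff_imp_t1_space Hausdorff_fun)

lemma continuous_psi_coset: "continuous_map U1_SO6_mod_Z2_topology euclidean (\<lambda>C. psi_coset C X)"
proof -
  have "continuous_map (top_of_set (U1 \<times> SO6)) euclidean ((\<lambda>C. psi_coset C X) \<circ> pair_coset)"
    using continuous_psi[of "U1 \<times> SO6" X] by (simp add: comp_def psi_coset_eq)
  then show ?thesis
    using continuous_compose_quotient_map_eq[OF quotient_map_mod] by blast
qed

text \<open>Continuity is tested at each \<open>X\<close> separately. As the second factor is
  discrete, a preimage is open once its slice over each \<open>h\<close> is.\<close>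

lemma continuous_join_map:
  "continuous_map (prod_topology U1_SO6_mod_Z2_topology (top_of_set Z2_gammaH)) euclidean join_map"
proof -
  let ?T = "prod_topology U1_SO6_mod_Z2_topology (discrete_topology Z2_gammaH)"
  have "continuous_map ?T euclidean (\<lambda>z. join_map z X)" for X
    unfolding continuous_map_def
  proof (intro conjI allI impI)
    fix V :: "jc set" assume V: "openin euclidean V"
    let ?P = "\<lambda>h. {C \<in> topspace U1_SO6_mod_Z2_topology. join_map (C, h) X \<in> V}"
    have o: "openin U1_SO6_mod_Z2_topology (?P h)" for h
    proof (cases "X \<in> JC")
      case True
      then have "?P h = {C \<in> topspace U1_SO6_mod_Z2_topology. psi_coset C (h X) \<in> V}"
        by (simp add: join_map_def compose_def)
      then show ?thesis using continuous_psi_coset[of "h X"] V by (simp add: continuous_map_def)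
    next
      \<comment> \<open>Outside \<open>JC\<close> every composite has the value
        \<open>undefined\<close>, so the map is constant there.\<close>
      case False
      then have "?P h = (if undefined \<in> V then topspace U1_SO6_mod_Z2_topology else {})"
        by (auto simp: join_map_def compose_def)
      then show ?thesis by simp
    qed
    have "{z \<in> topspace ?T. join_map z X \<in> V} = (\<Union>h\<in>Z2_gammaH. ?P h \<times> {h})"
      by auto
    also have "openin ?T \<dots>"
      by (intro openin_Union) (auto simp: openin_prod_Times_iff o)
    finally show "openin ?T {z \<in> topspace ?T. join_map z X \<in> V}" .
  qed simp
  then have "continuous_map ?T (product_topology (\<lambda>i. euclidean) UNIV) join_map"
    unfolding continuous_map_componentwise_UNIV by blast
  then show ?thesis
    unfolding discrete_Z2 euclidean_product_topology .
qed

lemma homeomorphic_join_map: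
  "homeomorphic_map (prod_topology U1_SO6_mod_Z2_topology (top_of_set Z2_gammaH)) (top_of_set fixed_group) join_map"
proof (rule continuous_imp_homeomorphic_map)
  let ?T = "prod_topology U1_SO6_mod_Z2_topology (top_of_set Z2_gammaH)"
  have top: "topspace ?T = carrier semi_group"
    by (simp add: topspace_mod carrier_semi)
  show "join_map ` topspace ?T = topspace (top_of_set fixed_group)"
    unfolding top join_map_image by simp
  then show "continuous_map ?T (top_of_set fixed_group) join_map"
    using continuous_join_map by (auto simp: continuous_map_in_subtopology)
  show "inj_on join_map (topspace ?T)" unfolding top by (rule join_map_inj)
  show "Hausdorff_space (top_of_set fixed_group)" by (rule Hausdorff_fun)
  have "compact_space (top_of_set Z2_gammaH)"
    by (simp add: compact_space_subtopology compactin_euclidean_iff finite_imp_compact Z2_gammaH_eq)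
  then show "compact_space ?T"
    by (simp add: compact_space_prod_topology compact_space_mod)
qed

theorem theorem4p5p5:
  shows "\<exists>\<phi> \<in> iso (transf_group (E6_lam_gamma \<inter> E6_lam_gamma_gammaC))
                  (semidirect U1_SO6_mod_Z2 (transf_group Z2_gammaH) Z2_act).
           homeomorphic_map (top_of_set (E6_lam_gamma \<inter> E6_lam_gamma_gammaC))
             (prod_topology U1_SO6_mod_Z2_topology (top_of_set Z2_gammaH)) \<phi>"
proof -
  let ?T = "prod_topology U1_SO6_mod_Z2_topology (top_of_set Z2_gammaH)"
  obtain \<phi> where maps: "homeomorphic_maps ?T (top_of_set fixed_group) join_map \<phi>"
    using homeomorphic_join_map homeomorphic_map_maps by blast
  have top: "topspace ?T = carrier semi_group"
    by (simp add: topspace_mod carrier_semi)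
  have homeo: "homeomorphic_map (top_of_set fixed_group) ?T \<phi>"
    using maps homeomorphic_maps_sym homeomorphic_map_maps by blast
  have right: "join_map (\<phi> \<alpha>) = \<alpha>" if "\<alpha> \<in> fixed_group" for \<alpha>
    using maps that unfolding homeomorphic_maps_def by simp
  have left: "\<phi> (join_map z) = z" if "z \<in> carrier semi_group" for z
    using maps that unfolding homeomorphic_maps_def top by blast
  have bij: "bij_betw \<phi> fixed_group (carrier semi_group)"
    using homeomorphic_imp_injective_map[OF homeo] homeomorphic_imp_surjective_map[OF homeo]
    unfolding top bij_betw_def by simp
  have mem: "\<phi> \<alpha> \<in> carrier semi_group" if "\<alpha> \<in> fixed_group" for \<alpha>
    using bij_betwE[OF bij] that by blast
  have "\<phi> \<in> iso (transf_group fixed_group) semi_group"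
  proof (rule isoI)
    show "\<phi> \<in> hom (transf_group fixed_group) semi_group"
    proof (rule homI)
      fix \<alpha> \<beta> assume "\<alpha> \<in> carrier (transf_group fixed_group)" "\<beta> \<in> carrier (transf_group fixed_group)"
      then have ab: "\<alpha> \<in> fixed_group" "\<beta> \<in> fixed_group" by simp_all
      note m = join_map_mult[OF mem[OF ab(1)] mem[OF ab(2)]]
      \<comment> \<open>Multiplicativity of \<open>join_map\<close> is read backwards; the closure
        part of \<open>m\<close> then lets \<open>left\<close> cancel it against
        \<open>\<phi>\<close>.\<close>
      have "\<alpha> \<otimes>\<^bsub>transf_group fixed_group\<^esub> \<beta> = join_map (\<phi> \<alpha> \<otimes>\<^bsub>semi_group\<^esub> \<phi> \<beta>)"
        using m right[OF ab(1)] right[OF ab(2)] mult_transf[OF fixed_Bij ab] by simp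
      then show "\<phi> (\<alpha> \<otimes>\<^bsub>transf_group fixed_group\<^esub> \<beta>) = \<phi> \<alpha> \<otimes>\<^bsub>semi_group\<^esub> \<phi> \<beta>"
        by (simp only: left[OF conjunct1[OF m]])
    qed (simp add: mem)
    show "bij_betw \<phi> (carrier (transf_group fixed_group)) (carrier semi_group)"
      using bij by simp
  qed
  then show ?thesis using homeo by blast
qed

end
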